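(* Consider the composite bilinear form on the space $\bm W_h\times Q_h$, $$\mathcal L(\bm w_h,p_h;\bm r_h,q_h):=a(\bm w_h,\bm r_h)+a^D(\bm D_hp_h,\bm r_h)+a^D(\bm D_hq_h,\bm w_h),$$ and the norm $|||(\bm r_h,q_h)|||^2:=a(\bm r_h,\bm r_h)+a^D(\bm D_hq_h,\bm D_hq_h)$. Then $\mathcal L$ satisfies the continuity condition and the inf-sup condition with respect to $|||\cdot|||$: for any $(\bm w_h,p_h)\in\bm W_h\times Q_h$ and $(\bm r_h,q_h)\in\bm W_h\times Q_h$, $$|\mathcal L(\bm w_h,p_h;\bm r_h,q_h)|\le\alpha\,|||(\bm w_h,p_h)|||\,|||(\bm r_h,q_h)|||,$$ $$\inf_{(\bm r_h,q_h)\in\bm W_h\times Q_h}\ \sup_{(\bm w_h,p_h)\in\bm W_h\times Q_h}\frac{\mathcal L(\bm w_h,p_h;\bm r_h,q_h)}{|||(\bm w_h,p_h)|||\,|||(\bm r_h,q_h)|||}\ge\beta$$ (infimum and supremum over nonzero elements), with constants $\alpha,\beta>0$ dependent on the shape regularity of the mesh but independent of the discretization and physical parameters (i.e. of $h$, $K$, $K_{\bm\nu}$, $\gamma$).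
   Context: **Geometry.** Let $n\in\{2,3\}$. A fractured porous medium of rectangular type (fractures are line segments if $n=2$, flat surfaces if $n=3$) is decomposed by the fractures into $n$-dimensional subdomains $\Omega_i^n$, $i\in I^n$; fractures and their intersections are lower-dimensional subdomains $\Omega_i^d$, $i\in I^d$, $0\le d<n$. For $0\le d\le n-1$ and $i\in I^d$, $\Gamma_{ij}^d$ ($j\in J_i^d$) are the interfaces between $\Omega_i^d$ and the adjacent $(d+1)$-dimensional subdomains. Set $\Omega^d=\bigcup_i\Omega_i^d$, $\Gamma^d=\bigcup_i\bigcup_j\Gamma_{ij}^d$, $\Omega=\bigcup_{d=0}^n\Omega^d$, $\Gamma=\bigcup_{d=0}^{n-1}\Gamma^d$. The boundary splits disjointly as $\partial\Omega=\partial\Omega_D\cup\partial\Omega_N$ with $\partial\Omega_D$ of positive measure; $\partial\Omega_N^d$ is the part of $\partial\Omega_N$ on $\partial\Omega^d$; $\bm\nu$ is the outward unit normal. **Physical parameters.** The permeability $K$ (on $\Omega$) and normal permeability $K_{\bm\nu}$ (on $\Gamma$) are symmetric positive definite tensors bounded above and below; $\gamma>0$ on $\Gamma$ (distance from $\Gamma_{ij}^d$ to $\Omega_i^d$; the aperture for $d=n-1$). All are assumed constant on each subdomain/interface. **Spaces.** $\bm V^d=\{\bm v\in (L^2(\Omega^d))^d:\nabla\cdot\bm v\in L^2(\Omega^d),\ \bm v\cdot\bm\nu=0 \text{ on }\partial\Omega_N^d\}$ for $1\le d\le n$; $\bm V_0^d=\{\bm v\in\bm V^d:\bm v\cdot\bm\nu=0\text{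 on }\Gamma^{d-1}\}$; $\Lambda^d=L^2(\Gamma^d)$ for $0\le d\le n-1$; $Q^d=L^2(\Omega^d)$ for $0\le d\le n$. On shape-regular simplicial triangulations $\mathcal T^d_\Omega$ of $\Omega^d$ and $\mathcal T^d_\Gamma$ of $\Gamma^d$ (maximal mesh size $h$), $\bm V_h^d\subset\bm V^d$ and $\bm V_{0h}^d\subset\bm V_0^d$ are lowest-order Raviart–Thomas spaces $\mathbb{RT}_0(\mathcal T_\Omega^d)$, $\Lambda_h^d=\mathbb P_0(\mathcal T_\Gamma^d)$ and $Q_h^d=\mathbb P_0(\mathcal T_\Omega^d)$ (piecewise constants). Put $\bm V_{0h}=\bigoplus_{d=1}^n\bm V_{0h}^d$, $\Lambda_h=\bigoplus_{d=0}^{n-1}\Lambda_h^d$, $Q_h=\bigoplus_{d=0}^nQ_h^d$, $\bm W_h=\bm V_{0h}\times\Lambda_h$. **Discrete extension.** $\widehat\Pi_h^d:\Lambda_h^d\to\bm V_h^{d+1}\cdot\bm\nu|_{\Gamma^d}$ is the $L^2$-projection, $(\widehat\Pi_h^d\mu-\mu,\bm v\cdot\bm\nu)_{L^2(\Gamma^d)}=0$ for all $\bm v\in\bm V_h^{d+1}$. $R_h^d:\Lambda_h^d\to\bm V_h^{d+1}$ is defined by $R_h^d\lambda\cdot\bm\nu=\widehat\Pi_h^d\lambda$ on $\Gamma^d$ and $0$ elsewhere (all other facet normal components vanish); $R_h=\bigoplus_{d=0}^{n-1}R_h^d$. **Forms.** $(\cdot,\cdot)_\Omega$, $(\cdot,\cdot)_\Gamma$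 are the sums of the $L^2$ inner products over all subdomains, respectively interfaces, with the convention that flux components for $d=0$ and mortar components for $d=n$ are zero. The jump is $\llbracket\lambda\rrbracket|_{\Omega_i^d}=-\sum_{j\in J_i^d}\lambda_{ij}^d$, and $\bm D\cdot[\bm u,\lambda]=\nabla\cdot\bm u+\llbracket\lambda\rrbracket$. For $\bm w_h=[\bm u_{0h},\lambda_h]$, $\bm r_h=[\bm v_{0h},\mu_h]\in\bm W_h$, $q_h\in Q_h$: $$a(\bm w_h,\bm r_h)=(K^{-1}(\bm u_{0h}+R_h\lambda_h),\bm v_{0h}+R_h\mu_h)_\Omega+(\gamma K_{\bm\nu}^{-1}\lambda_h,\mu_h)_\Gamma,$$ $$b(\bm r_h,q_h)=-(q_h,\bm D\cdot[\bm v_{0h}+R_h\mu_h,\mu_h])_\Omega,$$ $$a^D(\bm w_h,\bm r_h)=(K^{-1}(\bm u_{0h}+R_h\lambda_h),\bm v_{0h}+R_h\mu_h)_{D,\Omega}+(\gamma K_{\bm\nu}^{-1}\lambda_h,\mu_h)_\Gamma,$$ where $$(K^{-1}\bm u,\bm v)_{D,\Omega}=\sum_{d=0}^n\sum_{T\in\mathcal T_\Omega^d}\sum_{f\in\partial T}(\bm u\cdot\bm\nu_f)(\bm v\cdot\bm\nu_f)(K^{-1}\bm\phi_f,\bm\phi_f)_T.$$ Here $f$ runs over the faces of the element $T$, $\bm\nu_f$ is the unit outer normal of $f$, and $\bm\phi_f\in\mathbb{RT}_0(T)$ is the basis function of face $f$ (so $\bm v|_T=\sum_f(\bm v\cdot\bm\nu_f)\bm\phi_f$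 for $\bm v\in\mathbb{RT}_0(T)$). The discrete gradient $\bm D_h:Q_h\to\bm W_h$ is defined by $a^D(\bm D_hp_h,\bm r_h)=b(\bm r_h,p_h)$ for all $\bm r_h\in\bm W_h$.
   Formalization: The continuity constant α may depend on a bound for the anisotropy of K on each subdomain (ratio of its upper to lower bound), since independence of arbitrary K is false; β is independent of all K. The medium is assumed connected through interfaces, so that the norm is a norm. *)

theory Defs
  imports "HOL-Analysis.Analysis" "HOL-Library.Function_Algebras"
begin

section \<open>Calculus on flat sets\<close>

definition tangent :: "'a::euclidean_space set \<Rightarrow> 'a set" where
  "tangent S = span {x - y | x y. x \<in> S \<and> y \<in> S}"

definition onb :: "'a::euclidean_space set \<Rightarrow> 'a set" where
  "onb S = (SOME B. B \<subseteq> tangent S \<and> pairwise orthogonal B \<and> (\<forall>b\<in>B. norm b = 1) \<and> span B = tangent S)"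

text \<open>The $d$-dimensional Lebesgue measure on the affine hull of \<open>S\<close>, where $d$ is the dimension
  of that hull: the image of the product measure under a Euclidean coordinate system (compare
  \<open>lborel_eq\<close>). It does not depend on the choice of the frame or of the origin, and for
  \<open>S = {p}\<close> it is the unit mass at \<open>p\<close>.\<close>

definition flat_measure :: "'a::euclidean_space set \<Rightarrow> 'a measure" where
  "flat_measure S =
     distr (\<Pi>\<^sub>M b\<in>onb S. lborel) borel (\<lambda>t. (SOME x. x \<in> S) + (\<Sum>b\<in>onb S. t b *\<^sub>R b))"

definition flat_div :: "'a::euclidean_space set \<Rightarrow> ('a \<Rightarrow> 'a) \<Rightarrow> 'a \<Rightarrow> real" where
  "flat_div S v x = (\<Sum>b\<in>onb S. b \<bullet> frechet_derivative v (at x) b)"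

section \<open>Simplices, triangulations and the local Raviart--Thomas space\<close>

definition outer_normal :: "'a::euclidean_space set \<Rightarrow> 'a set \<Rightarrow> 'a" where
  "outer_normal T f =
     (THE \<nu>. \<nu> \<in> tangent T \<and> norm \<nu> = 1 \<and>
        (\<exists>c. (\<forall>x\<in>f. \<nu> \<bullet> x = c) \<and> (\<forall>x\<in>T. \<nu> \<bullet> x \<le> c)))"

text \<open>Only cells \<open>T\<close> lying on one side of each boundary piece of \<open>A\<close> are admitted
  (\<open>rel_interior T \<subseteq> A\<close>); this matters when \<open>A\<close> is slit by an immersed fracture, so that
  \<open>A\<close> is smaller than the relative interior of its closure.\<close>

definition triangulates :: "nat \<Rightarrow> 'a::euclidean_space set set \<Rightarrow> 'a set \<Rightarrow> bool" where
  "triangulates d \<T> A \<longleftrightarrow>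
     triangulation \<T> \<and> (\<forall>T\<in>\<T>. int d simplex T \<and> rel_interior T \<subseteq> A) \<and> \<Union>\<T> = closure A"

text \<open>The ratio of the diameter to the radius of an inscribed ball is at most \<open>\<sigma>\<close>.\<close>

definition shape_regular :: "real \<Rightarrow> 'a::euclidean_space set set \<Rightarrow> bool" where
  "shape_regular \<sigma> \<T> \<longleftrightarrow>
     (\<forall>T\<in>\<T>. \<exists>x r. 0 < r \<and> x \<in> T \<and> cball x r \<inter> affine hull T \<subseteq> T \<and> diameter T \<le> \<sigma> * r)"

text \<open>Polynomial fields on \<open>T\<close>, with values in the tangent space of \<open>T\<close>. They are written as
  functions on the whole space; each of them is determined by its values on \<open>T\<close> when \<open>T\<close> is a
  simplex of positive dimension.\<close>

definition RT0 :: "'a::euclidean_space set \<Rightarrow> ('a \<Rightarrow> 'a) set" where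
  "RT0 T = {v. \<exists>a\<in>tangent T. \<exists>b. \<exists>c\<in>T. v = (\<lambda>x. a + b *\<^sub>R (x - c))}"

text \<open>The normal component of a field in \<open>RT0 T\<close> is constant on every facet of \<open>T\<close>.\<close>

definition normal_comp :: "('a::euclidean_space \<Rightarrow> 'a) \<Rightarrow> 'a set \<Rightarrow> 'a set \<Rightarrow> real" where
  "normal_comp v T f = (THE c. \<forall>x\<in>f. v x \<bullet> outer_normal T f = c)"

definition facet_basis :: "'a::euclidean_space set \<Rightarrow> 'a set \<Rightarrow> 'a \<Rightarrow> 'a" where
  "facet_basis T f =
     (THE \<phi>. \<phi> \<in> RT0 T \<and> (\<forall>g. g facet_of T \<longrightarrow> normal_comp \<phi> T g = (if g = f then 1 else 0)))"

text \<open>A piecewise polynomial is represented by the family of its polynomial pieces, indexed by the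
  cells (and zero at indices that are not cells), so that equality of families is equality
  almost everywhere. A piecewise constant as a function of the point:\<close>

definition P0_fun :: "'a::euclidean_space set set \<Rightarrow> ('a set \<Rightarrow> real) \<Rightarrow> 'a \<Rightarrow> real" where
  "P0_fun \<T> q x = (\<Sum>T\<in>\<T>. q T * indicator (rel_interior T) x)"

section \<open>Fractured media\<close>

text \<open>Subdomains $\Omega_i^d$ are numbered by \<open>subs\<close>, the dimension being \<open>sdim\<close>. Interfaces
  $\Gamma_{ij}^d$ are numbered by \<open>ifaces\<close>: \<open>lower\<close> is the index of $\Omega_i^d$, \<open>upper\<close> that of
  the adjacent $(d+1)$-dimensional subdomain, and \<open>inormal\<close> is the unit normal on the interface
  that points out of the upper subdomain. In the reduced model $\Gamma_{ij}^d$ occupies the same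
  point set as $\Omega_i^d$. The normal distinguishes the two sides of a fracture, also
  when both sides border the same upper subdomain.\<close>

record 'a medium =
  subs :: "nat set"
  sdim :: "nat \<Rightarrow> nat"
  sdom :: "nat \<Rightarrow> 'a set"
  ifaces :: "nat set"
  lower :: "nat \<Rightarrow> nat"
  upper :: "nat \<Rightarrow> nat"
  inormal :: "nat \<Rightarrow> 'a"
  bdryD :: "'a set"
  bdryN :: "'a set"

record 'a problem = "'a medium" +
  perm :: "nat \<Rightarrow> 'a \<Rightarrow> 'a"
  nperm :: "nat \<Rightarrow> real"
  aper :: "nat \<Rightarrow> real"

record 'a discretization = "'a problem" +
  cells :: "nat \<Rightarrow> 'a set set"
  mcells :: "nat \<Rightarrow> 'a set set"

definition Omega :: "('a, 'z) medium_scheme \<Rightarrow> 'a set" where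
  "Omega D = (\<Union>i\<in>subs D. sdom D i)"

definition iface_dom :: "('a, 'z) medium_scheme \<Rightarrow> nat \<Rightarrow> 'a set" where
  "iface_dom D e = sdom D (lower D e)"

definition adjacent :: "('a::euclidean_space, 'z) medium_scheme \<Rightarrow> nat \<Rightarrow> nat \<Rightarrow> 'a \<Rightarrow> bool" where
  "adjacent D i k \<nu> \<longleftrightarrow>
     sdim D k = Suc (sdim D i) \<and>
     \<nu> \<in> tangent (sdom D k) \<and> norm \<nu> = 1 \<and> (\<forall>\<xi>\<in>tangent (sdom D i). \<nu> \<bullet> \<xi> = 0) \<and>
     (\<forall>x\<in>sdom D i. \<exists>\<epsilon>>0. \<forall>t. 0 < t \<and> t < \<epsilon> \<longrightarrow> x - t *\<^sub>R \<nu> \<in> sdom D k)"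

text \<open>The subdomains are relatively open, connected, flat and disjoint. The boundary of \<open>Omega\<close>
  contains the outer boundary, and also the immersed tips of fractures, which belong to no
  subdomain. The medium is connected in the sense that any two subdomains are linked by a chain of
  interfaces; without this some part of the medium could be cut off from the Dirichlet boundary.
  The Dirichlet boundary has positive $(n-1)$-dimensional measure within some hyperplane.\<close>

definition fractured_medium :: "('a::euclidean_space, 'z) medium_scheme \<Rightarrow> bool" where
  "fractured_medium D \<longleftrightarrow>
     finite (subs D) \<and> finite (ifaces D) \<and>
     (\<forall>i\<in>subs D. aff_dim (sdom D i) = int (sdim D i) \<and> connected (sdom D i) \<and>
        openin (top_of_set (affine hull (sdom D i))) (sdom D i)) \<and>
     disjoint_family_on (sdom D) (subs D) \<and>
     open (Omega D) \<and>
     bij_betw (\<lambda>e. (lower D e, upper D e, inormal D e)) (ifaces D)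
       {(i, k, \<nu>). i \<in> subs D \<and> k \<in> subs D \<and> adjacent D i k \<nu>} \<and>
     (\<forall>i\<in>subs D. \<forall>k\<in>subs D.
        (i, k) \<in> ((\<lambda>e. (lower D e, upper D e)) ` ifaces D \<union>
                  (\<lambda>e. (upper D e, lower D e)) ` ifaces D)\<^sup>*) \<and>
     bdryD D \<union> bdryN D = frontier (Omega D) \<and> bdryD D \<inter> bdryN D = {} \<and>
     (\<exists>H. affine H \<and> aff_dim H = int DIM('a) - 1 \<and>
        0 < emeasure (flat_measure H) (bdryD D \<inter> H))"

text \<open>The permeability is a symmetric positive definite operator on the tangent space of each
  subdomain. The normal permeability multiplies the scalar normal flux on an interface and
  is a positive number.\<close>

definition physical_parameters :: "('a::euclidean_space, 'z) problem_scheme \<Rightarrow> bool" where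
  "physical_parameters D \<longleftrightarrow>
     (\<forall>i\<in>subs D. linear (perm D i) \<and> perm D i ` tangent (sdom D i) \<subseteq> tangent (sdom D i) \<and>
        (\<forall>\<xi>\<in>tangent (sdom D i). \<forall>\<eta>\<in>tangent (sdom D i). perm D i \<xi> \<bullet> \<eta> = \<xi> \<bullet> perm D i \<eta>) \<and>
        (\<forall>\<xi>\<in>tangent (sdom D i). \<xi> \<noteq> 0 \<longrightarrow> 0 < perm D i \<xi> \<bullet> \<xi>)) \<and>
     (\<forall>e\<in>ifaces D. 0 < nperm D e \<and> 0 < aper D e)"

text \<open>Upper and lower bounds of the permeability, on each subdomain separately, have ratio at
  most \<open>\<kappa>\<close>. This limits the anisotropy, not the size of the permeability nor its
  variation between subdomains; an isotropic permeability satisfies it with \<open>\<kappa> = 1\<close>.\<close>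

definition perm_bounds :: "real \<Rightarrow> ('a::euclidean_space, 'z) problem_scheme \<Rightarrow> bool" where
  "perm_bounds \<kappa> D \<longleftrightarrow>
     (\<forall>i\<in>subs D. \<exists>k>0. \<forall>\<xi>\<in>tangent (sdom D i).
        k * (\<xi> \<bullet> \<xi>) \<le> perm D i \<xi> \<bullet> \<xi> \<and> perm D i \<xi> \<bullet> \<xi> \<le> \<kappa> * k * (\<xi> \<bullet> \<xi>))"

definition perm_inv :: "('a::euclidean_space, 'z) problem_scheme \<Rightarrow> nat \<Rightarrow> 'a \<Rightarrow> 'a" where
  "perm_inv D i = inv_into (tangent (sdom D i)) (perm D i)"

section \<open>Meshes\<close>

text \<open>The facets of cells of the upper subdomain that lie on the given side of an interface.\<close>

definition iface_facet :: "('a::euclidean_space, 'z) discretization_scheme \<Rightarrow> nat \<Rightarrow> 'a set \<Rightarrow> 'a set \<Rightarrow> bool" where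
  "iface_facet D e T f \<longleftrightarrow>
     T \<in> cells D (upper D e) \<and> f facet_of T \<and> f \<subseteq> closure (iface_dom D e) \<and>
     outer_normal T f = inormal D e"

definition trace_cells :: "('a::euclidean_space, 'z) discretization_scheme \<Rightarrow> nat \<Rightarrow> 'a set set" where
  "trace_cells D e = {f. \<exists>T. iface_facet D e T f}"

definition on_iface :: "('a::euclidean_space, 'z) discretization_scheme \<Rightarrow> nat \<Rightarrow> 'a set \<Rightarrow> 'a set \<Rightarrow> bool" where
  "on_iface D i T f \<longleftrightarrow> (\<exists>e\<in>ifaces D. upper D e = i \<and> iface_facet D e T f)"

text \<open>The mesh of an interface and the trace of the mesh of the upper subdomain need not match.\<close>

definition mesh :: "real \<Rightarrow> ('a::euclidean_space, 'z) discretization_scheme \<Rightarrow> bool" where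
  "mesh \<sigma> D \<longleftrightarrow>
     (\<forall>i\<in>subs D. triangulates (sdim D i) (cells D i) (sdom D i) \<and> shape_regular \<sigma> (cells D i) \<and>
        (\<forall>T\<in>cells D i. \<forall>f. f facet_of T \<longrightarrow>
           rel_interior f \<subseteq> sdom D i \<or> on_iface D i T f \<or>
           rel_interior f \<subseteq> bdryD D \<or> rel_interior f \<subseteq> bdryN D)) \<and>
     (\<forall>e\<in>ifaces D. triangulates (sdim D (lower D e)) (mcells D e) (iface_dom D e) \<and>
        shape_regular \<sigma> (mcells D e) \<and> \<Union>(trace_cells D e) = closure (iface_dom D e))"

definition admissible :: "real \<Rightarrow> 'a::euclidean_space discretization \<Rightarrow> bool" where
  "admissible \<sigma> D \<longleftrightarrow> fractured_medium D \<and> physical_parameters D \<and> mesh \<sigma> D"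

section \<open>Discrete spaces\<close>

type_synonym 'a flux = "nat \<Rightarrow> 'a set \<Rightarrow> 'a \<Rightarrow> 'a"
type_synonym 'a pwconst = "nat \<Rightarrow> 'a set \<Rightarrow> real"

text \<open>The space $\bigoplus_{d=1}^n \bm V_h^d$: normal components are continuous across the facets
  inside a subdomain (the two outer normals are opposite) and vanish on the Neumann boundary.\<close>

definition Vh :: "'a::euclidean_space discretization \<Rightarrow> 'a flux set" where
  "Vh D = {v.
     (\<forall>i T. if i \<in> subs D \<and> 1 \<le> sdim D i \<and> T \<in> cells D i then v i T \<in> RT0 T else v i T = 0) \<and>
     (\<forall>i\<in>subs D. \<forall>T\<in>cells D i. \<forall>T'\<in>cells D i. \<forall>f.
        T \<noteq> T' \<and> f facet_of T \<and> f facet_of T' \<and> rel_interior f \<subseteq> sdom D i \<longrightarrow>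
        normal_comp (v i T) T f + normal_comp (v i T') T' f = 0) \<and>
     (\<forall>i\<in>subs D. \<forall>T\<in>cells D i. \<forall>f.
        f facet_of T \<and> \<not> on_iface D i T f \<and> rel_interior f \<subseteq> bdryN D \<longrightarrow>
        normal_comp (v i T) T f = 0)}"

definition V0h :: "'a::euclidean_space discretization \<Rightarrow> 'a flux set" where
  "V0h D = {v \<in> Vh D. \<forall>i\<in>subs D. \<forall>T\<in>cells D i. \<forall>f. on_iface D i T f \<longrightarrow> normal_comp (v i T) T f = 0}"

definition Lh :: "'a::euclidean_space discretization \<Rightarrow> 'a pwconst set" where
  "Lh D = {\<mu>. \<forall>e S. \<not> (e \<in> ifaces D \<and> S \<in> mcells D e) \<longrightarrow> \<mu> e S = 0}"

definition Qh :: "'a::euclidean_space discretization \<Rightarrow> 'a pwconst set" where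
  "Qh D = {q. \<forall>i T. \<not> (i \<in> subs D \<and> T \<in> cells D i) \<longrightarrow> q i T = 0}"

definition Wh :: "'a::euclidean_space discretization \<Rightarrow> ('a flux \<times> 'a pwconst) set" where
  "Wh D = V0h D \<times> Lh D"

section \<open>Discrete extension\<close>

text \<open>The normal trace $\bm v\cdot\bm\nu|_\Gamma$, a piecewise constant on \<open>trace_cells\<close>.\<close>

definition normal_trace :: "'a::euclidean_space discretization \<Rightarrow> 'a flux \<Rightarrow> 'a pwconst" where
  "normal_trace D v e f =
     (if e \<in> ifaces D \<and> f \<in> trace_cells D e
      then let T = (THE T. iface_facet D e T f) in normal_comp (v (upper D e) T) T f else 0)"

definition Pi_h :: "'a::euclidean_space discretization \<Rightarrow> 'a pwconst \<Rightarrow> 'a pwconst" where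
  "Pi_h D \<mu> = (THE g. g \<in> normal_trace D ` Vh D \<and>
     (\<forall>v\<in>Vh D.
        (\<Sum>e\<in>ifaces D. LINT x:iface_dom D e|flat_measure (iface_dom D e).
           (P0_fun (trace_cells D e) (g e) x - P0_fun (mcells D e) (\<mu> e) x) *
           P0_fun (trace_cells D e) (normal_trace D v e) x) = 0))"

definition R_h :: "'a::euclidean_space discretization \<Rightarrow> 'a pwconst \<Rightarrow> 'a flux" where
  "R_h D \<mu> = (THE v. v \<in> Vh D \<and> normal_trace D v = Pi_h D \<mu> \<and>
     (\<forall>i\<in>subs D. \<forall>T\<in>cells D i. \<forall>f. f facet_of T \<and> \<not> on_iface D i T f \<longrightarrow>
        normal_comp (v i T) T f = 0))"

section \<open>Bilinear forms\<close>

definition jump :: "('a::euclidean_space, 'z) discretization_scheme \<Rightarrow> 'a pwconst \<Rightarrow> nat \<Rightarrow> 'a \<Rightarrow> real" where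
  "jump D \<mu> i x = - (\<Sum>e\<in>{e \<in> ifaces D. lower D e = i}. P0_fun (mcells D e) (\<mu> e) x)"

definition inner_K :: "'a::euclidean_space discretization \<Rightarrow> 'a flux \<Rightarrow> 'a flux \<Rightarrow> real" where
  "inner_K D u v = (\<Sum>i\<in>subs D. \<Sum>T\<in>cells D i.
     LINT x:T|flat_measure T. perm_inv D i (u i T x) \<bullet> v i T x)"

definition inner_KD :: "'a::euclidean_space discretization \<Rightarrow> 'a flux \<Rightarrow> 'a flux \<Rightarrow> real" where
  "inner_KD D u v = (\<Sum>i\<in>subs D. \<Sum>T\<in>cells D i. \<Sum>f\<in>{f. f facet_of T}.
     normal_comp (u i T) T f * normal_comp (v i T) T f *
     (LINT x:T|flat_measure T. perm_inv D i (facet_basis T f x) \<bullet> facet_basis T f x))"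

definition inner_Gamma :: "'a::euclidean_space discretization \<Rightarrow> 'a pwconst \<Rightarrow> 'a pwconst \<Rightarrow> real" where
  "inner_Gamma D \<theta> \<mu> = (\<Sum>e\<in>ifaces D. LINT x:iface_dom D e|flat_measure (iface_dom D e).
     aper D e * inverse (nperm D e) * P0_fun (mcells D e) (\<theta> e) x * P0_fun (mcells D e) (\<mu> e) x)"

definition form_a :: "'a::euclidean_space discretization \<Rightarrow> 'a flux \<times> 'a pwconst \<Rightarrow> 'a flux \<times> 'a pwconst \<Rightarrow> real" where
  "form_a D w r = (case (w, r) of ((u, \<theta>), (v, \<mu>)) \<Rightarrow>
     inner_K D (u + R_h D \<theta>) (v + R_h D \<mu>) + inner_Gamma D \<theta> \<mu>)"

definition form_aD :: "'a::euclidean_space discretization \<Rightarrow> 'a flux \<times> 'a pwconst \<Rightarrow> 'a flux \<times> 'a pwconst \<Rightarrow> real" where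
  "form_aD D w r = (case (w, r) of ((u, \<theta>), (v, \<mu>)) \<Rightarrow>
     inner_KD D (u + R_h D \<theta>) (v + R_h D \<mu>) + inner_Gamma D \<theta> \<mu>)"

definition form_b :: "'a::euclidean_space discretization \<Rightarrow> 'a flux \<times> 'a pwconst \<Rightarrow> 'a pwconst \<Rightarrow> real" where
  "form_b D r q = (case r of (v, \<mu>) \<Rightarrow>
     - (\<Sum>i\<in>subs D. \<Sum>T\<in>cells D i. LINT x:T|flat_measure T.
          q i T * (flat_div T ((v + R_h D \<mu>) i T) x + jump D \<mu> i x)))"

definition grad_h :: "'a::euclidean_space discretization \<Rightarrow> 'a pwconst \<Rightarrow> 'a flux \<times> 'a pwconst" where
  "grad_h D p = (THE w. w \<in> Wh D \<and> (\<forall>r\<in>Wh D. form_aD D w r = form_b D r p))"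

definition form_L ::
  "'a::euclidean_space discretization \<Rightarrow> ('a flux \<times> 'a pwconst) \<times> 'a pwconst \<Rightarrow>
   ('a flux \<times> 'a pwconst) \<times> 'a pwconst \<Rightarrow> real" where
  "form_L D x y = (case (x, y) of ((w, p), (r, q)) \<Rightarrow>
     form_a D w r + form_aD D (grad_h D p) r + form_aD D (grad_h D q) w)"

definition triple_norm :: "'a::euclidean_space discretization \<Rightarrow> ('a flux \<times> 'a pwconst) \<times> 'a pwconst \<Rightarrow> real" where
  "triple_norm D y = (case y of (r, q) \<Rightarrow>
     sqrt (form_a D r r + form_aD D (grad_h D q) (grad_h D q)))"

end

theory Submission
  imports Defs
begin

text \<open>
The form \<open>a\<close> measures the total flux in the exact mass matrix, the form \<open>a\<^sup>D\<close> in its lumped version, which is diagonal in the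
facet normal components.  The theorem rests on comparing the two on \<open>W\<^sub>h\<close>.

On a cell \<open>T\<close> a field is \<open>v = \<Sum>f. c\<^sub>f \<phi>\<^sub>f\<close> with at most four terms, so \<open>a \<le> 4 a\<^sup>D\<close> by Cauchy--Schwarz (\<open>form_a_le\<close>), with a
constant that depends on nothing.  The converse \<open>a\<^sup>D \<le> C\<^sup>2 a\<close> (\<open>form_aD_le\<close>) is where shape regularity and anisotropy enter.
On the one hand \<open>\<phi>\<^sub>f\<close> is bounded by \<open>\<sigma>\<close> (\<open>facet_basis_bound\<close>).  On the other hand \<open>c\<^sub>f\<close> is controlled by the mean
square of \<open>v\<close> (\<open>cell_form_lower\<close>): along the normal of \<open>f\<close> the field is an affine function of one barycentric coordinate,
and such a function cannot be small both near the facet and far from it.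

Given these bounds, continuity is Cauchy--Schwarz in three terms (\<open>saddle_continuity\<close>).  For the inf-sup condition let
\<open>Q = D\<^sub>h q\<close> and take \<open>w = r + Q/2\<close>, \<open>p = - q\<close>: the terms \<open>a\<^sup>D(D\<^sub>h p, r)\<close> and \<open>a\<^sup>D(Q, r)\<close> cancel, and
\<open>a \<le> 4 a\<^sup>D\<close> makes the remainder \<open>a(r, r) + a(Q, r)/2 + a\<^sup>D(Q, Q)/2\<close> coercive (\<open>saddle_infsup\<close>).

The quotient in the inf-sup condition has to be well defined, so the triple norm must be a norm.  For the mixed variable this
is unisolvence of the Raviart--Thomas element.  For the pressure it says that \<open>D\<^sub>h q = 0\<close> implies \<open>q = 0\<close>
(\<open>ker_zero\<close>).  Testing with a flux through one inner facet shows that \<open>q\<close> has the same value on both sides (\<open>ker_interior\<close>),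
and the cells of a connected subdomain are linked through facets (\<open>cells_chain\<close>), so \<open>q\<close> is constant on each subdomain.
Testing with a unit mortar relates the constants on the two sides of an interface (\<open>ker_iface\<close>).  A flux through a facet on
the Dirichlet boundary shows that one of them is zero (\<open>ker_dirichlet\<close>, \<open>dirichlet_facet\<close>), and interfaces link all subdomains.

Two kinds of auxiliary facts make this rigorous.  The measure on a flat set is carried by an isometric chart to Lebesgue
measure on \<open>real^d\<close> for \<open>d = 1, 2, 3\<close>, which yields the behaviour under homotheties and shears.  The objects given by
definite descriptions are identified explicitly: facet basis fields as radial fields from the opposite vertex, \<open>Pi_h\<close> as an
average over facets, \<open>R_h\<close> by its normal components, and the discrete gradient by Riesz representation.
\<close>

section \<open>Semidefinite forms and the two saddle point estimates\<close>

text \<open>Scalar multiplication is an explicit parameter, and the form is only required to be symmetric and positive semidefinite on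
a subspace: the discrete spaces are subspaces of function types.\<close>

locale psd_form = vector_space sc for sc :: "real \<Rightarrow> 'w::ab_group_add \<Rightarrow> 'w" +
  fixes W :: "'w set" and B :: "'w \<Rightarrow> 'w \<Rightarrow> real"
  assumes W: "subspace W"
    and add_left: "\<lbrakk>x \<in> W; y \<in> W; z \<in> W\<rbrakk> \<Longrightarrow> B (x + y) z = B x z + B y z"
    and scale_left: "\<lbrakk>x \<in> W; z \<in> W\<rbrakk> \<Longrightarrow> B (sc c x) z = c * B x z"
    and sym: "\<lbrakk>x \<in> W; y \<in> W\<rbrakk> \<Longrightarrow> B x y = B y x"
    and nonneg: "x \<in> W \<Longrightarrow> 0 \<le> B x x"
begin

lemma add_right: "\<lbrakk>x \<in> W; y \<in> W; z \<in> W\<rbrakk> \<Longrightarrow> B z (x + y) = B z x + B z y"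
  using W by (metis add_left sym subspace_add)

lemma scale_right: "\<lbrakk>x \<in> W; z \<in> W\<rbrakk> \<Longrightarrow> B z (sc c x) = c * B z x"
  using W by (metis scale_left sym subspace_scale)

lemma expand_square:
  assumes "x \<in> W" "y \<in> W"
  shows "B (x + sc t y) (x + sc t y) = B x x + 2 * t * B x y + t\<^sup>2 * B y y"
proof -
  have ty: "sc t y \<in> W" using assms W by (simp add: subspace_scale)
  then show ?thesis
    using assms W
    by (simp add: add_left add_right scale_left scale_right subspace_add sym[of y x] power2_eq_square
        algebra_simps)
qed

lemma cauchy_schwarz:
  assumes "x \<in> W" "y \<in> W"
  shows "\<bar>B x y\<bar> \<le> sqrt (B x x) * sqrt (B y y)"
proof -
  have q: "0 \<le> B x x + 2 * t * B x y + t\<^sup>2 * B y y" for t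
    using expand_square[OF assms, of t] nonneg[of "x + sc t y"] assms W
    by (simp add: subspace_add subspace_scale)
  have "(B x y)\<^sup>2 \<le> B x x * B y y"
  proof (cases "B y y = 0")
    case True
    have "B x y = 0"
    proof (rule ccontr)
      assume "B x y \<noteq> 0"
      then show False using q[of "- (B x x + 1) / (2 * B x y)"] True by (simp add: field_simps)
    qed
    then show ?thesis by (simp add: True)
  next
    case False
    then have "0 < B y y" using nonneg[OF assms(2)] by linarith
    then show ?thesis
      using q[of "- B x y / B y y"] by (simp add: field_simps power2_eq_square)
  qed
  then have "sqrt ((B x y)\<^sup>2) \<le> sqrt (B x x * B y y)" by (rule real_sqrt_le_mono)
  then show ?thesis by (simp add: real_sqrt_mult)
qed

text \<open>Triangle inequality for the seminorm, followed by Cauchy--Schwarz for the sum of \<open>card I\<close> seminorms.\<close>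

lemma sum_square_le:
  assumes "finite I" "\<And>i. i \<in> I \<Longrightarrow> x i \<in> W"
  shows "B (\<Sum>i\<in>I. x i) (\<Sum>i\<in>I. x i) \<le> card I * (\<Sum>i\<in>I. B (x i) (x i))"
proof -
  define N where "N v = sqrt (B v v)" for v
  have tri: "N (\<Sum>i\<in>J. x i) \<le> (\<Sum>i\<in>J. N (x i))" if "J \<subseteq> I" for J
    using finite_subset[OF that assms(1)] that
  proof (induction J rule: finite_induct)
    case empty
    have "B 0 0 = 0" using scale_left[of 0 0 0] W by (simp add: subspace_0)
    then show ?case by (simp add: N_def)
  next
    case (insert j J)
    let ?s = "\<Sum>i\<in>J. x i"
    have m: "x j \<in> W" "?s \<in> W"
      using insert.prems assms(2) W by (auto intro!: subspace_sum)
    have "B (x j + ?s) (x j + ?s) = B (x j) (x j) + 2 * B (x j) ?s + B ?s ?s"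
      using expand_square[OF m, of 1] by simp
    also have "\<dots> \<le> (N (x j) + N ?s)\<^sup>2"
      using cauchy_schwarz[OF m] nonneg[OF m(1)] nonneg[OF m(2)]
      by (simp add: N_def power2_sum)
    finally have "N (x j + ?s) \<le> N (x j) + N ?s"
      unfolding N_def using nonneg[OF m(1)] nonneg[OF m(2)] by (intro real_le_lsqrt) (auto simp: power2_sum)
    then show ?case using insert by simp
  qed
  have "B (\<Sum>i\<in>I. x i) (\<Sum>i\<in>I. x i) = (N (\<Sum>i\<in>I. x i))\<^sup>2"
    using assms W by (simp add: N_def nonneg subspace_sum)
  also have "\<dots> \<le> (\<Sum>i\<in>I. N (x i))\<^sup>2"
    using tri[of I] assms W by (intro power_mono) (auto simp: N_def nonneg subspace_sum)
  also have "\<dots> \<le> (\<Sum>i\<in>I. (1::real)\<^sup>2) * (\<Sum>i\<in>I. (N (x i))\<^sup>2)"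
    using Cauchy_Schwarz_ineq_sum[of "\<lambda>_. 1" "\<lambda>i. N (x i)" I] by simp
  also have "\<dots> = card I * (\<Sum>i\<in>I. B (x i) (x i))"
    using assms by (auto simp: N_def nonneg intro!: sum.cong)
  finally show ?thesis .
qed

text \<open>Gram--Schmidt: the component \<open>z\<close> of a new vector orthogonal to the previous span allows the value on that vector to be
corrected without disturbing the others.\<close>

lemma span_representer:
  assumes "finite S" "S \<subseteq> W"
    and def: "\<And>x. x \<in> W \<Longrightarrow> B x x = 0 \<Longrightarrow> x = 0"
    and F: "\<And>x y. x \<in> W \<Longrightarrow> y \<in> W \<Longrightarrow> F (x + y) = F x + F y" "\<And>c x. x \<in> W \<Longrightarrow> F (sc c x) = c * F x"
  shows "\<exists>w\<in>span S. \<forall>r\<in>span S. B w r = F r"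
  using assms(1,2) F
proof (induction S arbitrary: F rule: finite_induct)
  case empty
  have "F 0 = 0" using empty(3)[of 0 0] W by (simp add: subspace_0)
  moreover have "B 0 0 = 0" using scale_left[of 0 0 0] W by (simp add: subspace_0)
  ultimately show ?case by simp
next
  case (insert x S)
  have sW: "span S \<subseteq> W" using insert.prems(1) W by (simp add: span_minimal)
  have xW: "x \<in> W" using insert.prems by simp
  obtain p where p: "p \<in> span S" "\<And>r. r \<in> span S \<Longrightarrow> B p r = B x r"
    using insert.IH[of "B x"] insert.prems(1) xW by (auto simp: add_right scale_right)
  obtain u where u: "u \<in> span S" "\<And>r. r \<in> span S \<Longrightarrow> B u r = F r"
    using insert.IH[of F] insert.prems by auto
  define z where "z = x - p"
  have zW: "z \<in> W" and pW: "p \<in> W" and uW: "u \<in> W"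
    using xW p u sW W by (auto simp: z_def subspace_diff)
  have orth: "B z r = 0" if "r \<in> span S" for r
  proof -
    have "x = p + z" by (simp add: z_def)
    then have "B x r = B p r + B z r" using add_left pW zW that sW by auto
    then show ?thesis using p(2)[OF that] by simp
  qed
  have dec: "\<exists>k. \<exists>s\<in>span S. r = s + sc k z" if "r \<in> span (insert x S)" for r
  proof -
    obtain k where "r - sc k x \<in> span S" using \<open>r \<in> span (insert x S)\<close> by (auto simp: span_insert)
    then have "r - sc k x + sc k p \<in> span S" using p(1) by (simp add: span_add span_scale)
    moreover have "r = (r - sc k x + sc k p) + sc k z"
      by (simp add: z_def scale_right_diff_distrib)
    ultimately show ?thesis by blast
  qed
  have zspan: "z \<in> span (insert x S)"
    unfolding z_def using p(1) by (meson insertI1 span_base span_diff span_mono subset_insertI subsetD)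
  define w where "w = u + sc (F z / B z z) z"
  have "w \<in> span (insert x S)"
    unfolding w_def using u(1) zspan by (meson span_add span_scale span_mono subset_insertI subsetD)
  moreover have "B w r = F r" if r: "r \<in> span (insert x S)" for r
  proof -
    obtain k s where ks: "s \<in> span S" "r = s + sc k z" using dec[OF r] by blast
    have sW': "s \<in> W" using ks sW by auto
    have Fz: "F z / B z z * B z z = F z"
      using def[OF zW] insert.prems(3)[of 0 0] W by (cases "z = 0") (auto simp: subspace_0)
    have zz: "sc c z \<in> W" for c using zW W by (simp add: subspace_scale)
    have uz: "B u z = 0" using orth[OF u(1)] sym[OF zW uW] by simp
    have "B w r = B u s + k * B u z + F z / B z z * (B z s + k * B z z)"
      unfolding w_def ks(2) using uW sW' zW zz
      by (simp add: add_left add_right scale_left scale_right W subspace_add algebra_simps)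
    also have "\<dots> = F s + k * F z" using uz orth[OF ks(1)] u(2)[OF ks(1)] Fz by (simp add: mult.left_commute)
    also have "\<dots> = F r" unfolding ks(2) using insert.prems(2)[OF sW' zz] insert.prems(3)[OF zW] by simp
    finally show ?thesis .
  qed
  ultimately show ?case by blast
qed

text \<open>Riesz representation.  Here \<open>S\<close> spans a space that may be larger than \<open>W\<close>; a basis of \<open>W\<close> is finite all the same.\<close>

lemma representer:
  assumes fin: "finite S" "W \<subseteq> span S"
    and def: "\<And>x. x \<in> W \<Longrightarrow> B x x = 0 \<Longrightarrow> x = 0"
    and F: "\<And>x y. x \<in> W \<Longrightarrow> y \<in> W \<Longrightarrow> F (x + y) = F x + F y" "\<And>c x. x \<in> W \<Longrightarrow> F (sc c x) = c * F x"
  shows "\<exists>!w. w \<in> W \<and> (\<forall>r\<in>W. B w r = F r)"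
proof -
  obtain b where b: "b \<subseteq> W" "independent b" "W \<subseteq> span b"
    using maximal_independent_subset[of W] by blast
  have "finite b" using independent_span_bound[OF fin(1) b(2)] b(1) fin(2) by auto
  moreover have "span b = W" using b W by (simp add: span_minimal subset_antisym)
  ultimately obtain w where w: "w \<in> W" "\<forall>r\<in>W. B w r = F r"
    using span_representer[OF _ b(1) def, of F] F by blast
  have "v = w" if v: "v \<in> W" "\<forall>r\<in>W. B v r = F r" for v
  proof -
    have d: "v - w \<in> W" using v w W by (simp add: subspace_diff)
    have "B v (v - w) = B (v - w) (v - w) + B w (v - w)"
      using add_left[OF d w(1) d] by simp
    then have "B (v - w) (v - w) = 0" using v(2) w(2) d by simp
    then show ?thesis using def[OF d] by simp
  qed
  then show ?thesis using w by blast
qed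

end

text \<open>Cauchy--Schwarz in each of the three terms; the mixed ones need the energy \<open>d\<close> to be bounded by \<open>a\<close>.\<close>

lemma saddle_continuity:
  assumes "psd_form sc W a" "psd_form sc W d"
    and bound: "\<And>w. w \<in> W \<Longrightarrow> d w w \<le> C\<^sup>2 * a w w" "0 \<le> C"
    and m: "w \<in> W" "P \<in> W" "r \<in> W" "Q \<in> W"
  shows "\<bar>a w r + d P r + d Q w\<bar> \<le> (1 + 2 * C) * sqrt (a w w + d P P) * sqrt (a r r + d Q Q)"
proof -
  interpret a: psd_form sc W a by fact
  interpret d: psd_form sc W d by fact
  define N1 where "N1 = sqrt (a w w + d P P)"
  define N2 where "N2 = sqrt (a r r + d Q Q)"
  have nn: "0 \<le> N1" "0 \<le> N2" using m by (auto simp: N1_def N2_def a.nonneg d.nonneg)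
  have l: "sqrt (a w w) \<le> N1" "sqrt (d P P) \<le> N1" "sqrt (a r r) \<le> N2" "sqrt (d Q Q) \<le> N2"
    using m by (auto simp: N1_def N2_def a.nonneg d.nonneg)
  have db: "sqrt (d x x) \<le> C * sqrt (a x x)" if "x \<in> W" for x
    using real_sqrt_le_mono[OF bound(1)[OF that]] bound(2) by (simp add: real_sqrt_mult)
  have d1: "sqrt (d w w) \<le> C * N1" "sqrt (d r r) \<le> C * N2"
    using db[OF m(1)] db[OF m(3)] mult_left_mono[OF l(1) bound(2)] mult_left_mono[OF l(3) bound(2)] by auto
  have "\<bar>a w r\<bar> \<le> N1 * N2"
    by (rule order_trans[OF a.cauchy_schwarz[OF m(1,3)]]) (use l nn m in \<open>auto intro!: mult_mono simp: a.nonneg\<close>)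
  moreover have "\<bar>d P r\<bar> \<le> N1 * (C * N2)"
    by (rule order_trans[OF d.cauchy_schwarz[OF m(2,3)]]) (use l nn m d1 in \<open>auto intro!: mult_mono simp: d.nonneg\<close>)
  moreover have "\<bar>d Q w\<bar> \<le> N2 * (C * N1)"
    by (rule order_trans[OF d.cauchy_schwarz[OF m(4,1)]]) (use l nn m d1 in \<open>auto intro!: mult_mono simp: d.nonneg\<close>)
  ultimately show ?thesis unfolding N1_def[symmetric] N2_def[symmetric] by (simp add: algebra_simps)
qed

text \<open>The test pair has mixed component \<open>r + Q/2\<close> and discrete gradient \<open>- Q\<close>, so the two terms \<open>d Q r\<close> cancel and there remains
\<open>a r r + a Q r / 2 + d Q Q / 2\<close>.  With \<open>A\<close> and \<open>B\<close> the two parts of the norm, the middle term is at most \<open>A * B\<close> by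
\<open>a \<le> 4 d\<close>, and \<open>A\<^sup>2 - A * B + B\<^sup>2 / 2\<close> is positive definite.\<close>

lemma saddle_infsup:
  assumes "psd_form sc W a" "psd_form sc W d"
    and bound: "\<And>w. w \<in> W \<Longrightarrow> a w w \<le> 4 * d w w"
    and m: "r \<in> W" "Q \<in> W"
  defines "w \<equiv> r + sc (1/2) Q"
  shows "1/12 * (sqrt (a w w + d Q Q) * sqrt (a r r + d Q Q)) \<le> a w r - d Q r + d Q w"
proof -
  interpret a: psd_form sc W a by fact
  interpret d: psd_form sc W d by fact
  define A where "A = sqrt (a r r)"
  define B where "B = sqrt (d Q Q)"
  have AB: "0 \<le> A" "0 \<le> B" "a r r = A\<^sup>2" "d Q Q = B\<^sup>2"
    using m by (auto simp: A_def B_def a.nonneg d.nonneg)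
  have s: "sqrt (a Q Q) \<le> 2 * B"
    using real_sqrt_le_mono[OF bound[OF m(2)]] by (simp add: B_def real_sqrt_mult)
  have aQr: "\<bar>a r Q\<bar> \<le> A * (2 * B)"
    by (rule order_trans[OF a.cauchy_schwarz[OF m]]) (unfold A_def[symmetric], rule mult_left_mono[OF s AB(1)])
  have hQ: "sc (1/2) Q \<in> W" using m a.W by (simp add: a.subspace_scale)
  have e1: "a w r = A\<^sup>2 + a r Q / 2" unfolding w_def
    using m hQ AB by (simp add: a.add_left a.scale_left a.sym[of Q r])
  have e2: "d Q w = d Q r + B\<^sup>2 / 2" unfolding w_def
    using m hQ AB by (simp add: d.add_right d.scale_right)
  have e3: "a w w = A\<^sup>2 + a r Q + a Q Q / 4"
    unfolding w_def using a.expand_square[OF m, of "1/2"] AB by (simp add: power2_eq_square)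
  \<comment> \<open>the norm of the test pair is at most twice that of the given pair\<close>
  have "a w w + B\<^sup>2 \<le> 4 * (A\<^sup>2 + B\<^sup>2)"
  proof -
    have "a Q Q / 4 \<le> B\<^sup>2" using bound[OF m(2)] AB by simp
    moreover have "a r Q \<le> 2 * A * B" using aQr by simp
    then have "a r Q \<le> A\<^sup>2 + B\<^sup>2" using sum_squares_bound[of A B] by (rule order_trans)
    ultimately have "a w w + B\<^sup>2 \<le> 2 * A\<^sup>2 + 3 * B\<^sup>2" unfolding e3 by simp
    then show ?thesis by (rule order_trans) simp
  qed
  then have "sqrt (a w w + B\<^sup>2) \<le> sqrt (4 * (A\<^sup>2 + B\<^sup>2))" by (rule real_sqrt_le_mono)
  then have n: "sqrt (a w w + B\<^sup>2) \<le> 2 * sqrt (A\<^sup>2 + B\<^sup>2)"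
    by (simp only: real_sqrt_mult real_sqrt_four)
  have "1/12 * (sqrt (a w w + B\<^sup>2) * sqrt (A\<^sup>2 + B\<^sup>2)) \<le> 1/12 * ((2 * sqrt (A\<^sup>2 + B\<^sup>2)) * sqrt (A\<^sup>2 + B\<^sup>2))"
    using n by (intro mult_left_mono mult_right_mono) auto
  also have "\<dots> = 1/6 * (A\<^sup>2 + B\<^sup>2)" by simp
  also have "\<dots> \<le> A\<^sup>2 - A * B + B\<^sup>2 / 2"
  proof -
    \<comment> \<open>completing the square; \<open>1/6\<close> leaves \<open>1/30\<close> to spare\<close>
    have "A\<^sup>2 - A * B + B\<^sup>2 / 2 - 1/6 * (A\<^sup>2 + B\<^sup>2) = 5/6 * (A - 3/5 * B)\<^sup>2 + 1/30 * B\<^sup>2"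
      by (simp add: power2_eq_square algebra_simps)
    moreover have "0 \<le> 5/6 * (A - 3/5 * B)\<^sup>2 + 1/30 * B\<^sup>2" by simp
    ultimately show ?thesis by linarith
  qed
  also have "\<dots> \<le> a w r - d Q r + d Q w" using aQr e1 e2 by simp
  finally show ?thesis using AB by simp
qed

section \<open>Tangent spaces of flat sets\<close>

lemma tangent_subspace: "subspace (tangent S)"
  by (simp add: tangent_def)

lemma tangent_diff: "x \<in> S \<Longrightarrow> y \<in> S \<Longrightarrow> x - y \<in> tangent S"
  unfolding tangent_def by (rule span_base) blast

lemma tangent_mono: "S \<subseteq> S' \<Longrightarrow> tangent S \<subseteq> tangent S'"
  unfolding tangent_def by (rule span_mono) blast

lemma tangent_eq_span:
  assumes "p \<in> S" shows "tangent S = span ((\<lambda>x. x - p) ` S)"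
proof
  have "{x - y |x y. x \<in> S \<and> y \<in> S} \<subseteq> span ((\<lambda>x. x - p) ` S)"
  proof clarify
    fix x y assume "x \<in> S" "y \<in> S"
    then have "(x - p) - (y - p) \<in> span ((\<lambda>x. x - p) ` S)" by (intro span_diff span_base) auto
    then show "x - y \<in> span ((\<lambda>x. x - p) ` S)" by simp
  qed
  then show "tangent S \<subseteq> span ((\<lambda>x. x - p) ` S)" unfolding tangent_def by (simp add: span_minimal)
  show "span ((\<lambda>x. x - p) ` S) \<subseteq> tangent S" unfolding tangent_def by (rule span_mono) (use assms in blast)
qed

lemma affine_hull_tangent:
  assumes "a \<in> S" shows "affine hull S = {x. x - a \<in> tangent S}"
proof -
  have "affine hull S = (\<lambda>x. a + x) ` span ((\<lambda>x. - a + x) ` S)"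
    using assms by (intro affine_hull_span_gen hull_inc)
  also have "\<dots> = (\<lambda>x. a + x) ` tangent S" by (simp add: tangent_eq_span[OF assms])
  also have "\<dots> = {x. x - a \<in> tangent S}" by (force simp: image_iff)
  finally show ?thesis .
qed

lemma tangent_affine_hull: "tangent (affine hull S) = tangent S"
proof (cases "S = {}")
  case False
  then obtain a where a: "a \<in> S" by blast
  show ?thesis
  proof
    show "tangent S \<subseteq> tangent (affine hull S)" by (simp add: tangent_mono hull_subset)
    have "{x - y |x y. x \<in> affine hull S \<and> y \<in> affine hull S} \<subseteq> tangent S"
    proof clarify
      fix x y assume "x \<in> affine hull S" "y \<in> affine hull S"
      then have "(x - a) - (y - a) \<in> tangent S"
        using affine_hull_tangent[OF a] subspace_diff[OF tangent_subspace] by fast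
      then show "x - y \<in> tangent S" by simp
    qed
    then show "tangent (affine hull S) \<subseteq> tangent S"
      by (simp add: tangent_def[of "affine hull S"] span_minimal tangent_subspace)
  qed
qed simp

lemma tangent_cong_hull: "affine hull S = affine hull S' \<Longrightarrow> tangent S = tangent S'"
  by (metis tangent_affine_hull)

lemma tangent_hull_diff: "x \<in> affine hull S \<Longrightarrow> y \<in> affine hull S \<Longrightarrow> x - y \<in> tangent S"
  by (metis tangent_affine_hull tangent_diff)

lemma affine_hull_tangent':
  assumes "a \<in> affine hull S" shows "x \<in> affine hull S \<longleftrightarrow> x - a \<in> tangent S"
  using affine_hull_tangent[OF assms] by (simp add: tangent_affine_hull)

lemma dim_tangent: "S \<noteq> {} \<Longrightarrow> int (dim (tangent S)) = aff_dim S"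
proof -
  assume "S \<noteq> {}"
  then obtain a where a: "a \<in> S" by blast
  then show ?thesis
    using aff_dim_eq_dim_subtract[of a S] by (simp add: tangent_eq_span[OF a] hull_inc)
qed

lemma
  shows onb_orthogonal: "pairwise orthogonal (onb S)"
    and onb_norm: "b \<in> onb S \<Longrightarrow> norm b = 1"
    and span_onb: "span (onb S) = tangent S"
    and finite_onb: "finite (onb S)"
    and card_onb: "card (onb S) = dim (tangent S)"
proof -
  let ?P = "\<lambda>B. B \<subseteq> tangent S \<and> pairwise orthogonal B \<and> (\<forall>b\<in>B. norm b = 1) \<and> span B = tangent S"
  have "\<exists>B. ?P B"
    using orthonormal_basis_subspace[OF tangent_subspace[of S]] by metis
  then have P: "?P (onb S)" unfolding onb_def by (rule someI_ex)
  then show "pairwise orthogonal (onb S)" "b \<in> onb S \<Longrightarrow> norm b = 1" "span (onb S) = tangent S"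
    by auto
  have "0 \<notin> onb S" using P by force
  then have "independent (onb S)" using P by (simp add: pairwise_orthogonal_independent)
  then show "finite (onb S)" "card (onb S) = dim (tangent S)"
    using P dim_span_eq_card_independent[of "onb S"] by (auto simp: independent_imp_finite)
qed

lemma onb_cong: "tangent S = tangent S' \<Longrightarrow> onb S = onb S'"
  by (simp add: onb_def)

section \<open>The lowest-order Raviart--Thomas space\<close>

definition fscale :: "real \<Rightarrow> ('a \<Rightarrow> 'b::real_vector) \<Rightarrow> 'a \<Rightarrow> 'b" where "fscale c v = (\<lambda>x. c *\<^sub>R v x)"

lemma vector_space_fscale: "vector_space (fscale :: real \<Rightarrow> ('a \<Rightarrow> 'b::real_vector) \<Rightarrow> _)"
  by standard (auto simp: fscale_def fun_eq_iff algebra_simps)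

interpretation fscale: vector_space fscale by (rule vector_space_fscale)

lemma RT0_subspace:
  assumes "T \<noteq> {}" shows "fscale.subspace (RT0 T)"
  unfolding fscale.subspace_def
proof (intro conjI ballI allI)
  show "0 \<in> RT0 T"
    using assms subspace_0[OF tangent_subspace] unfolding RT0_def by (force simp: fun_eq_iff)
next
  fix u v assume "u \<in> RT0 T" "v \<in> RT0 T"
  then obtain a b c a' b' c' where
    u: "a \<in> tangent T" "c \<in> T" "u = (\<lambda>x. a + b *\<^sub>R (x - c))" and
    v: "a' \<in> tangent T" "c' \<in> T" "v = (\<lambda>x. a' + b' *\<^sub>R (x - c'))"
    unfolding RT0_def by blast
  have "a + a' + b' *\<^sub>R (c - c') \<in> tangent T"
    using u v by (intro subspace_add subspace_scale tangent_subspace tangent_diff)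
  moreover have "u + v = (\<lambda>x. (a + a' + b' *\<^sub>R (c - c')) + (b + b') *\<^sub>R (x - c))"
    by (simp add: u v fun_eq_iff algebra_simps)
  ultimately show "u + v \<in> RT0 T" using u unfolding RT0_def by blast
next
  fix k u assume "u \<in> RT0 T"
  then obtain a b c where u: "a \<in> tangent T" "c \<in> T" "u = (\<lambda>x. a + b *\<^sub>R (x - c))"
    unfolding RT0_def by blast
  have "k *\<^sub>R a \<in> tangent T" "fscale k u = (\<lambda>x. k *\<^sub>R a + (k * b) *\<^sub>R (x - c))"
    unfolding u(3) fscale_def by (simp_all add: u(1) subspace_scale tangent_subspace scaleR_add_right)
  then show "fscale k u \<in> RT0 T" using u unfolding RT0_def by blast
qed

lemma RT0_tangent:
  assumes "v \<in> RT0 T" "x \<in> affine hull T" shows "v x \<in> tangent T"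
proof -
  obtain a b c where u: "a \<in> tangent T" "c \<in> T" "v = (\<lambda>x. a + b *\<^sub>R (x - c))"
    using assms unfolding RT0_def by blast
  then show ?thesis
    using tangent_hull_diff[OF assms(2) hull_inc[OF u(2)]] by (simp add: subspace_add subspace_scale tangent_subspace)
qed

lemma RT0_shape:
  assumes "v \<in> RT0 T" obtains b where "\<And>x y. v x = v y + b *\<^sub>R (x - y)"
proof -
  obtain a b c where "v = (\<lambda>x. a + b *\<^sub>R (x - c))" using assms unfolding RT0_def by blast
  then have "v x = v y + b *\<^sub>R (x - y)" for x y by (simp add: algebra_simps)
  then show ?thesis by (rule that)
qed

lemma continuous_RT0: "v \<in> RT0 T \<Longrightarrow> continuous_on S v"
  unfolding RT0_def by (auto intro!: continuous_intros)

lemma flat_div_shape: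
  assumes "\<And>x. v x = a + b *\<^sub>R (x - c)"
  shows "flat_div S v x = b * dim (tangent S)"
proof -
  have "(v has_derivative (\<lambda>h. b *\<^sub>R h)) (at x)"
  proof -
    have "v = (\<lambda>x. a + b *\<^sub>R (x - c))" using assms by auto
    then show ?thesis by (auto intro!: derivative_eq_intros)
  qed
  then have "frechet_derivative v (at x) = (\<lambda>h. b *\<^sub>R h)" by (simp add: frechet_derivative_at[symmetric])
  then have "flat_div S v x = (\<Sum>e\<in>onb S. b * (e \<bullet> e))" by (simp add: flat_div_def)
  also have "\<dots> = (\<Sum>e\<in>onb S. b)" by (intro sum.cong) (auto simp: onb_norm dot_square_norm)
  also have "\<dots> = b * dim (tangent S)" by (simp add: card_onb)
  finally show ?thesis .
qed

lemma flat_div_add: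
  assumes "u \<in> RT0 T" "v \<in> RT0 T" shows "flat_div S (u + v) x = flat_div S u x + flat_div S v x"
proof -
  obtain a b c a' b' c' where
    u: "\<And>x. u x = a + b *\<^sub>R (x - c)" and v: "\<And>x. v x = a' + b' *\<^sub>R (x - c')"
    using assms unfolding RT0_def by blast
  have uv: "(u + v) x = (a + a' + b' *\<^sub>R (c - c')) + (b + b') *\<^sub>R (x - c)" for x
    by (simp add: u v algebra_simps)
  show ?thesis unfolding flat_div_shape[OF uv] flat_div_shape[OF u] flat_div_shape[OF v]
    by (simp add: algebra_simps)
qed

lemma flat_div_fscale:
  assumes "u \<in> RT0 T" shows "flat_div S (fscale k u) x = k * flat_div S u x"
proof -
  obtain a b c where u: "\<And>x. u x = a + b *\<^sub>R (x - c)"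
    using assms unfolding RT0_def by blast
  have ku: "fscale k u x = k *\<^sub>R a + (k * b) *\<^sub>R (x - c)" for x
    by (simp add: fscale_def u algebra_simps)
  show ?thesis unfolding flat_div_shape[OF ku] flat_div_shape[OF u] by simp
qed

lemma flat_div_const: "v \<in> RT0 T \<Longrightarrow> flat_div S v x = flat_div S v y"
  unfolding RT0_def by (auto simp: flat_div_shape)

lemma flat_div_0: "flat_div S 0 x = 0"
  using flat_div_shape[of 0 0 0 0 S x] by simp

section \<open>Simplices and facet basis fields\<close>

lemma orthogonal_tangent_zero:
  assumes "\<xi> \<in> tangent S" "p \<in> S" "\<And>w. w \<in> S \<Longrightarrow> \<xi> \<bullet> (w - p) = 0" shows "\<xi> = 0"
proof -
  have "span ((\<lambda>x. x - p) ` S) \<subseteq> {y. orthogonal \<xi> y}"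
    by (rule span_minimal[OF _ subspace_orthogonal_to_vector]) (auto simp: orthogonal_def assms(3))
  then show ?thesis using assms(1) tangent_eq_span[OF assms(2)] by (auto simp: orthogonal_def)
qed

text \<open>A simplex with vertex set \<open>C\<close>.  Facets are indexed by the opposite vertex: \<open>F p\<close> lies in the hyperplane \<open>nrm p \<bullet> x = off p\<close>,
\<open>ht p\<close> is the height of \<open>p\<close> over it, and \<open>bary p\<close> is the barycentric coordinate of \<open>p\<close>, written as the distance to the
facet relative to the height.\<close>

locale simplex_cell =
  fixes C T :: "'a::euclidean_space set"
  assumes ind: "\<not> affine_dependent C" and T: "T = convex hull C" and card: "2 \<le> card C"
begin

definition F :: "'a \<Rightarrow> 'a set" where "F p = convex hull (C - {p})"
definition nrm :: "'a \<Rightarrow> 'a" where "nrm p = outer_normal T (F p)"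
definition off :: "'a \<Rightarrow> real" where "off p = (SOME c. \<forall>x\<in>F p. nrm p \<bullet> x = c)"
definition ht :: "'a \<Rightarrow> real" where "ht p = off p - nrm p \<bullet> p"
definition bary :: "'a \<Rightarrow> 'a \<Rightarrow> real" where "bary p x = (off p - nrm p \<bullet> x) / ht p"

lemma fin: "finite C" using ind by (rule aff_independent_finite)

lemma facet_iff: "f facet_of T \<longleftrightarrow> (\<exists>p\<in>C. f = F p)"
  unfolding T F_def using facet_of_convex_hull_affine_independent_alt[OF ind] card by auto

lemma C_T: "C \<subseteq> T" unfolding T by (rule hull_subset)

lemma hull_T: "affine hull T = affine hull C" by (simp add: T affine_hull_convex_hull)

lemma tangent_C: "tangent C = tangent T" using hull_T tangent_cong_hull by metis

lemma other: "p \<in> C \<Longrightarrow> \<exists>w. w \<in> C - {p}"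
proof -
  assume "p \<in> C"
  then have "card (C - {p}) = card C - 1" using fin by simp
  then have "C - {p} \<noteq> {}" using card by (metis card.empty diff_is_0_eq not_less_eq_eq numeral_2_eq_2 One_nat_def)
  then show ?thesis by blast
qed

lemma F_T: "F p \<subseteq> T" unfolding F_def T by (rule hull_mono) blast
lemma F_ne: "p \<in> C \<Longrightarrow> F p \<noteq> {}" unfolding F_def using other by auto
lemma vertex_F: "q \<in> C \<Longrightarrow> q \<noteq> p \<Longrightarrow> q \<in> F p" unfolding F_def by (simp add: hull_inc)

lemma linear_hull_eq:
  assumes "\<And>w. w \<in> A \<Longrightarrow> \<nu> \<bullet> w = c" "x \<in> convex hull A" shows "\<nu> \<bullet> x = (c::real)"
proof -
  have "convex hull A \<subseteq> {x. \<nu> \<bullet> x = c}" using assms(1) by (intro hull_minimal convex_hyperplane) auto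
  then show ?thesis using assms(2) by auto
qed

lemma linear_hull_le:
  assumes "\<And>w. w \<in> A \<Longrightarrow> \<nu> \<bullet> w \<le> c" "x \<in> convex hull A" shows "\<nu> \<bullet> x \<le> (c::real)"
proof -
  have "convex hull A \<subseteq> {x. \<nu> \<bullet> x \<le> c}" using assms(1) by (intro hull_minimal convex_halfspace_le) auto
  then show ?thesis using assms(2) by auto
qed

lemma normal_exists:
  assumes p: "p \<in> C"
  obtains \<nu> c where "\<nu> \<in> tangent T" "norm \<nu> = 1" "\<And>w. w \<in> C - {p} \<Longrightarrow> \<nu> \<bullet> w = c" "\<nu> \<bullet> p < c"
proof -
  obtain w0 where w0: "w0 \<in> C - {p}" using other[OF p] by blast
  have "p \<notin> affine hull (C - {p})" using ind p unfolding affine_dependent_def by blast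
  then have x: "p - w0 \<notin> tangent (C - {p})" using affine_hull_tangent[OF w0] by simp
  obtain y z where yz: "y \<in> tangent (C - {p})" "\<And>w. w \<in> tangent (C - {p}) \<Longrightarrow> orthogonal z w" "p - w0 = y + z"
    using orthogonal_subspace_decomp_exists[of "tangent (C - {p})" "p - w0"]
    by (metis span_eq_iff tangent_subspace)
  have z: "z \<noteq> 0" using x yz by auto
  have "z = (p - w0) - y" using yz by simp
  moreover have "tangent (C - {p}) \<subseteq> tangent T" using tangent_mono[of "C - {p}" C] tangent_C by auto
  ultimately have zt: "z \<in> tangent T"
    using yz(1) p w0 C_T by (metis (no_types) DiffD1 subsetD subspace_diff tangent_diff tangent_subspace)
  define \<nu> where "\<nu> = (- 1 / norm z) *\<^sub>R z"
  show ?thesis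
  proof (rule that[of \<nu> "\<nu> \<bullet> w0"])
    show "\<nu> \<in> tangent T" unfolding \<nu>_def using zt by (rule subspace_scale[OF tangent_subspace])
    show "norm \<nu> = 1" unfolding \<nu>_def using z by simp
    show "\<nu> \<bullet> w = \<nu> \<bullet> w0" if "w \<in> C - {p}" for w
    proof -
      have "orthogonal z (w - w0)" using yz(2) tangent_diff[OF that w0] by blast
      then have "z \<bullet> w = z \<bullet> w0" by (simp add: orthogonal_def inner_diff_right)
      then show ?thesis by (simp add: \<nu>_def)
    qed
    have "z \<bullet> (p - w0) = z \<bullet> z" using yz(1,2,3) by (simp add: orthogonal_def inner_add_right)
    moreover have "0 < z \<bullet> z / norm z" using z by simp
    ultimately show "\<nu> \<bullet> p < \<nu> \<bullet> w0"
      using z by (simp add: \<nu>_def inner_diff_right field_simps)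
  qed
qed

text \<open>With the signed distances \<open>s\<close> and \<open>s'\<close> of the apex, the combination \<open>s' \<nu> - s \<nu>'\<close> is orthogonal to all edges of the
simplex, hence zero; equal norms leave only the sign open.\<close>

lemma normal_pm:
  assumes p: "p \<in> C" and a: "\<nu> \<in> tangent T" "norm \<nu> = 1" "\<And>w. w \<in> C - {p} \<Longrightarrow> \<nu> \<bullet> w = c"
    and b: "\<nu>' \<in> tangent T" "norm \<nu>' = 1" "\<And>w. w \<in> C - {p} \<Longrightarrow> \<nu>' \<bullet> w = c'"
  shows "\<nu> \<bullet> p \<noteq> c" "(\<nu> \<bullet> p < c \<and> \<nu>' \<bullet> p < c' \<and> \<nu> = \<nu>') \<or> (\<nu> \<bullet> p > c \<and> \<nu>' \<bullet> p > c' \<and> \<nu> = \<nu>') \<or>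
     (\<nu> \<bullet> p < c \<and> \<nu>' \<bullet> p > c' \<and> \<nu> = - \<nu>') \<or> (\<nu> \<bullet> p > c \<and> \<nu>' \<bullet> p < c' \<and> \<nu> = - \<nu>')"
proof -
  obtain w0 where w0: "w0 \<in> C - {p}" using other[OF p] by blast
  have nz: "\<mu> \<bullet> p \<noteq> k" if "\<mu> \<in> tangent T" "norm \<mu> = 1" "\<And>w. w \<in> C - {p} \<Longrightarrow> \<mu> \<bullet> w = k" for \<mu> k
  proof
    assume "\<mu> \<bullet> p = k"
    then have "\<mu> = 0"
      using orthogonal_tangent_zero[of \<mu> C w0] that(1,3) w0 tangent_C
      by (metis DiffI inner_diff_right right_minus_eq singletonD DiffD1)
    then show False using that(2) by simp
  qed
  show 1: "\<nu> \<bullet> p \<noteq> c" using nz a by blast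
  have 2: "\<nu>' \<bullet> p \<noteq> c'" using nz b by blast
  define s where "s = c - \<nu> \<bullet> p"
  define s' where "s' = c' - \<nu>' \<bullet> p"
  have "s' *\<^sub>R \<nu> - s *\<^sub>R \<nu>' = 0"
  proof (rule orthogonal_tangent_zero[of _ C w0])
    show "s' *\<^sub>R \<nu> - s *\<^sub>R \<nu>' \<in> tangent C"
      using a(1) b(1) tangent_C by (simp add: subspace_diff subspace_scale tangent_subspace)
    fix w assume w: "w \<in> C"
    show "(s' *\<^sub>R \<nu> - s *\<^sub>R \<nu>') \<bullet> (w - w0) = 0"
      using a(3)[OF w0] b(3)[OF w0] a(3)[of w] b(3)[of w] w
      by (cases "w = p") (auto simp: inner_diff_left inner_diff_right s_def s'_def algebra_simps)
  qed (use w0 in auto)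
  then have e: "s' *\<^sub>R \<nu> = s *\<^sub>R \<nu>'" by simp
  then have "norm (s' *\<^sub>R \<nu>) = norm (s *\<^sub>R \<nu>')" by simp
  then have "\<bar>s'\<bar> = \<bar>s\<bar>" using a b by simp
  moreover have "s \<noteq> 0" "s' \<noteq> 0" using 1 2 by (auto simp: s_def s'_def)
  ultimately consider "s' = s" "s > 0" | "s' = s" "s < 0" | "s' = - s" "s > 0" | "s' = -s" "s < 0" by linarith
  then show "(\<nu> \<bullet> p < c \<and> \<nu>' \<bullet> p < c' \<and> \<nu> = \<nu>') \<or> (\<nu> \<bullet> p > c \<and> \<nu>' \<bullet> p > c' \<and> \<nu> = \<nu>') \<or>
     (\<nu> \<bullet> p < c \<and> \<nu>' \<bullet> p > c' \<and> \<nu> = - \<nu>') \<or> (\<nu> \<bullet> p > c \<and> \<nu>' \<bullet> p < c' \<and> \<nu> = - \<nu>')"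
  proof cases
    case 1
    with e show ?thesis by (auto simp: s_def s'_def)
  next
    case 2
    with e show ?thesis by (auto simp: s_def s'_def)
  next
    case 3
    then have "s *\<^sub>R (- \<nu>) = s *\<^sub>R \<nu>'" using e by simp
    then have "- \<nu> = \<nu>'" using 3 by (metis less_irrefl scaleR_cancel_left)
    then show ?thesis using 3 by (auto simp: s_def s'_def)
  next
    case 4
    then have "s *\<^sub>R (- \<nu>) = s *\<^sub>R \<nu>'" using e by simp
    then have "- \<nu> = \<nu>'" using 4 by (metis less_irrefl scaleR_cancel_left)
    then show ?thesis using 4 by (auto simp: s_def s'_def)
  qed
qed

lemma nrm_vertices:
  assumes p: "p \<in> C"
  shows "nrm p \<in> tangent T \<and> norm (nrm p) = 1 \<and> (\<exists>c. (\<forall>w\<in>C - {p}. nrm p \<bullet> w = c) \<and> nrm p \<bullet> p < c)"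
proof -
  obtain \<nu> c where n: "\<nu> \<in> tangent T" "norm \<nu> = 1" "\<And>w. w \<in> C - {p} \<Longrightarrow> \<nu> \<bullet> w = c" "\<nu> \<bullet> p < c"
    using normal_exists[OF p] by blast
  have "nrm p = \<nu>"
    unfolding nrm_def outer_normal_def
  proof (rule the_equality)
    have "\<nu> \<bullet> w \<le> c" if "w \<in> C" for w using n(3)[of w] n(4) that by (cases "w = p") auto
    then have le: "\<forall>x\<in>T. \<nu> \<bullet> x \<le> c" using linear_hull_le[of C \<nu> c] unfolding T by blast
    have eq: "\<forall>x\<in>F p. \<nu> \<bullet> x = c" unfolding F_def using linear_hull_eq[OF n(3)] by blast
    show "\<nu> \<in> tangent T \<and> norm \<nu> = 1 \<and> (\<exists>c. (\<forall>x\<in>F p. \<nu> \<bullet> x = c) \<and> (\<forall>x\<in>T. \<nu> \<bullet> x \<le> c))"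
      using n(1,2) le eq by blast
    fix \<nu>' assume h: "\<nu>' \<in> tangent T \<and> norm \<nu>' = 1 \<and> (\<exists>c. (\<forall>x\<in>F p. \<nu>' \<bullet> x = c) \<and> (\<forall>x\<in>T. \<nu>' \<bullet> x \<le> c))"
    then obtain c' where c': "\<forall>x\<in>F p. \<nu>' \<bullet> x = c'" "\<forall>x\<in>T. \<nu>' \<bullet> x \<le> c'" by blast
    have "\<nu>' \<bullet> w = c'" if "w \<in> C - {p}" for w using c'(1) vertex_F that by blast
    moreover have "\<nu>' \<bullet> p \<le> c'" using c'(2) C_T p by blast
    ultimately show "\<nu>' = \<nu>"
      using normal_pm[OF p n(1,2,3), of \<nu>' c'] h n(4) by force
  qed
  then show ?thesis using n by blast
qed

lemma
  assumes p: "p \<in> C"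
  shows nrm_tangent: "nrm p \<in> tangent T" and norm_nrm: "norm (nrm p) = 1"
    and nrm_F: "x \<in> F p \<Longrightarrow> nrm p \<bullet> x = off p" and ht_pos: "0 < ht p"
    and nrm_apex: "nrm p \<bullet> p = off p - ht p"
proof -
  show "nrm p \<in> tangent T" "norm (nrm p) = 1" using nrm_vertices[OF p] by auto
  obtain c where c: "\<And>w. w \<in> C - {p} \<Longrightarrow> nrm p \<bullet> w = c" "nrm p \<bullet> p < c" using nrm_vertices[OF p] by blast
  have "\<forall>x\<in>F p. nrm p \<bullet> x = c" unfolding F_def using linear_hull_eq[OF c(1)] by blast
  moreover have "\<forall>x\<in>F p. nrm p \<bullet> x = off p" unfolding off_def by (rule someI_ex) (use calculation in blast)
  ultimately have "off p = c" using F_ne[OF p] by force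
  then show "x \<in> F p \<Longrightarrow> nrm p \<bullet> x = off p" "0 < ht p"
    using \<open>\<forall>x\<in>F p. nrm p \<bullet> x = c\<close> c(2) by (auto simp: ht_def)
  show "nrm p \<bullet> p = off p - ht p" by (simp add: ht_def)
qed

lemma nrm_unique:
  assumes p: "p \<in> C" and n: "\<nu> \<in> tangent T" "norm \<nu> = 1" "\<And>x. x \<in> F p \<Longrightarrow> \<nu> \<bullet> x = c"
  shows "\<nu> = nrm p \<or> \<nu> = - nrm p"
proof -
  have "\<nu> \<bullet> w = c" "nrm p \<bullet> w = off p" if "w \<in> C - {p}" for w using n(3) nrm_F[OF p] vertex_F that by blast+
  then show ?thesis
    using normal_pm(2)[OF p n(1,2), of c "nrm p" "off p"] nrm_tangent[OF p] norm_nrm[OF p] by blast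
qed

lemma bary_vertex: "p \<in> C \<Longrightarrow> w \<in> C \<Longrightarrow> bary p w = (if w = p then 1 else 0)"
  using ht_pos[of p] nrm_F[of p w] vertex_F[of w p] by (auto simp: bary_def ht_def)

lemma bary_sum:
  assumes p: "p \<in> C" and u: "sum u C = 1"
  shows "bary p (\<Sum>w\<in>C. u w *\<^sub>R w) = u p"
proof -
  have "bary p (\<Sum>w\<in>C. u w *\<^sub>R w) = (\<Sum>w\<in>C. u w * bary p w)"
  proof -
    have "off p - nrm p \<bullet> (\<Sum>w\<in>C. u w *\<^sub>R w) = (\<Sum>w\<in>C. u w) * off p - (\<Sum>w\<in>C. u w * (nrm p \<bullet> w))"
      by (simp add: u inner_sum_right)
    also have "\<dots> = (\<Sum>w\<in>C. u w * (off p - nrm p \<bullet> w))"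
      by (simp add: sum_distrib_right right_diff_distrib sum_subtractf)
    finally show ?thesis by (simp add: bary_def sum_divide_distrib)
  qed
  also have "\<dots> = (\<Sum>w\<in>C. if w = p then u w else 0)" by (intro sum.cong) (auto simp: bary_vertex p)
  finally show ?thesis using p fin by simp
qed

lemma bary_rep:
  assumes "x \<in> affine hull T" shows "sum (\<lambda>p. bary p x) C = 1" "(\<Sum>p\<in>C. bary p x *\<^sub>R p) = x"
proof -
  obtain u where u: "sum u C = 1" "(\<Sum>p\<in>C. u p *\<^sub>R p) = x"
    using assms hull_T fin by (auto simp: affine_hull_finite)
  then have "bary p x = u p" if "p \<in> C" for p using bary_sum that by blast
  then show "sum (\<lambda>p. bary p x) C = 1" "(\<Sum>p\<in>C. bary p x *\<^sub>R p) = x" using u by auto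
qed

lemma T_bary: "x \<in> T \<longleftrightarrow> x \<in> affine hull T \<and> (\<forall>p\<in>C. 0 \<le> bary p x)"
proof
  assume x: "x \<in> T"
  then obtain u where u: "\<forall>p\<in>C. 0 \<le> u p" "sum u C = 1" "(\<Sum>p\<in>C. u p *\<^sub>R p) = x"
    using fin T by (auto simp: convex_hull_finite)
  then have "bary p x = u p" if "p \<in> C" for p using bary_sum that by blast
  then show "x \<in> affine hull T \<and> (\<forall>p\<in>C. 0 \<le> bary p x)" using u x by (simp add: hull_inc)
next
  assume h: "x \<in> affine hull T \<and> (\<forall>p\<in>C. 0 \<le> bary p x)"
  then have "x \<in> convex hull C"
    unfolding convex_hull_finite[OF fin] using bary_rep[of x]
    by (intro CollectI exI[of _ "\<lambda>p. bary p x"]) simp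
  then show "x \<in> T" using T by simp
qed

lemma bary_le_1: assumes "x \<in> T" "p \<in> C" shows "bary p x \<le> 1"
proof -
  have "bary p x \<le> sum (\<lambda>p. bary p x) C"
    using assms fin T_bary by (intro member_le_sum) auto
  then show ?thesis using bary_rep[of x] assms by (simp add: hull_inc)
qed

lemma rel_interior_T: "rel_interior T = {x \<in> affine hull T. \<forall>p\<in>C. 0 < bary p x}"
proof -
  have "rel_interior T = {y. \<exists>u. (\<forall>x\<in>C. 0 < u x) \<and> sum u C = 1 \<and> (\<Sum>x\<in>C. u x *\<^sub>R x) = y}"
    unfolding T by (rule rel_interior_convex_hull_explicit[OF ind])
  also have "\<dots> = {x \<in> affine hull T. \<forall>p\<in>C. 0 < bary p x}"
  proof (intro set_eqI iffI CollectI)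
    fix y assume "y \<in> {y. \<exists>u. (\<forall>x\<in>C. 0 < u x) \<and> sum u C = 1 \<and> (\<Sum>x\<in>C. u x *\<^sub>R x) = y}"
    then obtain u where u: "\<forall>x\<in>C. 0 < u x" "sum u C = 1" "(\<Sum>x\<in>C. u x *\<^sub>R x) = y" by blast
    then show "y \<in> affine hull T \<and> (\<forall>p\<in>C. 0 < bary p y)"
      using bary_sum[of _ u] hull_T affine_hull_finite[OF fin] by auto
  next
    fix y assume "y \<in> {x \<in> affine hull T. \<forall>p\<in>C. 0 < bary p x}"
    then show "\<exists>u. (\<forall>x\<in>C. 0 < u x) \<and> sum u C = 1 \<and> (\<Sum>x\<in>C. u x *\<^sub>R x) = y"
      using bary_rep[of y] by (intro exI[of _ "\<lambda>p. bary p y"]) simp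
  qed
  finally show ?thesis .
qed

lemma bary_F:
  assumes "p \<in> C" "q \<in> C" "q \<noteq> p" "x \<in> rel_interior (F p)" shows "0 < bary q x"
proof -
  have "\<not> affine_dependent (C - {p})" using ind affine_dependent_subset by blast
  then obtain u where u: "\<forall>w\<in>C - {p}. 0 < u w" "sum u (C - {p}) = 1" "(\<Sum>w\<in>C - {p}. u w *\<^sub>R w) = x"
    using assms(4) unfolding F_def by (auto simp: rel_interior_convex_hull_explicit)
  define u' where "u' = u(p := 0)"
  have "sum u' C = 1" "(\<Sum>w\<in>C. u' w *\<^sub>R w) = x"
    using u(2,3) sum.remove[OF fin assms(1), of u'] sum.remove[OF fin assms(1), of "\<lambda>w. u' w *\<^sub>R w"]
    by (auto simp: u'_def)
  then have "bary q x = u' q" using bary_sum[OF assms(2)] by blast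
  then show ?thesis using u(1) assms by (simp add: u'_def)
qed

text \<open>The barycentric coordinate of \<open>p\<close> grows from zero, the others stay positive by continuity.\<close>

lemma step_inside:
  assumes p: "p \<in> C" and x: "x \<in> rel_interior (F p)"
  shows "\<forall>\<^sub>F t in at_right 0. x - t *\<^sub>R nrm p \<in> rel_interior T"
proof -
  have xF: "x \<in> F p" using x rel_interior_subset by blast
  then have xT: "x \<in> affine hull T" using F_T hull_inc[of x T affine] by blast
  have "\<forall>\<^sub>F t in at_right 0. 0 < bary q (x - t *\<^sub>R nrm p)" if q: "q \<in> C" for q
  proof (cases "q = p")
    case True
    have "nrm p \<bullet> nrm p = 1" using norm_nrm[OF p] by (simp add: norm_eq_1)
    then have "bary p (x - t *\<^sub>R nrm p) = t / ht p" for t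
      using nrm_F[OF p xF] by (simp add: bary_def inner_diff_right)
    then show ?thesis
      using True ht_pos[OF p] eventually_at_right_less[of "0::real"] by (auto elim!: eventually_mono)
  next
    case False
    have "((\<lambda>t. bary q (x - t *\<^sub>R nrm p)) \<longlongrightarrow> bary q (x - 0 *\<^sub>R nrm p)) (at_right 0)"
      unfolding bary_def by (intro tendsto_intros) (use ht_pos[OF q] in auto)
    then show ?thesis using order_tendstoD(1)[of _ _ _ 0] bary_F[OF p q False x] by fastforce
  qed
  then have "\<forall>\<^sub>F t in at_right 0. \<forall>q\<in>C. 0 < bary q (x - t *\<^sub>R nrm p)"
    using fin by (simp add: eventually_ball_finite)
  then show ?thesis
  proof eventually_elim
    case (elim t)
    have "x - t *\<^sub>R nrm p \<in> affine hull T"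
      using affine_hull_tangent'[OF xT] nrm_tangent[OF p]
      by (simp add: subspace_neg subspace_scale tangent_subspace)
    then show ?case using elim by (simp add: rel_interior_T)
  qed
qed

lemma normal_comp_eqI:
  assumes "p \<in> C" "\<And>x. x \<in> F p \<Longrightarrow> v x \<bullet> nrm p = c" shows "normal_comp v T (F p) = c"
  unfolding normal_comp_def using assms F_ne[OF assms(1)] by (intro the_equality) (auto simp: nrm_def)

lemma normal_comp_eq:
  assumes "v \<in> RT0 T" "p \<in> C" "x \<in> F p" shows "normal_comp v T (F p) = v x \<bullet> nrm p"
proof (rule normal_comp_eqI[OF assms(2)])
  fix y assume y: "y \<in> F p"
  obtain b where "\<And>x y. v x = v y + b *\<^sub>R (x - y)" using RT0_shape[OF assms(1)] by blast
  then have "v y = v x + b *\<^sub>R (y - x)" by blast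
  then show "v y \<bullet> nrm p = v x \<bullet> nrm p"
    using nrm_F[OF assms(2) y] nrm_F[OF assms(2,3)]
    by (simp add: inner_add_right inner_diff_right inner_commute[of _ "nrm p"])
qed

text \<open>At a vertex \<open>p\<close> the value of the field is orthogonal to the normals of all facets through \<open>p\<close>, that is, it leaves all
barycentric coordinates other than that of \<open>p\<close> unchanged, and so it vanishes.  A field of the form \<open>a + b (x - c)\<close> that vanishes at two
points is zero.\<close>

lemma RT0_unisolvent:
  assumes v: "v \<in> RT0 T" and z: "\<And>p. p \<in> C \<Longrightarrow> normal_comp v T (F p) = 0" shows "v = 0"
proof -
  have vp: "v p = 0" if p: "p \<in> C" for p
  proof -
    have pT: "p \<in> affine hull T" using p C_T by (simp add: hull_inc subsetD)
    have t: "v p \<in> tangent T" using RT0_tangent[OF v pT] .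
    then have h: "p + v p \<in> affine hull T" using affine_hull_tangent'[OF pT] by simp
    have "bary q (p + v p) = 0" if q: "q \<in> C" "q \<noteq> p" for q
    proof -
      have "v p \<bullet> nrm q = 0" using normal_comp_eq[OF v q(1) vertex_F[OF p]] q z by auto
      then show ?thesis using bary_vertex[OF q(1) p] q
        by (simp add: bary_def inner_add_right inner_commute[of _ "nrm q"])
    qed
    then have "(\<Sum>q\<in>C. bary q (p + v p) *\<^sub>R q) = bary p (p + v p) *\<^sub>R p"
        "(\<Sum>q\<in>C. bary q (p + v p)) = bary p (p + v p)"
      using fin p by (simp_all add: sum.remove[OF fin p])
    then show ?thesis using bary_rep[OF h] by simp
  qed
  obtain p where p: "p \<in> C" using card by fastforce
  obtain w where w: "w \<in> C - {p}" using other[OF p] by blast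
  obtain b where b: "\<And>x y. v x = v y + b *\<^sub>R (x - y)" using RT0_shape[OF v] by blast
  have "b *\<^sub>R (w - p) = 0" using b[of w p] vp p w by auto
  then have "b = 0" using w by auto
  then show ?thesis using b[of _ p] vp[OF p] by (auto simp: fun_eq_iff)
qed

definition \<phi> :: "'a \<Rightarrow> 'a \<Rightarrow> 'a" where "\<phi> p x = (1 / ht p) *\<^sub>R (x - p)"

lemma \<phi>_RT0: "p \<in> C \<Longrightarrow> \<phi> p \<in> RT0 T"
proof -
  assume "p \<in> C"
  then have "p \<in> T" "\<phi> p = (\<lambda>x. 0 + (1 / ht p) *\<^sub>R (x - p))" using C_T by (auto simp: \<phi>_def)
  then show ?thesis unfolding RT0_def using subspace_0[OF tangent_subspace, of T] by blast
qed

lemma normal_comp_\<phi>: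
  assumes "p \<in> C" "q \<in> C" shows "normal_comp (\<phi> p) T (F q) = (if q = p then 1 else 0)"
proof (rule normal_comp_eqI[OF assms(2)])
  fix x assume x: "x \<in> F q"
  show "\<phi> p x \<bullet> nrm q = (if q = p then 1 else 0)"
    using nrm_F[OF assms(2) x] nrm_apex[OF assms(2)] nrm_F[OF assms(2) vertex_F[OF assms(1)]] ht_pos[OF assms(2)]
    by (auto simp: \<phi>_def inner_diff_right inner_commute[of _ "nrm q"])
qed

lemma normal_comp_add:
  assumes "u \<in> RT0 T" "v \<in> RT0 T" "f facet_of T"
  shows "normal_comp (u + v) T f = normal_comp u T f + normal_comp v T f"
proof -
  obtain p where p: "p \<in> C" "f = F p" using assms(3) facet_iff by blast
  obtain x where x: "x \<in> F p" using F_ne[OF p(1)] by blast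
  have "u + v \<in> RT0 T" using assms C_T RT0_subspace[of T] p by (intro fscale.subspace_add) auto
  then show ?thesis using normal_comp_eq[OF _ p(1) x] assms p(2) by (simp add: inner_add_left)
qed

lemma normal_comp_fscale:
  assumes "u \<in> RT0 T" "f facet_of T"
  shows "normal_comp (fscale k u) T f = k * normal_comp u T f"
proof -
  obtain p where p: "p \<in> C" "f = F p" using assms facet_iff by blast
  obtain x where x: "x \<in> F p" using F_ne[OF p(1)] by blast
  have "fscale k u \<in> RT0 T" using assms C_T RT0_subspace[of T] p by (intro fscale.subspace_scale) auto
  then show ?thesis using normal_comp_eq[OF _ p(1) x] assms p(2) by (simp add: fscale_def)
qed

lemma F_inj: assumes "p \<in> C" "q \<in> C" "F p = F q" shows "p = q"
proof (rule ccontr)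
  assume "p \<noteq> q"
  then have "p \<in> F p" using vertex_F[of p q] assms by auto
  then show False using nrm_F[of p p] nrm_apex[of p] ht_pos[of p] assms by auto
qed

lemma facets: "{f. f facet_of T} = F ` C" "inj_on F C"
  using facet_iff F_inj by (auto simp: inj_on_def)

lemma RT0_ext:
  assumes "u \<in> RT0 T" "v \<in> RT0 T" "\<And>f. f facet_of T \<Longrightarrow> normal_comp u T f = normal_comp v T f"
  shows "u = v"
proof -
  have ne: "T \<noteq> {}" using C_T card by fastforce
  have d: "u - v \<in> RT0 T"
    using assms RT0_subspace[OF ne] by (intro fscale.subspace_diff)
  have "normal_comp (u - v) T (F p) = 0" if "p \<in> C" for p
    using normal_comp_add[OF d assms(2), of "F p"] assms(3)[of "F p"] facet_iff that by auto
  then have "u - v = 0" by (rule RT0_unisolvent[OF d])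
  then show ?thesis by simp
qed

lemma facet_basis_F: assumes p: "p \<in> C" shows "facet_basis T (F p) = \<phi> p"
  unfolding facet_basis_def
proof (rule the_equality)
  show *: "\<phi> p \<in> RT0 T \<and> (\<forall>g. g facet_of T \<longrightarrow> normal_comp (\<phi> p) T g = (if g = F p then 1 else 0))"
  proof (intro conjI allI impI)
    fix g assume "g facet_of T"
    then obtain q where "q \<in> C" "g = F q" using facet_iff by blast
    then show "normal_comp (\<phi> p) T g = (if g = F p then 1 else 0)"
      using normal_comp_\<phi>[OF p] F_inj[OF p] by auto
  qed (rule \<phi>_RT0[OF p])
  fix \<psi> assume "\<psi> \<in> RT0 T \<and> (\<forall>g. g facet_of T \<longrightarrow> normal_comp \<psi> T g = (if g = F p then 1 else 0))"
  then show "\<psi> = \<phi> p" using * by (intro RT0_ext) auto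
qed

lemma facet_basis_RT0: "f facet_of T \<Longrightarrow> facet_basis T f \<in> RT0 T"
  unfolding facet_iff by (metis facet_basis_F \<phi>_RT0)

lemma normal_comp_facet_basis:
  assumes "f facet_of T" "g facet_of T" shows "normal_comp (facet_basis T f) T g = (if g = f then 1 else 0)"
proof -
  obtain p where p: "p \<in> C" "f = F p" using assms(1) facet_iff by blast
  obtain q where q: "q \<in> C" "g = F q" using assms(2) facet_iff by blast
  have "g = f \<longleftrightarrow> q = p" using p q F_inj by blast
  then show ?thesis unfolding p(2) q(2) facet_basis_F[OF p(1)] normal_comp_\<phi>[OF p(1) q(1)] by simp
qed

lemma finite_facets: "finite {f. f facet_of T}" "card {f. f facet_of T} = card C"
  using facets fin by (auto simp: card_image)

lemma T_ne: "T \<noteq> {}" using C_T card by fastforce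

lemma RT0_combination:
  "(\<Sum>f\<in>{f. f facet_of T}. fscale (c f) (facet_basis T f)) \<in> RT0 T"
  using RT0_subspace[OF T_ne] by (intro fscale.subspace_sum fscale.subspace_scale facet_basis_RT0) auto

lemma normal_comp_combination:
  assumes g: "g facet_of T"
  shows "normal_comp (\<Sum>f\<in>{f. f facet_of T}. fscale (c f) (facet_basis T f)) T g = c g"
proof -
  have *: "A \<subseteq> {f. f facet_of T} \<Longrightarrow> (\<Sum>f\<in>A. fscale (c f) (facet_basis T f)) \<in> RT0 T \<and>
     normal_comp (\<Sum>f\<in>A. fscale (c f) (facet_basis T f)) T g = (if g \<in> A then c g else 0)" if "finite A" for A
    using that
  proof (induction A rule: finite_induct)
    case empty
    obtain p where p: "p \<in> C" "g = F p" using g facet_iff by blast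
    have "normal_comp 0 T (F p) = 0" by (rule normal_comp_eqI[OF p(1)]) simp
    then show ?case using fscale.subspace_0[OF RT0_subspace[OF T_ne]] p(2)
      by (simp only: sum.empty empty_iff if_False simp_thms)
  next
    case (insert f A)
    have f: "f facet_of T" "fscale (c f) (facet_basis T f) \<in> RT0 T"
      using insert facet_basis_RT0 RT0_subspace[OF T_ne] by (auto intro: fscale.subspace_scale)
    let ?S = "\<Sum>f\<in>A. fscale (c f) (facet_basis T f)"
    have S: "?S \<in> RT0 T" "normal_comp ?S T g = (if g \<in> A then c g else 0)" using insert by blast+
    have e: "(\<Sum>f\<in>insert f A. fscale (c f) (facet_basis T f)) = fscale (c f) (facet_basis T f) + ?S"
      using insert by (intro sum.insert)
    have "normal_comp (fscale (c f) (facet_basis T f) + ?S) T g = (if g \<in> insert f A then c g else 0)"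
      unfolding normal_comp_add[OF f(2) S(1) g] normal_comp_fscale[OF facet_basis_RT0[OF f(1)] g]
        normal_comp_facet_basis[OF f(1) g] S(2) using insert.hyps by (cases "g = f") simp_all
    then show ?case unfolding e using fscale.subspace_add[OF RT0_subspace[OF T_ne] f(2) S(1)] by blast
  qed
  show ?thesis using *[of "{f. f facet_of T}"] finite_facets g by simp
qed

lemma RT0_expansion:
  assumes "v \<in> RT0 T"
  shows "v = (\<Sum>f\<in>{f. f facet_of T}. fscale (normal_comp v T f) (facet_basis T f))"
  by (rule RT0_ext[OF assms RT0_combination]) (simp add: normal_comp_combination)

lemma flat_div_facet_basis:
  assumes "p \<in> C" shows "flat_div T (facet_basis T (F p)) x = dim (tangent T) / ht p"
  using flat_div_shape[of "\<phi> p" 0 "1 / ht p" p T x] by (simp add: facet_basis_F[OF assms] \<phi>_def)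

end

lemma simplex_cellI:
  assumes "int d simplex T" "1 \<le> d" obtains C where "simplex_cell C T" "card C = Suc d"
  using assms that unfolding simplex_def simplex_cell_def by force

lemma facet_normals:
  assumes "int d simplex T" "1 \<le> d" "int d simplex T'" "tangent T' = tangent T" "f facet_of T" "f facet_of T'"
  shows "outer_normal T' f = outer_normal T f \<or> outer_normal T' f = - outer_normal T f"
proof -
  obtain C where C: "simplex_cell C T" using simplex_cellI[OF assms(1,2)] by blast
  obtain C' where C': "simplex_cell C' T'" using simplex_cellI[OF assms(3,2)] by blast
  interpret a: simplex_cell C T by fact
  interpret b: simplex_cell C' T' by fact
  obtain p where p: "p \<in> C" "f = a.F p" using assms(5) a.facet_iff by blast
  obtain q where q: "q \<in> C'" "f = b.F q" using assms(6) b.facet_iff by blast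
  show ?thesis
    using a.nrm_unique[OF p(1), of "b.nrm q" "b.off q"] b.nrm_tangent[OF q(1)] b.norm_nrm[OF q(1)]
      b.nrm_F[OF q(1)] p q assms(4) by (auto simp: a.nrm_def b.nrm_def)
qed

text \<open>A small step from an inner point of the facet against the common outer normal leads into both cells.  Their intersection
therefore contains the facet and a point off its affine hull; being a common face of full dimension, it is equal to both.\<close>

lemma same_side_cells:
  assumes "int d simplex T" "1 \<le> d" "int d simplex T'" "f facet_of T" "f facet_of T'"
    and eq: "outer_normal T f = outer_normal T' f"
    and face: "(T \<inter> T') face_of T" "(T \<inter> T') face_of T'"
  shows "T = T'"
proof -
  obtain C where C: "simplex_cell C T" using simplex_cellI[OF assms(1,2)] by blast
  obtain C' where C': "simplex_cell C' T'" using simplex_cellI[OF assms(3,2)] by blast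
  interpret a: simplex_cell C T by fact
  interpret b: simplex_cell C' T' by fact
  obtain p where p: "p \<in> C" "f = a.F p" using assms(4) a.facet_iff by blast
  obtain q where q: "q \<in> C'" "f = b.F q" using assms(5) b.facet_iff by blast
  have dims: "aff_dim T = d" "aff_dim T' = d" using assms(1,3) aff_dim_simplex by auto
  have "convex f" "f \<noteq> {}" using assms(4) face_of_imp_convex by (auto simp: facet_of_def)
  then obtain x where x: "x \<in> rel_interior f" using rel_interior_eq_empty by blast
  have n: "a.nrm p = b.nrm q" using eq p q by (simp add: a.nrm_def b.nrm_def)
  have "\<forall>\<^sub>F t in at_right 0. x - t *\<^sub>R a.nrm p \<in> rel_interior T" "\<forall>\<^sub>F t in at_right 0. x - t *\<^sub>R b.nrm q \<in> rel_interior T'"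
    using a.step_inside[OF p(1)] b.step_inside[OF q(1)] x p q by auto
  moreover have "\<forall>\<^sub>F t in at_right 0. (0::real) < t" by (rule eventually_at_right_less)
  ultimately have "\<forall>\<^sub>F t in at_right 0. 0 < t \<and> x - t *\<^sub>R a.nrm p \<in> T \<inter> T'"
    unfolding n by eventually_elim (use rel_interior_subset in blast)
  then obtain t where t: "0 < t" "x - t *\<^sub>R a.nrm p \<in> T \<inter> T'"
    using eventually_happens'[OF trivial_limit_at_right_real] by blast
  let ?y = "x - t *\<^sub>R a.nrm p"
  have xf: "x \<in> f" using x rel_interior_subset by blast
  have "affine hull f \<subseteq> {z. a.nrm p \<bullet> z = a.off p}"
    using a.nrm_F[OF p(1)] p(2) by (intro hull_minimal affine_hyperplane) auto
  moreover have "a.nrm p \<bullet> ?y \<noteq> a.off p"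
    using a.nrm_F[OF p(1)] xf p a.norm_nrm[OF p(1)] t(1) by (simp add: inner_diff_right norm_eq_1)
  ultimately have "?y \<notin> affine hull f" by blast
  then have "aff_dim (insert ?y f) = d"
    using dims assms(4) by (simp add: aff_dim_insert facet_of_def)
  moreover have "insert ?y f \<subseteq> T \<inter> T'" using t(2) assms(4,5) by (auto dest!: facet_of_imp_subset)
  ultimately have "aff_dim T \<le> aff_dim (T \<inter> T')" using aff_dim_subset dims by metis
  then have "T \<inter> T' = T" "T \<inter> T' = T'"
    using face_of_aff_dim_lt[OF _ face(1)] face_of_aff_dim_lt[OF _ face(2)] dims assms(1,3) convex_simplex by fastforce+
  then show ?thesis by blast
qed

section \<open>Lebesgue measure on flat sets\<close>

lemma det_rank_one_axis:
  fixes w :: "real^'n::finite"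
  shows "det (matrix (\<lambda>y. y + (y $ k) *\<^sub>R w)) = 1 + w $ k"
proof -
  have "matrix (\<lambda>y. y + (y $ k) *\<^sub>R w) = (\<chi> i j. if j = k then (mat 1 *v (axis k 1 + w)) $ i else mat 1 $ i $ j)"
    unfolding matrix_vector_mul_lid by (auto simp: matrix_def vec_eq_iff axis_def mat_def)
  also have "det \<dots> = (axis k 1 + w) $ k * det (mat 1 :: real^'n^'n)" by (rule cramer_lemma)
  finally show ?thesis by (simp add: axis_def)
qed

text \<open>Rotate \<open>a\<close> into a coordinate axis: the conjugated map changes a single column of the identity matrix, whose determinant
is given by Cramer's rule.\<close>

lemma det_rank_one:
  fixes a w :: "real^'n::finite"
  shows "det (matrix (\<lambda>y. y + (a \<bullet> y) *\<^sub>R w)) = 1 + a \<bullet> w"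
proof (cases "a = 0")
  case True
  have "matrix (id :: real^'n \<Rightarrow> real^'n) = mat 1" by (rule matrix_id_mat_1)
  then show ?thesis using True by (simp add: id_def)
next
  case False
  \<comment> \<open>an arbitrary coordinate\<close>
  define k :: 'n where "k = undefined"
  obtain Q :: "real^'n \<Rightarrow> real^'n" where Q: "orthogonal_transformation Q" "Q (axis k (norm a)) = a"
    using orthogonal_transformation_exists[of "axis k (norm a)" a]
    by (auto simp: norm_eq_sqrt_inner inner_axis_axis)
  define Q' where "Q' = inv Q"
  have Q': "orthogonal_transformation Q'" unfolding Q'_def using Q(1) by (rule orthogonal_transformation_inv)
  have QQ: "Q (Q' y) = y" "Q' (Q y) = y" for y
    unfolding Q'_def using Q(1) by (simp_all add: orthogonal_transformation_surj orthogonal_transformation_inj surj_f_inv_f)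
  define g where "g = (\<lambda>y. y + (y $ k) *\<^sub>R (norm a *\<^sub>R Q' w))"
  have lin: "linear Q" "linear Q'" "linear g"
    using Q Q' by (auto simp: orthogonal_transformation_linear g_def intro!: linearI simp: algebra_simps)
  have a: "a \<bullet> y = norm a * (Q' y $ k)" for y
  proof -
    have "a \<bullet> y = Q (axis k (norm a)) \<bullet> Q (Q' y)" using Q(2) QQ by simp
    also have "\<dots> = axis k (norm a) \<bullet> Q' y" using Q(1) by (simp add: orthogonal_transformation_def)
    finally show ?thesis by (simp add: inner_axis' )
  qed
  have "(\<lambda>y. y + (a \<bullet> y) *\<^sub>R w) = Q \<circ> (g \<circ> Q')"
    using lin(1) by (auto simp: fun_eq_iff g_def a linear_add linear_scale QQ mult.commute)
  then have "det (matrix (\<lambda>y. y + (a \<bullet> y) *\<^sub>R w)) = det (matrix Q) * (det (matrix g) * det (matrix Q'))"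
    using lin by (simp add: matrix_compose linear_compose det_mul)
  moreover have "det (matrix Q) * det (matrix Q') = 1"
  proof -
    have "Q \<circ> Q' = id" using QQ by auto
    then have "matrix Q ** matrix Q' = mat 1" using lin by (metis matrix_compose matrix_id_mat_1)
    then show ?thesis by (metis det_I det_mul)
  qed
  moreover have "det (matrix g) = 1 + a \<bullet> w"
    unfolding g_def det_rank_one_axis using a[of w] by simp
  ultimately show ?thesis by (metis mult.commute mult.left_commute mult.right_neutral)
qed

lemma product_sigma_finite_lborel: "product_sigma_finite (\<lambda>_. lborel :: 'b::euclidean_space measure)"
  by standard

lemma PiM_lborel_reindex:
  assumes b: "bij_betw \<beta> I K" and fin: "finite K"
  shows "distr (\<Pi>\<^sub>M k\<in>K. lborel :: real measure) (\<Pi>\<^sub>M i\<in>I. lborel) (\<lambda>f. \<lambda>i\<in>I. f (\<beta> i)) = (\<Pi>\<^sub>M i\<in>I. lborel)"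
    (is "distr ?P ?R ?r = _")
proof -
  interpret product_sigma_finite "\<lambda>_. lborel :: real measure" by (rule product_sigma_finite_lborel)
  have finI: "finite I" using b fin bij_betw_finite by blast
  have bK: "\<beta> i \<in> K" if "i \<in> I" for i using b that bij_betwE by blast
  have m[measurable]: "?r \<in> measurable ?P ?R"
    by (rule measurable_restrict) (use bK in measurable)
  show ?thesis
  proof (rule PiM_eqI[OF finI])
    fix A :: "'a \<Rightarrow> real set" assume A: "\<And>i. i \<in> I \<Longrightarrow> A i \<in> sets lborel"
    define A' where "A' k = A (inv_into I \<beta> k)" for k
    have inv: "inv_into I \<beta> (\<beta> i) = i" if "i \<in> I" for i
      using b that by (simp add: bij_betw_def inv_into_f_f)
    have A': "A' k \<in> sets lborel" if "k \<in> K" for k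
      unfolding A'_def using A b that by (metis bij_betw_def inv_into_into)
    have "?r -` Pi\<^sub>E I A \<inter> space ?P = Pi\<^sub>E K A'"
    proof (intro set_eqI iffI)
      fix f assume f: "f \<in> ?r -` Pi\<^sub>E I A \<inter> space ?P"
      show "f \<in> Pi\<^sub>E K A'"
      proof (rule PiE_I)
        fix k assume "k \<in> K"
        then obtain i where "i \<in> I" "k = \<beta> i" using b by (auto simp: bij_betw_def)
        then show "f k \<in> A' k" using f inv by (auto simp: A'_def PiE_iff)
      qed (use f in \<open>auto simp: space_PiM PiE_iff extensional_def\<close>)
    next
      fix f assume f: "f \<in> Pi\<^sub>E K A'"
      then have "f (\<beta> i) \<in> A i" if "i \<in> I" for i
        using bK[OF that] inv[OF that] that by (auto simp: A'_def PiE_iff dest!: bspec)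
      then show "f \<in> ?r -` Pi\<^sub>E I A \<inter> space ?P" using f by (auto simp: space_PiM PiE_iff)
    qed
    moreover have "Pi\<^sub>E I A \<in> sets ?R" using A finI by (intro sets_PiM_I_finite) auto
    ultimately have "emeasure (distr ?P ?R ?r) (Pi\<^sub>E I A) = (\<Prod>k\<in>K. emeasure lborel (A' k))"
      using A' fin by (simp add: emeasure_distr emeasure_PiM)
    also have "\<dots> = (\<Prod>i\<in>I. emeasure lborel (A' (\<beta> i)))"
      using prod.reindex_bij_betw[OF b, of "\<lambda>k. emeasure lborel (A' k)"] by simp
    also have "\<dots> = (\<Prod>i\<in>I. emeasure lborel (A i))" by (intro prod.cong) (auto simp: A'_def inv)
    finally show "emeasure (distr ?P ?R ?r) (Pi\<^sub>E I A) = (\<Prod>i\<in>I. emeasure lborel (A i))" .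
  qed simp
qed

text \<open>Enumerating the frame \<open>B\<close> by the standard basis identifies the product measure with Lebesgue measure.  The map \<open>J\<close> is chosen before
the origin \<open>x0\<close>, so that measures with different origins can be compared in one chart.\<close>

lemma frame_chart:
  fixes B :: "'a::euclidean_space set"
  assumes B: "finite B" "pairwise orthogonal B" "\<And>b. b \<in> B \<Longrightarrow> norm b = 1" and c: "card B = CARD('d)"
  obtains J :: "real^'d::finite \<Rightarrow> 'a" where "linear J" "\<And>x y. J x \<bullet> J y = x \<bullet> y" "range J = span B"
    "\<And>x0. distr (\<Pi>\<^sub>M b\<in>B. lborel) borel (\<lambda>t. x0 + (\<Sum>b\<in>B. t b *\<^sub>R b)) = distr lborel borel (\<lambda>y. x0 + J y)"
proof -
  have "card B = card (Basis :: (real^'d) set)" using c by simp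
  then obtain \<beta> where \<beta>: "bij_betw \<beta> B (Basis :: (real^'d) set)"
    using B(1) finite_Basis finite_same_card_bij by blast
  define J where "J = (\<lambda>y::real^'d. \<Sum>b\<in>B. (y \<bullet> \<beta> b) *\<^sub>R b)"
  have lin: "linear J"
    unfolding J_def by (intro linearI) (auto simp: inner_add_left scaleR_add_left sum.distrib scaleR_right.sum)
  have ip: "J x \<bullet> J y = x \<bullet> y" for x y
  proof -
    have "J x \<bullet> J y = (\<Sum>b\<in>B. \<Sum>b'\<in>B. (x \<bullet> \<beta> b) * (y \<bullet> \<beta> b') * (b \<bullet> b'))"
      unfolding J_def inner_sum_left inner_sum_right inner_scaleR_left inner_scaleR_right
      by (subst sum.swap) (simp add: sum_distrib_left mult_ac)
    also have "\<dots> = (\<Sum>b\<in>B. \<Sum>b'\<in>B. if b' = b then (x \<bullet> \<beta> b) * (y \<bullet> \<beta> b) else 0)"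
    proof (intro sum.cong refl)
      fix b b' assume bb: "b \<in> B" "b' \<in> B"
      have "b \<bullet> b = 1" using B(3)[OF bb(1)] by (simp add: dot_square_norm)
      moreover have "b \<bullet> b' = 0" if "b \<noteq> b'" using B(2) bb that by (auto simp: pairwise_def orthogonal_def)
      ultimately show "(x \<bullet> \<beta> b) * (y \<bullet> \<beta> b') * (b \<bullet> b') = (if b' = b then (x \<bullet> \<beta> b) * (y \<bullet> \<beta> b) else 0)" by auto
    qed
    also have "\<dots> = (\<Sum>b\<in>B. (x \<bullet> \<beta> b) * (y \<bullet> \<beta> b))" using B(1) by simp
    also have "\<dots> = (\<Sum>e\<in>Basis. (x \<bullet> e) * (y \<bullet> e))" by (rule sum.reindex_bij_betw[OF \<beta>])
    also have "\<dots> = x \<bullet> y" by (rule euclidean_inner[symmetric])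
    finally show ?thesis .
  qed
  have \<beta>B: "\<beta> b \<in> Basis" if "b \<in> B" for b using \<beta> that bij_betwE by blast
  have \<beta>I: "\<beta> b \<bullet> \<beta> b' = (if b' = b then 1 else 0)" if "b \<in> B" "b' \<in> B" for b b'
    using \<beta>B that \<beta> by (auto simp: inner_Basis bij_betw_def inj_on_def)
  have rng: "range J = span B"
  proof
    show "range J \<subseteq> span B" unfolding J_def by (intro image_subsetI span_sum span_scale) (rule span_base)
    show "span B \<subseteq> range J"
    proof (rule span_minimal)
      show "B \<subseteq> range J"
      proof
        fix b assume b: "b \<in> B"
        have "J (\<beta> b) = (\<Sum>b'\<in>B. if b' = b then b' else 0)"
          unfolding J_def by (intro sum.cong) (auto simp: \<beta>I b)
        also have "\<dots> = b" using B(1) b by simp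
        finally show "b \<in> range J" by (metis rangeI)
      qed
      show "subspace (range J)" using lin by (simp add: linear_subspace_image)
    qed
  qed
  have "distr (\<Pi>\<^sub>M b\<in>B. lborel) borel (\<lambda>t. x0 + (\<Sum>b\<in>B. t b *\<^sub>R b)) = distr lborel borel (\<lambda>y. x0 + J y)" for x0
  proof -
    let ?r = "\<lambda>f. \<lambda>b\<in>B. f (\<beta> b)"
    have m1: "?r \<in> measurable (\<Pi>\<^sub>M k\<in>Basis. lborel :: real measure) (\<Pi>\<^sub>M i\<in>B. lborel)"
      by (rule measurable_restrict) (use \<beta>B in measurable)
    have m2: "(\<lambda>t. x0 + (\<Sum>b\<in>B. t b *\<^sub>R b)) \<in> measurable (\<Pi>\<^sub>M i\<in>B. lborel :: real measure) borel"
      by measurable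
    have m3: "(\<lambda>f. \<Sum>b\<in>Basis. f b *\<^sub>R b) \<in> measurable (\<Pi>\<^sub>M k\<in>(Basis :: (real^'d) set). lborel) borel"
      by measurable
    have m4: "(\<lambda>y. x0 + J y) \<in> measurable borel borel"
      using lin by (intro borel_measurable_continuous_onI continuous_intros linear_continuous_on linear_conv_bounded_linear[THEN iffD1])
    have "distr (\<Pi>\<^sub>M b\<in>B. lborel) borel (\<lambda>t. x0 + (\<Sum>b\<in>B. t b *\<^sub>R b)) =
        distr (distr (\<Pi>\<^sub>M k\<in>Basis. lborel) (\<Pi>\<^sub>M i\<in>B. lborel) ?r) borel (\<lambda>t. x0 + (\<Sum>b\<in>B. t b *\<^sub>R b))"
      by (simp add: PiM_lborel_reindex[OF \<beta>])
    also have "\<dots> = distr (\<Pi>\<^sub>M k\<in>Basis. lborel) borel ((\<lambda>t. x0 + (\<Sum>b\<in>B. t b *\<^sub>R b)) \<circ> ?r)"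
      by (rule distr_distr[OF m2 m1])
    also have "(\<lambda>t. x0 + (\<Sum>b\<in>B. t b *\<^sub>R b)) \<circ> ?r = (\<lambda>y. x0 + J y) \<circ> (\<lambda>f. \<Sum>b\<in>Basis. f b *\<^sub>R b)"
    proof
      fix f :: "(real^'d) \<Rightarrow> real"
      have "J (\<Sum>e\<in>Basis. f e *\<^sub>R e) = (\<Sum>b\<in>B. f (\<beta> b) *\<^sub>R b)"
        unfolding J_def using \<beta>B by (intro sum.cong) (auto simp: inner_sum_left_Basis)
      then show "((\<lambda>t. x0 + (\<Sum>b\<in>B. t b *\<^sub>R b)) \<circ> ?r) f = ((\<lambda>y. x0 + J y) \<circ> (\<lambda>f. \<Sum>b\<in>Basis. f b *\<^sub>R b)) f"
        by simp
    qed
    also have "distr (\<Pi>\<^sub>M k\<in>Basis. lborel) borel \<dots> = distr (distr (\<Pi>\<^sub>M k\<in>Basis. lborel) borel (\<lambda>f. \<Sum>b\<in>Basis. f b *\<^sub>R b)) borel (\<lambda>y. x0 + J y)"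
      by (rule distr_distr[OF m4 m3, symmetric])
    also have "\<dots> = distr lborel borel (\<lambda>y. x0 + J y)"
      by (simp only: lborel_eq[symmetric])
    finally show ?thesis .
  qed
  then show ?thesis using that lin ip rng by blast
qed

text \<open>An isometric parametrisation of the affine hull of \<open>S\<close> that carries Lebesgue measure to \<open>flat_measure S\<close>.\<close>

locale flat_chart =
  fixes J :: "real^'d::{finite,wellorder} \<Rightarrow> 'a::euclidean_space" and S :: "'a set" and x0 :: 'a
  assumes lin: "linear J" and iso: "J x \<bullet> J y = x \<bullet> y" and range: "range J = tangent S" and x0: "x0 \<in> S"
    and flat: "flat_measure S = distr lborel borel (\<lambda>y. x0 + J y)"
begin

definition "chart y = x0 + J y"

lemma norm_J: "norm (J y) = norm y" by (simp add: norm_eq_sqrt_inner iso)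

lemma adjoint_J: "adjoint J (J y) = y"
proof (rule vector_eq_rdot[THEN iffD1], intro allI)
  fix z show "adjoint J (J y) \<bullet> z = y \<bullet> z"
    using adjoint_works[OF lin, of z "J y"] iso by (simp add: inner_commute)
qed

lemma J_adjoint: "\<xi> \<in> tangent S \<Longrightarrow> J (adjoint J \<xi>) = \<xi>"
  using range adjoint_J by (metis imageE)

lemma continuous_chart: "continuous_on A chart"
  unfolding chart_def using lin
  by (intro continuous_intros linear_continuous_on linear_conv_bounded_linear[THEN iffD1])

lemma measurable_chart: "chart \<in> borel_measurable borel"
  by (rule borel_measurable_continuous_onI[OF continuous_chart])

lemma emeasure_flat: "A \<in> sets borel \<Longrightarrow> emeasure (flat_measure S) A = emeasure lborel (chart -` A)"
  using measurable_chart unfolding flat chart_def[abs_def] by (subst emeasure_distr) auto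

lemma measure_flat: "A \<in> sets borel \<Longrightarrow> measure (flat_measure S) A = measure lebesgue (chart -` A)"
  using measurable_sets[OF measurable_chart, of A] by (simp add: measure_def emeasure_flat)

lemma chart_hull: "chart y \<in> affine hull S"
  using affine_hull_tangent[OF x0] range by (auto simp: chart_def)

lemma chart_surj: "x \<in> affine hull S \<Longrightarrow> chart (adjoint J (x - x0)) = x"
  using affine_hull_tangent[OF x0] by (auto simp: chart_def J_adjoint)

lemma chart_inv: "adjoint J (chart y - x0) = y"
  by (simp add: chart_def adjoint_J)

lemma linear_adjoint: "linear (adjoint J)" by (rule adjoint_linear[OF lin])

lemma vimage_chart: "A \<subseteq> affine hull S \<Longrightarrow> chart -` A = (\<lambda>x. adjoint J (x - x0)) ` A"
proof (intro set_eqI iffI)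
  fix y assume "y \<in> chart -` A"
  then show "y \<in> (\<lambda>x. adjoint J (x - x0)) ` A" by (intro image_eqI[of _ _ "chart y"]) (simp_all add: chart_inv)
next
  fix y assume A: "A \<subseteq> affine hull S" and "y \<in> (\<lambda>x. adjoint J (x - x0)) ` A"
  then obtain x where "x \<in> A" "y = adjoint J (x - x0)" by blast
  then show "y \<in> chart -` A" using chart_surj[of x] A by auto
qed

lemma compact_vimage: "compact A \<Longrightarrow> A \<subseteq> affine hull S \<Longrightarrow> compact (chart -` A)"
  unfolding vimage_chart
  by (intro compact_continuous_image linear_continuous_on_compose[OF _ linear_adjoint] continuous_intros)

lemma bounded_finite:
  assumes "bounded A" "A \<in> sets borel" shows "emeasure (flat_measure S) A < \<infinity>"
proof -
  obtain r where r: "\<And>x. x \<in> A \<Longrightarrow> norm x \<le> r" using assms by (auto simp: bounded_iff)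
  have "norm y \<le> r + norm x0" if "chart y \<in> A" for y
    using r[OF that] norm_triangle_ineq2[of "J y" "- x0"] norm_J[of y] by (simp add: chart_def add.commute)
  then have "bounded (chart -` A)" by (auto simp: bounded_iff)
  then show ?thesis using emeasure_flat[OF assms(2)] emeasure_bounded_finite by simp
qed

lemma open_positive:
  assumes U: "openin (top_of_set (affine hull S)) U" "U \<noteq> {}"
  shows "0 < emeasure (flat_measure S) U"
proof -
  obtain W where W: "open W" "U = affine hull S \<inter> W" using U(1) by (auto simp: openin_open)
  have eq: "chart -` U = chart -` W" using W chart_hull by auto
  have o: "open (chart -` U)" unfolding eq using continuous_chart[of UNIV] W(1)
    by (simp add: continuous_on_open_vimage)
  have ne: "chart -` U \<noteq> {}" using U(2) W(2) chart_surj by force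
  have "\<not> negligible (chart -` U)"
  proof
    assume n: "negligible (chart -` U)"
    obtain y where "y \<in> chart -` U" using ne by blast
    then obtain a b where ab: "cbox a b \<subseteq> chart -` U" "y \<in> box a b"
      using open_contains_cbox[OF o, of y] by metis
    then have "negligible (cbox a b)" using n negligible_subset by blast
    then show False using ab(2) negligible_interval(1)[of a b] by blast
  qed
  then have "emeasure lborel (chart -` U) \<noteq> 0"
    using o negligible_iff_emeasure0[of "chart -` U"] by (auto simp: borel_open)
  moreover have "U \<in> sets borel" using W by (simp add: borel_closed borel_open affine_closed)
  ultimately show ?thesis by (simp add: emeasure_flat zero_less_iff_neq_zero)
qed

lemma affine_null:
  assumes A: "affine A" "\<not> affine hull S \<subseteq> A"
  shows "emeasure (flat_measure S) A = 0"
proof -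
  let ?V = "chart -` A"
  have cl: "closed A" using A by (simp add: affine_closed)
  have af: "affine ?V"
    unfolding affine_def
  proof (intro ballI allI impI)
    fix x y u v assume h: "x \<in> ?V" "y \<in> ?V" "u + v = (1::real)"
    have "chart (u *\<^sub>R x + v *\<^sub>R y) = (u + v) *\<^sub>R x0 + u *\<^sub>R J x + v *\<^sub>R J y"
      using lin h(3) by (simp add: chart_def linear_add linear_scale)
    also have "\<dots> = u *\<^sub>R chart x + v *\<^sub>R chart y" by (simp add: chart_def algebra_simps)
    finally show "u *\<^sub>R x + v *\<^sub>R y \<in> ?V" using A(1) h by (simp add: affine_def)
  qed
  have "?V \<noteq> UNIV" using A(2) chart_surj by (metis UNIV_I subsetI vimageD)
  then have "affine hull ?V \<noteq> UNIV" using af by (simp add: hull_same)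
  then have "interior ?V = {}" using affine_hull_nonempty_interior by blast
  then have "negligible ?V" using af negligible_convex_interior affine_imp_convex by blast
  moreover have V: "?V \<in> sets borel"
    using measurable_sets[OF measurable_chart, of A] cl by (simp add: borel_closed)
  ultimately have "emeasure lborel ?V = 0"
    using negligible_iff_emeasure0[of ?V] by simp
  then show ?thesis using emeasure_flat[of A] cl by (simp add: borel_closed)
qed

text \<open>In the chart the map is a linear map followed by a translation, so the determinant formula for Lebesgue measure applies.\<close>

lemma measure_affine_image:
  assumes L: "linear L" and A: "compact A" "A \<subseteq> affine hull S" and x1: "x1 \<in> affine hull S" "x2 \<in> affine hull S"
  shows "measure (flat_measure S) ((\<lambda>x. x1 + J (L (adjoint J (x - x2)))) ` A) = \<bar>det (matrix L)\<bar> * measure (flat_measure S) A"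
proof -
  let ?G = "\<lambda>x. x1 + J (L (adjoint J (x - x2)))"
  let ?V = "chart -` A"
  define z where "z = adjoint J (x1 - x0) - L (adjoint J (x2 - x0))"
  have cG: "continuous_on A ?G"
    by (intro continuous_on_add[OF continuous_on_const] linear_continuous_on_compose[OF _ lin]
        linear_continuous_on_compose[OF _ L] linear_continuous_on_compose[OF _ linear_adjoint] continuous_intros)
  have sub: "?G ` A \<subseteq> affine hull S"
    using affine_hull_tangent'[OF x1(1)] range by auto
  have V: "compact ?V" by (rule compact_vimage[OF A])
  have G: "adjoint J (?G x - x0) = z + L (adjoint J (x - x0))" for x
  proof -
    have "?G x - x0 = (x1 - x0) + J (L (adjoint J ((x - x0) - (x2 - x0))))" by simp
    then show ?thesis using linear_adjoint L
      by (simp only: linear_add linear_diff adjoint_J z_def) (simp add: algebra_simps)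
  qed
  have "chart -` (?G ` A) = (+) z ` (L ` ?V)"
    unfolding vimage_chart[OF sub] vimage_chart[OF A(2)] image_image G ..
  moreover have "?G ` A \<in> sets borel" "A \<in> sets borel"
    using cG A by (simp_all add: borel_closed compact_imp_closed compact_continuous_image)
  ultimately show ?thesis
    using measure_linear_image[OF L lmeasurable_compact[OF V]] by (simp add: measure_flat measure_translation)
qed

lemma measure_homothety:
  assumes A: "compact A" "A \<subseteq> affine hull S" and q: "q \<in> affine hull S" and t: "0 < t"
  shows "measure (flat_measure S) ((\<lambda>x. q + t *\<^sub>R (x - q)) ` A) = t ^ CARD('d) * measure (flat_measure S) A"
proof -
  have "(\<lambda>x. q + t *\<^sub>R (x - q)) ` A = (\<lambda>x. q + J (t *\<^sub>R adjoint J (x - q))) ` A"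
  proof (rule image_cong[OF refl])
    fix x assume "x \<in> A"
    then have "x - q \<in> tangent S" using A q tangent_hull_diff by blast
    then show "q + t *\<^sub>R (x - q) = q + J (t *\<^sub>R adjoint J (x - q))"
      using lin by (simp add: linear_scale J_adjoint)
  qed
  moreover have "det (matrix (\<lambda>y::(real,'d) vec. t *\<^sub>R y)) = t ^ CARD('d)"
    by (subst det_diagonal) (auto simp: matrix_def axis_def)
  moreover have "linear (\<lambda>y::(real,'d) vec. t *\<^sub>R y)" by (intro linearI) (auto simp: algebra_simps)
  ultimately show ?thesis
    using measure_affine_image[OF _ A q q, of "\<lambda>y. t *\<^sub>R y"] t by simp
qed

lemma measure_shear:
  assumes A: "compact A" "A \<subseteq> affine hull S" and aw: "a \<in> tangent S" "w \<in> tangent S"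
  shows "measure (flat_measure S) ((\<lambda>x. x + (a \<bullet> x + k) *\<^sub>R w) ` A) = \<bar>1 + a \<bullet> w\<bar> * measure (flat_measure S) A"
proof -
  define L where "L = (\<lambda>y. y + (adjoint J a \<bullet> y) *\<^sub>R adjoint J w)"
  have L: "linear L" unfolding L_def by (intro linearI) (auto simp: inner_add_right algebra_simps)
  have ad: "adjoint J \<xi> \<bullet> adjoint J \<eta> = \<xi> \<bullet> \<eta>" if "\<xi> \<in> tangent S" "\<eta> \<in> tangent S" for \<xi> \<eta>
    using iso[of "adjoint J \<xi>" "adjoint J \<eta>"] that J_adjoint by simp
  define x1 where "x1 = x0 + (a \<bullet> x0 + k) *\<^sub>R w"
  have x0h: "x0 \<in> affine hull S" using x0 by (simp add: hull_inc)
  have x1: "x1 \<in> affine hull S"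
    unfolding x1_def affine_hull_tangent'[OF x0h] using aw by (simp add: subspace_scale tangent_subspace)
  have "(\<lambda>x. x + (a \<bullet> x + k) *\<^sub>R w) ` A = (\<lambda>x. x1 + J (L (adjoint J (x - x0)))) ` A"
  proof (rule image_cong[OF refl])
    fix x assume "x \<in> A"
    then have t: "x - x0 \<in> tangent S" using A x0h tangent_hull_diff by blast
    have "J (L (adjoint J (x - x0))) = (x - x0) + (a \<bullet> (x - x0)) *\<^sub>R w"
      unfolding L_def using lin t aw by (simp add: linear_add linear_scale J_adjoint ad)
    then show "x + (a \<bullet> x + k) *\<^sub>R w = x1 + J (L (adjoint J (x - x0)))"
      by (simp add: x1_def inner_diff_right algebra_simps)
  qed
  moreover have "det (matrix L) = 1 + a \<bullet> w"
    unfolding L_def det_rank_one ad[OF aw] ..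
  ultimately show ?thesis using measure_affine_image[OF L A x1 x0h] by simp
qed

end

lemma flat_chart_exists:
  fixes S :: "'a::euclidean_space set"
  assumes "aff_dim S = int CARD('d)"
  obtains J :: "real^'d::{finite,wellorder} \<Rightarrow> 'a" where "flat_chart J S (SOME x. x \<in> S)"
proof -
  have ne: "S \<noteq> {}" using assms by auto
  have c: "card (onb S) = CARD('d)" using dim_tangent[OF ne] assms card_onb[of S] by simp
  obtain J :: "(real, 'd) vec \<Rightarrow> 'a" where J: "linear J" "\<And>x y. J x \<bullet> J y = x \<bullet> y" "range J = span (onb S)"
    "\<And>x0. distr (\<Pi>\<^sub>M b\<in>onb S. lborel) borel (\<lambda>t. x0 + (\<Sum>b\<in>onb S. t b *\<^sub>R b)) = distr lborel borel (\<lambda>y. x0 + J y)"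
    by (rule frame_chart[OF finite_onb[of S] onb_orthogonal onb_norm[of _ S] c], assumption) (rule that; assumption)
  have "flat_chart J S (SOME x. x \<in> S)"
    unfolding flat_chart_def using J ne by (auto simp: flat_measure_def span_onb some_in_eq)
  then show ?thesis by (rule that)
qed

lemma flat_measure_translate:
  fixes S :: "'a::euclidean_space set"
  assumes "aff_dim S = int CARD('d::{finite,wellorder})" and eq: "affine hull S' = affine hull S"
  shows "flat_measure S' = flat_measure S"
proof -
  have ne: "S \<noteq> {}" using assms by auto
  then have ne': "S' \<noteq> {}" using eq by force
  have c: "card (onb S) = CARD('d)" using dim_tangent[OF ne] assms card_onb[of S] by simp
  obtain J :: "(real, 'd) vec \<Rightarrow> 'a" where J: "linear J" "\<And>x y. J x \<bullet> J y = x \<bullet> y" "range J = span (onb S)"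
    "\<And>x0. distr (\<Pi>\<^sub>M b\<in>onb S. lborel) borel (\<lambda>t. x0 + (\<Sum>b\<in>onb S. t b *\<^sub>R b)) = distr lborel borel (\<lambda>y. x0 + J y)"
    by (rule frame_chart[OF finite_onb[of S] onb_orthogonal onb_norm[of _ S] c], assumption) (rule that; assumption)
  have o: "onb S' = onb S" using tangent_cong_hull[OF eq] by (rule onb_cong)
  define x where "x = (SOME x. x \<in> S)"
  define x' where "x' = (SOME x. x \<in> S')"
  have "x \<in> S" "x' \<in> S'" using ne ne' by (simp_all add: x_def x'_def some_in_eq)
  then have "x \<in> affine hull S" "x' \<in> affine hull S" using eq by (metis hull_inc)+
  then have "x' - x \<in> range J" using J(3) tangent_hull_diff by (auto simp: span_onb)
  then obtain y0 where y0: "x' - x = J y0" by blast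
  have m: "(\<lambda>y. x + J y) \<in> borel_measurable borel"
    using J(1) by (intro borel_measurable_continuous_onI continuous_intros linear_continuous_on linear_conv_bounded_linear[THEN iffD1])
  have "flat_measure S' = distr lborel borel (\<lambda>y. x' + J y)"
    unfolding flat_measure_def o using J(4)[of x'] by (simp add: x'_def)
  also have "(\<lambda>y. x' + J y) = (\<lambda>y. x + J y) \<circ> (+) y0"
    using y0 J(1) by (auto simp: fun_eq_iff linear_add algebra_simps)
  also have "distr lborel borel \<dots> = distr (distr lborel borel ((+) y0)) borel (\<lambda>y. x + J y)"
    by (rule distr_distr[OF m, symmetric]) simp
  also have "\<dots> = distr lborel borel (\<lambda>y. x + J y)" by (simp only: lborel_distr_plus)
  also have "\<dots> = flat_measure S"
    unfolding flat_measure_def using J(4)[of x] by (simp add: x_def)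
  finally show ?thesis .
qed

lemma sets_flat [simp]: "sets (flat_measure S) = sets borel" by (simp add: flat_measure_def)
lemma space_flat [simp]: "space (flat_measure S) = UNIV" by (simp add: flat_measure_def)

lemma emeasure_flat_point:
  fixes S :: "'a::euclidean_space set"
  assumes "aff_dim S = 0" "p \<in> S" "A \<in> sets borel" shows "emeasure (flat_measure S) A = indicator A p"
proof -
  obtain a where "S = {a}" using assms(1) aff_dim_eq_0 by blast
  then have S: "S = {p}" using assms by simp
  have "S \<noteq> {}" using assms(2) by blast
  then have "card (onb S) = 0" using dim_tangent[of S] card_onb[of S] assms(1) by linarith
  then have onb: "onb S = {}" using finite_onb[of S] by simp
  have "(SOME x. x \<in> S) = p" using S by simp
  then have "emeasure (flat_measure S) A = emeasure (Pi\<^sub>M {} (\<lambda>_::'a. lborel :: real measure)) ((\<lambda>t. p) -` A \<inter> space (Pi\<^sub>M {} (\<lambda>_::'a. lborel :: real measure)))"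
    unfolding flat_measure_def onb using assms(3) by (subst emeasure_distr) auto
  also have "\<dots> = indicator A p"
    by (cases "p \<in> A") (auto simp: PiM_empty)
  finally show ?thesis .
qed

text \<open>Charts live on \<open>real^1\<close>, \<open>real^2\<close> or \<open>real^3\<close>: the dimension of a subdomain is a number, that of a vector type is
a type, and this case distinction is the bridge between them.\<close>

lemma dim_upto_3_cases:
  assumes "S \<noteq> {}" "aff_dim S \<le> 3"
  obtains "aff_dim S = 0" | "aff_dim S = int CARD(1)" | "aff_dim S = int CARD(2)" | "aff_dim S = int CARD(3)"
proof -
  have "0 \<le> aff_dim S" using assms(1) aff_dim_negative_iff[of S] by linarith
  then have "aff_dim S = 0 \<or> aff_dim S = 1 \<or> aff_dim S = 2 \<or> aff_dim S = 3" using assms(2) by linarith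
  then show ?thesis using that by auto
qed

text \<open>The orthonormal frame depends on the tangent space only; a change of the origin is a translation in the chart.\<close>

lemma flat_measure_cong:
  assumes "S \<noteq> {}" "aff_dim S \<le> 3" and eq: "affine hull S' = affine hull S"
  shows "flat_measure S' = flat_measure S"
proof (rule dim_upto_3_cases[OF assms(1,2)])
  assume 0: "aff_dim S = 0"
  then obtain p where p: "S = {p}" using aff_dim_eq_0 by blast
  have "aff_dim S' = 0" using eq 0 by (metis aff_dim_affine_hull)
  then obtain p' where p': "S' = {p'}" using aff_dim_eq_0 by blast
  show ?thesis using eq p p' by simp
qed (use flat_measure_translate[OF _ eq] in blast)+

lemma flat_bounded_finite:
  assumes "S \<noteq> {}" "aff_dim S \<le> 3" "bounded A" "A \<in> sets borel"
  shows "emeasure (flat_measure S) A < \<infinity>"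
proof (rule dim_upto_3_cases[OF assms(1,2)])
  assume 0: "aff_dim S = 0"
  obtain p where "p \<in> S" using assms(1) by blast
  then show ?thesis using emeasure_flat_point[OF 0 _ assms(4)] by (auto simp: indicator_def)
qed (metis flat_chart_exists flat_chart.bounded_finite assms(3,4))+

lemma flat_open_positive:
  assumes "S \<noteq> {}" "aff_dim S \<le> 3" "openin (top_of_set (affine hull S)) U" "U \<noteq> {}"
  shows "0 < emeasure (flat_measure S) U"
proof (rule dim_upto_3_cases[OF assms(1,2)])
  assume 0: "aff_dim S = 0"
  then obtain p where p: "S = {p}" using aff_dim_eq_0 by blast
  then have "U = {p}" using assms(3,4) openin_imp_subset by fastforce
  then show ?thesis using emeasure_flat_point[OF 0, of p U] p by simp
qed (metis flat_chart_exists flat_chart.open_positive assms(3,4))+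

lemma flat_affine_null:
  assumes "S \<noteq> {}" "aff_dim S \<le> 3" "affine A" "\<not> affine hull S \<subseteq> A"
  shows "emeasure (flat_measure S) A = 0"
proof (rule dim_upto_3_cases[OF assms(1,2)])
  assume 0: "aff_dim S = 0"
  then obtain p where p: "S = {p}" using aff_dim_eq_0 by blast
  then show ?thesis using emeasure_flat_point[OF 0, of p A] assms(3,4) by (simp add: affine_closed borel_closed)
qed (metis flat_chart_exists flat_chart.affine_null assms(3,4))+

lemma flat_homothety:
  fixes S :: "'a::euclidean_space set"
  assumes S: "S \<noteq> {}" "aff_dim S \<le> 3" and d: "aff_dim S = int d" "1 \<le> d" and A: "compact A" "A \<subseteq> affine hull S"
    and q: "q \<in> affine hull S" "0 < t"
  shows "measure (flat_measure S) ((\<lambda>x. q + t *\<^sub>R (x - q)) ` A) = t ^ d * measure (flat_measure S) A"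
proof (rule dim_upto_3_cases[OF S])
  assume 1: "aff_dim S = int CARD(1)"
  then obtain J :: "real^1 \<Rightarrow> 'a" where "flat_chart J S (SOME x. x \<in> S)" by (rule flat_chart_exists)
  then show ?thesis using flat_chart.measure_homothety[OF _ A q] 1 d(1) by fastforce
next
  assume 2: "aff_dim S = int CARD(2)"
  then obtain J :: "real^2 \<Rightarrow> 'a" where "flat_chart J S (SOME x. x \<in> S)" by (rule flat_chart_exists)
  then show ?thesis using flat_chart.measure_homothety[OF _ A q] 2 d(1) by fastforce
next
  assume 3: "aff_dim S = int CARD(3)"
  then obtain J :: "real^3 \<Rightarrow> 'a" where "flat_chart J S (SOME x. x \<in> S)" by (rule flat_chart_exists)
  then show ?thesis using flat_chart.measure_homothety[OF _ A q] 3 d(1) by fastforce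
qed (use d in auto)

lemma flat_shear:
  fixes S :: "'a::euclidean_space set"
  assumes S: "S \<noteq> {}" "aff_dim S \<le> 3" and d: "1 \<le> aff_dim S" and A: "compact A" "A \<subseteq> affine hull S"
    and aw: "a \<in> tangent S" "w \<in> tangent S"
  shows "measure (flat_measure S) ((\<lambda>x. x + (a \<bullet> x + k) *\<^sub>R w) ` A) = \<bar>1 + a \<bullet> w\<bar> * measure (flat_measure S) A"
proof (rule dim_upto_3_cases[OF S])
  assume 1: "aff_dim S = int CARD(1)"
  then obtain J :: "real^1 \<Rightarrow> 'a" where "flat_chart J S (SOME x. x \<in> S)" by (rule flat_chart_exists)
  then show ?thesis by (rule flat_chart.measure_shear[OF _ A aw])
next
  assume 2: "aff_dim S = int CARD(2)"
  then obtain J :: "real^2 \<Rightarrow> 'a" where "flat_chart J S (SOME x. x \<in> S)" by (rule flat_chart_exists)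
  then show ?thesis by (rule flat_chart.measure_shear[OF _ A aw])
next
  assume 3: "aff_dim S = int CARD(3)"
  then obtain J :: "real^3 \<Rightarrow> 'a" where "flat_chart J S (SOME x. x \<in> S)" by (rule flat_chart_exists)
  then show ?thesis by (rule flat_chart.measure_shear[OF _ A aw])
qed (use d in auto)

section \<open>Energies on a single cell\<close>

lemma flat_set_integrable:
  fixes g :: "'a::euclidean_space \<Rightarrow> real"
  assumes S: "S \<noteq> {}" "aff_dim S \<le> 3" and T: "compact T" "continuous_on T g"
  shows "set_integrable (flat_measure S) T g"
proof -
  have Tb: "T \<in> sets borel" using T(1) by (simp add: borel_closed compact_imp_closed)
  obtain B where B: "\<And>x. x \<in> T \<Longrightarrow> norm (g x) \<le> B"
    using compact_imp_bounded[OF compact_continuous_image[OF T(2,1)]] by (auto simp: bounded_iff)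
  let ?g = "\<lambda>x. indicator T x *\<^sub>R g x"
  have m: "?g \<in> borel_measurable (flat_measure S)"
    using borel_measurable_continuous_on_indicator[OF Tb T(2)] by (simp add: measurable_cong_sets[OF sets_flat refl])
  have "integrable (flat_measure S) (\<lambda>x. indicator T x *\<^sub>R ?g x)"
    by (rule integrableI_bounded_set_indicator[where B=B])
      (use m Tb B flat_bounded_finite[OF S compact_imp_bounded[OF T(1)] Tb] in \<open>auto simp: indicator_def\<close>)
  then show ?thesis unfolding set_integrable_def
    by (rule Bochner_Integration.integrable_cong[THEN iffD1, rotated 2]) (auto simp: indicator_def)
qed

lemma set_integral_mono_subset:
  fixes g :: "'a \<Rightarrow> real"
  assumes "set_integrable M T g" "A \<in> sets M" "emeasure M A < \<infinity>" "A \<subseteq> T" "\<And>x. x \<in> T \<Longrightarrow> 0 \<le> g x" "\<And>x. x \<in> A \<Longrightarrow> c \<le> g x"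
  shows "c * measure M A \<le> (LINT x:T|M. g x)"
proof -
  have "c * measure M A = (\<integral>x. indicator A x * c \<partial>M)"
    using assms(2,3) by (simp add: mult.commute)
  also have "\<dots> \<le> (\<integral>x. indicator T x *\<^sub>R g x \<partial>M)"
  proof (rule integral_mono)
    show "integrable M (\<lambda>x. indicat_real A x * c)" using assms(2,3) by simp
    show "integrable M (\<lambda>x. indicator T x *\<^sub>R g x)" using assms(1) by (simp add: set_integrable_def)
    fix x show "indicat_real A x * c \<le> indicator T x *\<^sub>R g x" using assms(4,5,6) by (auto simp: indicator_def)
  qed
  finally show ?thesis by (simp add: set_lebesgue_integral_def)
qed

text \<open>If \<open>\<bar>s\<bar>\<close> is at most \<open>7/2\<close> times \<open>\<bar>c\<bar>\<close>, then \<open>s * l\<close> cannot cancel more than \<open>7/8\<close> of \<open>c\<close> for \<open>l\<close> up to \<open>1/4\<close>;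
otherwise \<open>s * l\<close> exceeds \<open>7/4\<close> of \<open>c\<close> in modulus as soon as \<open>l\<close> reaches \<open>1/2\<close>.\<close>

lemma affine_function_large_somewhere:
  fixes c s :: real
  shows "(\<forall>l. 0 \<le> l \<and> l \<le> 1/4 \<longrightarrow> c\<^sup>2 / 64 \<le> (c - s * l)\<^sup>2) \<or> (\<forall>l. 1/2 \<le> l \<and> l \<le> 1 \<longrightarrow> c\<^sup>2 / 64 \<le> (c - s * l)\<^sup>2)"
proof -
  have sq: "c\<^sup>2 / 64 \<le> y\<^sup>2" if "\<bar>c\<bar> / 8 \<le> \<bar>y\<bar>" for y
  proof -
    have "(\<bar>c\<bar> / 8)\<^sup>2 \<le> \<bar>y\<bar>\<^sup>2" using that by (intro power_mono) auto
    then show ?thesis by (simp add: power_divide)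
  qed
  show ?thesis
  proof (cases "\<bar>s\<bar> \<le> 7/2 * \<bar>c\<bar>")
    case True
    have "\<bar>c\<bar> / 8 \<le> \<bar>c - s * l\<bar>" if "0 \<le> l" "l \<le> 1/4" for l
    proof -
      have "\<bar>s * l\<bar> \<le> (7/2 * \<bar>c\<bar>) * (1/4)" unfolding abs_mult using True that by (intro mult_mono) auto
      then show ?thesis by linarith
    qed
    then show ?thesis using sq by blast
  next
    case False
    have "\<bar>c\<bar> / 8 \<le> \<bar>c - s * l\<bar>" if "1/2 \<le> l" for l
    proof -
      have "(7/2 * \<bar>c\<bar>) * (1/2) \<le> \<bar>s * l\<bar>" unfolding abs_mult using False that by (intro mult_mono) auto
      then show ?thesis by linarith
    qed
    then show ?thesis using sq by blast
  qed
qed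

definition cell_form :: "('a::euclidean_space \<Rightarrow> 'a) \<Rightarrow> 'a set \<Rightarrow> ('a \<Rightarrow> 'a) \<Rightarrow> ('a \<Rightarrow> 'a) \<Rightarrow> real" where
  "cell_form A T u v = (LINT x:T|flat_measure T. A (u x) \<bullet> v x)"

context simplex_cell
begin

lemma compact_T: "compact T" using fin T finite_imp_compact_convex_hull by simp

lemma T_borel: "T \<in> sets borel" using compact_T by (simp add: borel_closed compact_imp_closed)

lemma aff_dim_T: "aff_dim T = int (card C) - 1"
  unfolding T aff_dim_convex_hull using aff_dim_affine_independent[OF ind] by simp

lemma bary_homothety: "bary p (q + t *\<^sub>R (x - q)) = (1 - t) * bary p q + t * bary p x"
  by (simp add: bary_def inner_add_right inner_diff_right add_divide_distrib[symmetric] algebra_simps diff_divide_distrib[symmetric])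

lemma homothety_T:
  assumes "q \<in> C" "0 \<le> t" "t \<le> 1" "x \<in> T" shows "q + t *\<^sub>R (x - q) \<in> T"
proof -
  have "(1 - t) *\<^sub>R q + t *\<^sub>R x \<in> T"
    using assms C_T convex_convex_hull[of C] T by (intro convexD_alt) auto
  then show ?thesis by (simp add: algebra_simps)
qed

end

locale flat_cell = simplex_cell + assumes dim3: "aff_dim T \<le> 3"
begin

lemma finite_T: "A \<subseteq> T \<Longrightarrow> A \<in> sets borel \<Longrightarrow> emeasure (flat_measure T) A < \<infinity>"
  using flat_bounded_finite[OF T_ne dim3] compact_T compact_imp_bounded bounded_subset by blast

lemma measure_T_pos: "0 < measure (flat_measure T) T"
proof -
  have "convex T" unfolding T by (rule convex_convex_hull)
  then have "0 < emeasure (flat_measure T) (rel_interior T)"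
    using T_ne by (intro flat_open_positive[OF T_ne dim3]) (auto simp: rel_interior_eq_empty openin_rel_interior)
  also have "\<dots> \<le> emeasure (flat_measure T) T"
    using T_borel rel_interior_subset by (intro emeasure_mono) auto
  finally show ?thesis using finite_T[OF order.refl T_borel] by (simp add: measure_def enn2real_positive_iff)
qed

lemma measure_homothety_T:
  assumes "q \<in> C" "0 < t" "t \<le> 1" "1/4 \<le> t"
  shows "measure (flat_measure T) T / 64 \<le> measure (flat_measure T) ((\<lambda>x. q + t *\<^sub>R (x - q)) ` T)"
proof -
  define d where "d = card C - 1"
  have d: "aff_dim T = int d" "1 \<le> d" "d \<le> 3" using aff_dim_T card dim3 by (auto simp: d_def)
  have "(1/4) ^ 3 \<le> (1/4::real) ^ d" using d by (intro power_decreasing) auto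
  also have "\<dots> \<le> t ^ d" using assms by (intro power_mono) auto
  finally have "1/64 \<le> t ^ d" by (simp add: power3_eq_cube)
  then have "1/64 * measure (flat_measure T) T \<le> t ^ d * measure (flat_measure T) T"
    by (intro mult_right_mono) auto
  then show ?thesis
    using flat_homothety[OF T_ne dim3 d(1,2) compact_T hull_subset, of q t] assms C_T
    by (simp add: hull_inc subsetD)
qed

text \<open>One of the regions where the barycentric coordinate is at most \<open>1/4\<close> or at least \<open>1/2\<close> contributes enough.  The first one
contains a copy of \<open>T\<close> shrunk by \<open>1/4\<close> towards a vertex of the facet, the second one a copy shrunk by \<open>1/2\<close> towards \<open>p\<close>.
Either has at least \<open>1/64\<close> of the volume, and \<open>64 * 64 = 4096\<close>.\<close>

lemma affine_square_integral:
  assumes p: "p \<in> C" and g: "continuous_on T g" "\<And>x. x \<in> T \<Longrightarrow> (c - s * bary p x)\<^sup>2 \<le> g x"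
  shows "c\<^sup>2 * measure (flat_measure T) T / 4096 \<le> (LINT x:T|flat_measure T. g x)"
proof -
  have int: "set_integrable (flat_measure T) T g" by (rule flat_set_integrable[OF T_ne dim3 compact_T g(1)])
  have main: "c\<^sup>2 * measure (flat_measure T) T / 4096 \<le> (LINT x:T|flat_measure T. g x)"
    if q: "q \<in> C" and t: "0 < t" "t \<le> 1" "1/4 \<le> t" and b: "\<And>x. x \<in> T \<Longrightarrow> c\<^sup>2 / 64 \<le> (c - s * bary p (q + t *\<^sub>R (x - q)))\<^sup>2" for q t
  proof -
    let ?A = "(\<lambda>x. q + t *\<^sub>R (x - q)) ` T"
    have A: "?A \<subseteq> T" using homothety_T[OF q] t by auto
    have "compact ?A" using compact_T by (intro compact_continuous_image continuous_intros)
    then have Ab: "?A \<in> sets borel" by (simp add: borel_closed compact_imp_closed)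
    have "c\<^sup>2 / 64 * (measure (flat_measure T) T / 64) \<le> c\<^sup>2 / 64 * measure (flat_measure T) ?A"
      using measure_homothety_T[OF q t] by (intro mult_left_mono) auto
    also have "\<dots> \<le> (LINT x:T|flat_measure T. g x)"
    proof (rule set_integral_mono_subset[OF int])
      show "0 \<le> g x" if "x \<in> T" for x using g(2)[OF that] by (rule order_trans[rotated]) simp
      show "c\<^sup>2 / 64 \<le> g x" if x: "x \<in> ?A" for x
      proof -
        obtain y where y: "y \<in> T" "x = q + t *\<^sub>R (y - q)" using x by blast
        have "x \<in> T" using x A by blast
        then show ?thesis using order_trans[OF b[OF y(1)] g(2)[of x, unfolded y(2)]] y(2) by simp
      qed
    qed (use Ab A finite_T[OF A Ab] in auto)
    finally show ?thesis by simp
  qed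
  obtain w where w: "w \<in> C" "w \<noteq> p" using other[OF p] by blast
  have bb: "0 \<le> bary p x" "bary p x \<le> 1" if "x \<in> T" for x using that T_bary bary_le_1 p by auto
  from affine_function_large_somewhere[of c s] show ?thesis
  proof
    assume h: "\<forall>l. 0 \<le> l \<and> l \<le> 1/4 \<longrightarrow> c\<^sup>2 / 64 \<le> (c - s * l)\<^sup>2"
    show ?thesis
    proof (rule main[OF w(1), of "1/4"])
      fix x assume "x \<in> T"
      then have "0 \<le> bary p (w + (1/4) *\<^sub>R (x - w))" "bary p (w + (1/4) *\<^sub>R (x - w)) \<le> 1/4"
        using bb[of x] w(2) unfolding bary_homothety by (auto simp: bary_vertex p w(1))
      then show "c\<^sup>2 / 64 \<le> (c - s * bary p (w + (1/4) *\<^sub>R (x - w)))\<^sup>2" using h by blast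
    qed auto
  next
    assume h: "\<forall>l. 1/2 \<le> l \<and> l \<le> 1 \<longrightarrow> c\<^sup>2 / 64 \<le> (c - s * l)\<^sup>2"
    show ?thesis
    proof (rule main[OF p, of "1/2"])
      fix x assume "x \<in> T"
      then have "1/2 \<le> bary p (p + (1/2) *\<^sub>R (x - p))" "bary p (p + (1/2) *\<^sub>R (x - p)) \<le> 1"
        using bb[of x] unfolding bary_homothety by (auto simp: bary_vertex p)
      then show "c\<^sup>2 / 64 \<le> (c - s * bary p (p + (1/2) *\<^sub>R (x - p)))\<^sup>2" using h by blast
    qed auto
  qed
qed

text \<open>The component of \<open>v\<close> along the normal of \<open>f\<close> is an affine function of the barycentric coordinate belonging to \<open>f\<close>, with
value \<open>normal_comp v T f\<close> on the facet itself.\<close>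

lemma cell_form_lower:
  assumes A: "linear A" "0 \<le> l" "\<And>\<xi>. \<xi> \<in> tangent T \<Longrightarrow> l * (\<xi> \<bullet> \<xi>) \<le> A \<xi> \<bullet> \<xi>"
    and v: "v \<in> RT0 T" and f: "f facet_of T"
  shows "l * ((normal_comp v T f)\<^sup>2 * measure (flat_measure T) T / 4096) \<le> cell_form A T v v"
proof -
  obtain p where p: "p \<in> C" "f = F p" using f facet_iff by blast
  obtain y where y: "y \<in> F p" using F_ne[OF p(1)] by blast
  obtain b where b: "\<And>x y. v x = v y + b *\<^sub>R (x - y)" using RT0_shape[OF v] by blast
  let ?c = "normal_comp v T f"
  have c: "?c = v y \<bullet> nrm p" using normal_comp_eq[OF v p(1) y] p(2) by simp
  have cv: "continuous_on T v" by (rule continuous_RT0[OF v])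
  have cA: "continuous_on T (\<lambda>x. A (v x) \<bullet> v x)"
    by (intro continuous_intros linear_continuous_on_compose[OF _ A(1)] cv)
  have "?c\<^sup>2 * measure (flat_measure T) T / 4096 \<le> (LINT x:T|flat_measure T. v x \<bullet> v x)"
  proof (rule affine_square_integral[OF p(1), where s = "b * ht p"])
    fix x assume "x \<in> T"
    have "v x \<bullet> nrm p = ?c + b * ((x - y) \<bullet> nrm p)"
      unfolding c using b[of x y] by (simp add: inner_add_left)
    also have "(x - y) \<bullet> nrm p = - (ht p * bary p x)"
      using nrm_F[OF p(1) y] ht_pos[OF p(1)] by (simp add: bary_def inner_diff_right inner_commute[of _ "nrm p"])
    finally have "?c - b * ht p * bary p x = v x \<bullet> nrm p" by simp
    also have "(v x \<bullet> nrm p)\<^sup>2 \<le> (v x \<bullet> v x) * (nrm p \<bullet> nrm p)" by (rule Cauchy_Schwarz_ineq)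
    also have "\<dots> = v x \<bullet> v x" using norm_nrm[OF p(1)] by (simp add: norm_eq_1)
    finally show "(?c - b * ht p * bary p x)\<^sup>2 \<le> v x \<bullet> v x" .
  qed (intro continuous_intros cv)
  then have "l * (?c\<^sup>2 * measure (flat_measure T) T / 4096) \<le> l * (LINT x:T|flat_measure T. v x \<bullet> v x)"
    using A(2) by (intro mult_left_mono)
  also have "\<dots> = (LINT x:T|flat_measure T. l * (v x \<bullet> v x))" by simp
  also have "\<dots> \<le> cell_form A T v v"
    unfolding cell_form_def
  proof (rule set_integral_mono)
    show "l * (v x \<bullet> v x) \<le> A (v x) \<bullet> v x" if "x \<in> T" for x
      using A(3) RT0_tangent[OF v] that by (simp add: hull_inc)
  qed (intro flat_set_integrable[OF T_ne dim3 compact_T] cA continuous_intros cv)+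
  finally show ?thesis .
qed

lemma cell_form_psd:
  assumes A: "linear A" "\<And>\<xi> \<eta>. \<xi> \<in> tangent T \<Longrightarrow> \<eta> \<in> tangent T \<Longrightarrow> A \<xi> \<bullet> \<eta> = \<xi> \<bullet> A \<eta>" "\<And>\<xi>. \<xi> \<in> tangent T \<Longrightarrow> 0 \<le> A \<xi> \<bullet> \<xi>"
  shows "psd_form fscale (RT0 T) (cell_form A T)"
proof -
  have int: "set_integrable (flat_measure T) T (\<lambda>x. A (u x) \<bullet> v x)" if "u \<in> RT0 T" "v \<in> RT0 T" for u v
    by (intro flat_set_integrable[OF T_ne dim3 compact_T] continuous_intros linear_continuous_on_compose[OF _ A(1)] continuous_RT0[OF that(1)] continuous_RT0[OF that(2)])
  show ?thesis
  proof (intro psd_form.intro vector_space_fscale psd_form_axioms.intro)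
    show "fscale.subspace (RT0 T)" by (rule RT0_subspace[OF T_ne])
    fix u v w :: "'a \<Rightarrow> 'a" assume u: "u \<in> RT0 T"
    show "0 \<le> cell_form A T u u"
      unfolding cell_form_def set_lebesgue_integral_def
      by (rule Bochner_Integration.integral_nonneg) (use A(3) RT0_tangent[OF u] in \<open>auto simp: indicator_def hull_inc\<close>)
    assume v: "v \<in> RT0 T"
    show "cell_form A T u v = cell_form A T v u"
      unfolding cell_form_def using T_borel A(2) RT0_tangent[OF u] RT0_tangent[OF v]
      by (intro set_lebesgue_integral_cong) (auto simp: hull_inc inner_commute)
    show "cell_form A T (fscale c u) v = c * cell_form A T u v" for c
      unfolding cell_form_def fscale_def using A(1) by (simp add: linear_scale)
    assume w: "w \<in> RT0 T"
    show "cell_form A T (u + v) w = cell_form A T u w + cell_form A T v w"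
      unfolding cell_form_def using int[OF u w] int[OF v w] A(1)
      by (simp add: linear_add inner_add_left set_integral_add)
  qed
qed

text \<open>The basis field is the position relative to the opposite vertex divided by the height.  The height is at least the radius
of an inscribed ball, because the ball fits between the facet and the parallel plane through the vertex.\<close>

lemma facet_basis_bound:
  assumes r: "0 < r" "x0 \<in> T" "cball x0 r \<inter> affine hull T \<subseteq> T" "diameter T \<le> \<sigma> * r"
    and f: "f facet_of T" and x: "x \<in> T"
  shows "norm (facet_basis T f x) \<le> \<sigma>"
proof -
  obtain p where p: "p \<in> C" "f = F p" using f facet_iff by blast
  have x0: "x0 \<in> affine hull T" using r(2) by (simp add: hull_inc)
  have "x0 + r *\<^sub>R nrm p \<in> affine hull T"
    unfolding affine_hull_tangent'[OF x0] using nrm_tangent[OF p(1)] by (simp add: subspace_scale tangent_subspace)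
  moreover have "x0 + r *\<^sub>R nrm p \<in> cball x0 r" using r(1) norm_nrm[OF p(1)] by (simp add: dist_norm)
  ultimately have "0 \<le> bary p (x0 + r *\<^sub>R nrm p)" using r(3) T_bary p(1) by blast
  then have "nrm p \<bullet> x0 + r \<le> off p"
    using ht_pos[OF p(1)] norm_nrm[OF p(1)] by (simp add: bary_def inner_add_right zero_le_divide_iff norm_eq_1)
  moreover have "off p - nrm p \<bullet> x0 \<le> ht p"
    using bary_le_1[OF r(2) p(1)] ht_pos[OF p(1)] by (simp add: bary_def)
  ultimately have h: "r \<le> ht p" by linarith
  have "dist x p \<le> diameter T"
    using diameter_bounded_bound[OF compact_imp_bounded[OF compact_T]] x p C_T by blast
  then have "norm (x - p) \<le> \<sigma> * r" using r(4) by (simp add: dist_norm)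
  moreover have "0 \<le> \<sigma>" using \<open>norm (x - p) \<le> \<sigma> * r\<close> r(1) norm_ge_zero[of "x - p"]
    by (metis order_trans zero_le_mult_iff not_less)
  ultimately have "norm (x - p) \<le> \<sigma> * ht p" using h by (meson mult_left_mono order_trans)
  then show ?thesis unfolding p(2) facet_basis_F[OF p(1)] \<phi>_def using ht_pos[OF p(1)] by (simp add: pos_divide_le_eq del: scaleR_diff_right)
qed

lemma cell_form_facet_basis_upper:
  assumes A: "linear A" "0 \<le> m" "\<And>\<xi>. \<xi> \<in> tangent T \<Longrightarrow> A \<xi> \<bullet> \<xi> \<le> m * (\<xi> \<bullet> \<xi>)" and f: "f facet_of T"
    and b: "\<And>x. x \<in> T \<Longrightarrow> norm (facet_basis T f x) \<le> \<sigma>"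
  shows "cell_form A T (facet_basis T f) (facet_basis T f) \<le> m * \<sigma>\<^sup>2 * measure (flat_measure T) T"
proof -
  let ?\<phi> = "facet_basis T f"
  have c: "continuous_on T ?\<phi>" by (rule continuous_RT0[OF facet_basis_RT0[OF f]])
  have "cell_form A T ?\<phi> ?\<phi> \<le> (LINT x:T|flat_measure T. m * \<sigma>\<^sup>2)"
    unfolding cell_form_def
  proof (rule set_integral_mono)
    fix x assume x: "x \<in> T"
    have "A (?\<phi> x) \<bullet> ?\<phi> x \<le> m * (?\<phi> x \<bullet> ?\<phi> x)"
      using A(3) RT0_tangent[OF facet_basis_RT0[OF f]] x by (simp add: hull_inc)
    also have "?\<phi> x \<bullet> ?\<phi> x \<le> \<sigma>\<^sup>2" using b[OF x] by (simp add: dot_square_norm power_mono)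
    finally show "A (?\<phi> x) \<bullet> ?\<phi> x \<le> m * \<sigma>\<^sup>2" using A(2) by (simp add: mult_left_mono)
  qed (intro flat_set_integrable[OF T_ne dim3 compact_T] continuous_intros linear_continuous_on_compose[OF _ A(1)] c)+
  also have "\<dots> = m * \<sigma>\<^sup>2 * measure (flat_measure T) T"
    using T_borel finite_T[OF order.refl T_borel] by (simp add: set_lebesgue_integral_def)
  finally show ?thesis .
qed

end

text \<open>The volume of a simplex over a fixed base is proportional to its height.  The map
\<open>G x = x + bary p x (q - p)\<close> fixes the facet, moves the apex \<open>p\<close> of \<open>T\<close> to the apex \<open>q\<close> of \<open>T'\<close>, and so maps \<open>T\<close> onto
\<open>T'\<close>.  It is a shear whose determinant is the ratio of the two heights.\<close>

lemma height_ratio: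
  assumes a: "flat_cell C T" and b: "flat_cell C' T'" and eq: "affine hull T' = affine hull T"
    and p: "p \<in> C" "q \<in> C'" "simplex_cell.F C p = simplex_cell.F C' q"
  shows "measure (flat_measure T') T' / simplex_cell.ht C' T' q = measure (flat_measure T) T / simplex_cell.ht C T p"
proof -
  interpret a: flat_cell C T by (rule a)
  interpret b: flat_cell C' T' by (rule b)
  \<comment> \<open>\<open>bary p x = aa \<bullet> x + k\<close>, so that \<open>G\<close> becomes a rank one perturbation of the identity\<close>
  define aa where "aa = (- 1 / a.ht p) *\<^sub>R a.nrm p"
  define k where "k = a.off p / a.ht p"
  define w where "w = q - p"
  have hp: "a.ht p \<noteq> 0" using a.ht_pos[OF p(1)] by simp
  have tan: "tangent T' = tangent T" by (rule tangent_cong_hull[OF eq])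
  have qT: "q \<in> affine hull T" using b.C_T p(2) eq by (metis hull_inc subsetD)
  have in_tangent: "w \<in> tangent T" "aa \<in> tangent T"
    using tangent_hull_diff[OF qT, of p] a.C_T p(1) a.nrm_tangent[OF p(1)]
    by (auto simp: w_def aa_def hull_inc subsetD subspace_neg subspace_scale tangent_subspace)
  let ?G = "\<lambda>x. x + (aa \<bullet> x + k) *\<^sub>R w"
  have coef: "aa \<bullet> x + k = a.bary p x" for x
    by (simp add: aa_def k_def a.bary_def diff_divide_distrib)
  have "?G ` C = insert q (C - {p})"
  proof -
    have apex: "?G p = q" using a.bary_vertex[OF p(1) p(1)] by (simp add: coef w_def)
    have fixed: "?G x = x" if "x \<in> C - {p}" for x using a.bary_vertex[OF p(1), of x] that by (simp add: coef)
    have "?G ` (C - {p}) = (\<lambda>x. x) ` (C - {p})" by (rule image_cong[OF refl fixed])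
    moreover have "?G ` C = insert (?G p) (?G ` (C - {p}))" using p(1) by blast
    ultimately show ?thesis using apex by simp
  qed
  have "?G ` T = (+) (k *\<^sub>R w) ` ((\<lambda>x. x + (aa \<bullet> x) *\<^sub>R w) ` T)"
    by (auto simp: image_image algebra_simps)
  also have "\<dots> = convex hull ((+) (k *\<^sub>R w) ` ((\<lambda>x. x + (aa \<bullet> x) *\<^sub>R w) ` C))"
    unfolding a.T convex_hull_translation
    by (subst convex_hull_linear_image) (auto intro!: linearI simp: inner_add_right algebra_simps)
  also have "(+) (k *\<^sub>R w) ` ((\<lambda>x. x + (aa \<bullet> x) *\<^sub>R w) ` C) = ?G ` C"
    by (auto simp: image_image algebra_simps)
  also have "convex hull (?G ` C) = convex hull (insert q (convex hull (C - {p})))"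
    unfolding \<open>?G ` C = _\<close> by (rule hull_insert)
  also have "\<dots> = convex hull (insert q (convex hull (C' - {q})))"
    using p(3) by (simp add: a.F_def b.F_def)
  also have "\<dots> = convex hull (insert q (C' - {q}))" by (rule hull_insert[symmetric])
  also have "\<dots> = T'" using p(2) b.T by (simp add: insert_absorb)
  finally have G: "?G ` T = T'" .
  have fl: "flat_measure T' = flat_measure T" by (rule flat_measure_cong[OF a.T_ne a.dim3 eq])
  have "measure (flat_measure T) T' = \<bar>1 + aa \<bullet> w\<bar> * measure (flat_measure T) T"
    using flat_shear[OF a.T_ne a.dim3 _ a.compact_T hull_subset in_tangent(2,1), of k] a.aff_dim_T a.card G by simp
  \<comment> \<open>\<open>q\<close> may lie on either side of the facet, hence the modulus\<close>
  moreover have "\<bar>1 + aa \<bullet> w\<bar> = b.ht q / a.ht p"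
  proof -
    have "1 + aa \<bullet> w = (a.off p - a.nrm p \<bullet> q) / a.ht p"
      using hp by (simp add: aa_def w_def inner_diff_right a.nrm_apex[OF p(1)] field_simps)
    moreover have "\<bar>a.off p - a.nrm p \<bullet> q\<bar> = b.ht q"
    proof -
      obtain y where y: "y \<in> a.F p" using a.F_ne[OF p(1)] by blast
      have "a.nrm p = b.nrm q \<or> a.nrm p = - b.nrm q"
        using b.nrm_unique[OF p(2), of "a.nrm p" "a.off p"] a.nrm_tangent[OF p(1)] a.norm_nrm[OF p(1)] a.nrm_F[OF p(1)] tan p(3)
        by auto
      moreover have "a.nrm p \<bullet> y = a.off p" "b.nrm q \<bullet> y = b.off q" using y p a.nrm_F b.nrm_F by auto
      ultimately show ?thesis using b.nrm_apex[OF p(2)] b.ht_pos[OF p(2)] by auto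
    qed
    ultimately show ?thesis using a.ht_pos[OF p(1)] by (simp add: abs_divide)
  qed
  ultimately show ?thesis unfolding fl using hp b.ht_pos[OF p(2)] by (simp add: field_simps)
qed

text \<open>The quotient of the two quadratic forms attains its minimum on the unit sphere of the subspace.\<close>

lemma pos_def_lower_bound:
  fixes A :: "'a::euclidean_space \<Rightarrow> 'a"
  assumes "linear A" "subspace U" "\<And>\<xi>. \<xi> \<in> U \<Longrightarrow> \<xi> \<noteq> 0 \<Longrightarrow> 0 < A \<xi> \<bullet> \<xi>"
  obtains l where "0 < l" "\<And>\<xi>. \<xi> \<in> U \<Longrightarrow> l * (\<xi> \<bullet> \<xi>) \<le> A \<xi> \<bullet> \<xi>"
proof (cases "U \<inter> sphere 0 1 = {}")
  case True
  have "\<xi> = 0" if "\<xi> \<in> U" for \<xi>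
  proof (rule ccontr)
    assume "\<xi> \<noteq> 0"
    then have "(1 / norm \<xi>) *\<^sub>R \<xi> \<in> U \<inter> sphere 0 1" using that assms(2) by (simp add: subspace_scale)
    then show False using True by blast
  qed
  then show ?thesis using that[of 1] linear_0[OF assms(1)] by force
next
  case False
  have "compact (U \<inter> sphere 0 1)"
    using closed_subspace[OF assms(2)] by (simp add: closed_Int_compact)
  moreover have "continuous_on (U \<inter> sphere 0 1) (\<lambda>\<xi>. A \<xi> \<bullet> \<xi>)"
    by (intro continuous_intros linear_continuous_on_compose[OF _ assms(1)])
  ultimately obtain \<xi>0 where x0: "\<xi>0 \<in> U \<inter> sphere 0 1" "\<And>\<xi>. \<xi> \<in> U \<inter> sphere 0 1 \<Longrightarrow> A \<xi>0 \<bullet> \<xi>0 \<le> A \<xi> \<bullet> \<xi>"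
    using continuous_attains_inf[OF _ False, of "\<lambda>\<xi>. A \<xi> \<bullet> \<xi>"] by blast
  have "\<xi>0 \<noteq> 0" using x0(1) by auto
  show ?thesis
  proof (rule that)
    show "0 < A \<xi>0 \<bullet> \<xi>0" using assms(3) x0(1) \<open>\<xi>0 \<noteq> 0\<close> by blast
    fix \<xi> assume \<xi>: "\<xi> \<in> U"
    show "A \<xi>0 \<bullet> \<xi>0 * (\<xi> \<bullet> \<xi>) \<le> A \<xi> \<bullet> \<xi>"
    proof (cases "\<xi> = 0")
      case True then show ?thesis by simp
    next
      case False
      then have "(1 / norm \<xi>) *\<^sub>R \<xi> \<in> U \<inter> sphere 0 1" using \<xi> assms(2) by (simp add: subspace_scale)
      from x0(2)[OF this] have "A \<xi>0 \<bullet> \<xi>0 \<le> (A \<xi> \<bullet> \<xi>) / (norm \<xi>)\<^sup>2"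
        by (simp add: linear_scale[OF assms(1)] power2_eq_square)
      then show ?thesis using False by (simp add: dot_square_norm field_simps)
    qed
  qed
qed

section \<open>Integrals of piecewise constants\<close>

lemma finite_sum_indicator_integral:
  fixes S :: "'a::euclidean_space set"
  assumes S: "S \<noteq> {}" "aff_dim S \<le> 3" and A: "bounded A" "A \<in> sets borel" and J: "finite J" "\<And>j. j \<in> J \<Longrightarrow> B j \<in> sets borel"
  shows "(LINT x:A|flat_measure S. (\<Sum>j\<in>J. c j * indicator (B j) x)) = (\<Sum>j\<in>J. c j * measure (flat_measure S) (B j \<inter> A))" (is ?e)
    and "set_integrable (flat_measure S) A (\<lambda>x. \<Sum>j\<in>J. c j * indicator (B j) x)"
proof -
  have BA: "B j \<inter> A \<in> sets borel" "emeasure (flat_measure S) (B j \<inter> A) < \<infinity>" if "j \<in> J" for j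
    using J(2)[OF that] A flat_bounded_finite[OF S, of "B j \<inter> A"] bounded_subset[OF A(1), of "B j \<inter> A"] by auto
  have eq: "(\<lambda>x. indicator A x *\<^sub>R (\<Sum>j\<in>J. c j * indicator (B j) x)) = (\<lambda>x. \<Sum>j\<in>J. indicator (B j \<inter> A) x *\<^sub>R c j)"
    by (auto simp: fun_eq_iff sum_distrib_left indicator_def intro!: sum.cong)
  have int: "integrable (flat_measure S) (\<lambda>x. indicator (B j \<inter> A) x *\<^sub>R c j)" if "j \<in> J" for j
    using BA[OF that] by (intro integrable_scaleR_left integrable_real_indicator) auto
  show ?e
    unfolding set_lebesgue_integral_def eq using int BA
    by (subst Bochner_Integration.integral_sum) (auto simp: mult.commute intro!: sum.cong)
  show "set_integrable (flat_measure S) A (\<lambda>x. \<Sum>j\<in>J. c j * indicator (B j) x)"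
    unfolding set_integrable_def eq by (intro Bochner_Integration.integrable_sum int)
qed

lemma rel_interior_borel: "convex S \<Longrightarrow> rel_interior S \<in> sets borel" for S :: "'a::euclidean_space set"
  by (metis affine_affine_hull affine_closed borel_closed borel_open openin_open openin_rel_interior sets.Int)

definition disjoint_interiors :: "'a::euclidean_space set set \<Rightarrow> bool" where
  "disjoint_interiors \<T> \<longleftrightarrow> finite \<T> \<and> (\<forall>T\<in>\<T>. convex T) \<and>
     (\<forall>T\<in>\<T>. \<forall>T'\<in>\<T>. rel_interior T \<inter> rel_interior T' \<noteq> {} \<longrightarrow> T = T')"

lemma P0_fun_mult:
  assumes "disjoint_interiors \<T>"
  shows "P0_fun \<T> q x * P0_fun \<T> q' x = (\<Sum>T\<in>\<T>. (q T * q' T) * indicator (rel_interior T) x)"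
proof -
  have "P0_fun \<T> q x * P0_fun \<T> q' x =
    (\<Sum>T\<in>\<T>. \<Sum>T'\<in>\<T>. (q T * indicator (rel_interior T) x) * (q' T' * indicator (rel_interior T') x))"
    by (simp add: P0_fun_def sum_product)
  also have "\<dots> = (\<Sum>T\<in>\<T>. \<Sum>T'\<in>\<T>. if T' = T then (q T * q' T) * indicator (rel_interior T) x else 0)"
    using assms unfolding disjoint_interiors_def by (intro sum.cong refl) (auto simp: indicator_def)
  also have "\<dots> = (\<Sum>T\<in>\<T>. (q T * q' T) * indicator (rel_interior T) x)"
    using assms by (intro sum.cong refl) (simp add: disjoint_interiors_def)
  finally show ?thesis .
qed

lemma triangulation_disjoint_interiors: "triangulation \<T> \<Longrightarrow> disjoint_interiors \<T>"
proof -
  assume t: "triangulation \<T>"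
  have "T = T'" if h: "T \<in> \<T>" "T' \<in> \<T>" "rel_interior T \<inter> rel_interior T' \<noteq> {}" for T T'
  proof -
    have f: "(T \<inter> T') face_of T" "(T' \<inter> T) face_of T'" using t h by (auto simp: triangulation_def)
    then have f: "(T \<inter> T') face_of T" "(T \<inter> T') face_of T'" by (simp_all add: Int_commute)
    obtain x where x: "x \<in> rel_interior T" "x \<in> rel_interior T'" using h(3) by blast
    then have "x \<in> T \<inter> T'" using rel_interior_subset by blast
    then have "T \<subseteq> T \<inter> T'" "T' \<subseteq> T \<inter> T'"
      using subset_of_face_of[OF f(1), of T] subset_of_face_of[OF f(2), of T'] x by blast+
    then show ?thesis by blast
  qed
  then show ?thesis using t convex_simplex unfolding triangulation_def disjoint_interiors_def by blast
qed

section \<open>Cells, facets and interfaces of a fractured medium\<close>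

locale fractured_disc =
  fixes D :: "'a::euclidean_space discretization" and \<sigma> :: real
  assumes adm: "admissible \<sigma> D" and dimA: "DIM('a) = 2 \<or> DIM('a) = 3"
begin

lemma med: "fractured_medium D" and phys: "physical_parameters D" and msh: "mesh \<sigma> D"
  using adm by (auto simp: admissible_def)

lemma finite_subs: "finite (subs D)" and finite_ifaces: "finite (ifaces D)"
  using med by (auto simp: fractured_medium_def)

lemma sub_dim: "i \<in> subs D \<Longrightarrow> aff_dim (sdom D i) = int (sdim D i)"
  and sub_connected: "i \<in> subs D \<Longrightarrow> connected (sdom D i)"
  and sub_open: "i \<in> subs D \<Longrightarrow> openin (top_of_set (affine hull (sdom D i))) (sdom D i)"
  using med by (auto simp: fractured_medium_def)

lemma sub_disjoint: "i \<in> subs D \<Longrightarrow> k \<in> subs D \<Longrightarrow> x \<in> sdom D i \<Longrightarrow> x \<in> sdom D k \<Longrightarrow> i = k"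
  using med by (auto simp: fractured_medium_def disjoint_family_on_def)

lemma sub_ne: "i \<in> subs D \<Longrightarrow> sdom D i \<noteq> {}" using sub_dim by fastforce

lemma sub_dim3: "i \<in> subs D \<Longrightarrow> aff_dim (sdom D i) \<le> 3"
  using aff_dim_le_DIM[of "sdom D i"] dimA by auto

lemma sub_borel: "i \<in> subs D \<Longrightarrow> sdom D i \<in> sets borel"
  using sub_open[of i] unfolding openin_open by (metis affine_affine_hull affine_closed borel_closed borel_open sets.Int)

lemma
  assumes "e \<in> ifaces D"
  shows lower_sub: "lower D e \<in> subs D" and upper_sub: "upper D e \<in> subs D" and adj: "adjacent D (lower D e) (upper D e) (inormal D e)"
proof -
  have "(\<lambda>e. (lower D e, upper D e, inormal D e)) ` ifaces D = {(i, k, \<nu>). i \<in> subs D \<and> k \<in> subs D \<and> adjacent D i k \<nu>}"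
    using med by (simp add: fractured_medium_def bij_betw_def)
  then show "lower D e \<in> subs D" "upper D e \<in> subs D" "adjacent D (lower D e) (upper D e) (inormal D e)" using assms by blast+
qed

lemma iface_inj:
  assumes "e \<in> ifaces D" "e' \<in> ifaces D" "lower D e = lower D e'" "upper D e = upper D e'" "inormal D e = inormal D e'"
  shows "e = e'"
proof -
  have "inj_on (\<lambda>e. (lower D e, upper D e, inormal D e)) (ifaces D)"
    using med by (simp add: fractured_medium_def bij_betw_def)
  then show ?thesis using assms by (auto dest: inj_onD)
qed

lemma upper_dim: "e \<in> ifaces D \<Longrightarrow> sdim D (upper D e) = Suc (sdim D (lower D e))"
  using adj by (simp add: adjacent_def)

lemma cells_tri: "i \<in> subs D \<Longrightarrow> triangulates (sdim D i) (cells D i) (sdom D i)"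
  and mcells_tri: "e \<in> ifaces D \<Longrightarrow> triangulates (sdim D (lower D e)) (mcells D e) (iface_dom D e)"
  and trace_union: "e \<in> ifaces D \<Longrightarrow> \<Union>(trace_cells D e) = closure (iface_dom D e)"
  and cells_regular: "i \<in> subs D \<Longrightarrow> shape_regular \<sigma> (cells D i)"
  using msh by (auto simp: mesh_def)

lemma facet_cases:
  assumes "i \<in> subs D" "T \<in> cells D i" "f facet_of T"
  shows "rel_interior f \<subseteq> sdom D i \<or> on_iface D i T f \<or> rel_interior f \<subseteq> bdryD D \<or> rel_interior f \<subseteq> bdryN D"
  using msh assms by (simp add: mesh_def)

lemma iface_dom_eq: "iface_dom D e = sdom D (lower D e)" by (simp add: iface_dom_def)

text \<open>Common to the meshes of subdomains and of interfaces: the cells have the dimension of the subdomain and hence its affine hull.\<close>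

lemma tri_facts:
  assumes i: "i \<in> subs D" and t: "triangulates (sdim D i) \<T> (sdom D i)"
  shows "finite \<T>" "disjoint_interiors \<T>" "\<Union>\<T> = closure (sdom D i)"
    "T \<in> \<T> \<Longrightarrow> int (sdim D i) simplex T" "T \<in> \<T> \<Longrightarrow> rel_interior T \<subseteq> sdom D i" "T \<in> \<T> \<Longrightarrow> affine hull T = affine hull (sdom D i)"
    "T \<in> \<T> \<Longrightarrow> T' \<in> \<T> \<Longrightarrow> (T \<inter> T') face_of T"
proof -
  show "finite \<T>" "disjoint_interiors \<T>" "\<Union>\<T> = closure (sdom D i)"
    "T \<in> \<T> \<Longrightarrow> int (sdim D i) simplex T" "T \<in> \<T> \<Longrightarrow> rel_interior T \<subseteq> sdom D i"
    "T \<in> \<T> \<Longrightarrow> T' \<in> \<T> \<Longrightarrow> (T \<inter> T') face_of T"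
    using t triangulation_disjoint_interiors unfolding triangulates_def triangulation_def by blast+
  assume T: "T \<in> \<T>"
  have "T \<subseteq> closure (sdom D i)" using T t by (auto simp: triangulates_def)
  moreover have "aff_dim T = aff_dim (closure (sdom D i))"
    using T t sub_dim[OF i] aff_dim_simplex by (auto simp: triangulates_def)
  ultimately have "affine hull T = affine hull (closure (sdom D i))" using aff_dim_eq_full_gen by blast
  then show "affine hull T = affine hull (sdom D i)" by simp
qed

lemma
  assumes "i \<in> subs D"
  shows cell_finite: "finite (cells D i)" and cell_union: "\<Union>(cells D i) = closure (sdom D i)"
    and cell_simplex: "T \<in> cells D i \<Longrightarrow> int (sdim D i) simplex T"
    and cell_interior: "T \<in> cells D i \<Longrightarrow> rel_interior T \<subseteq> sdom D i"
    and cell_hull: "T \<in> cells D i \<Longrightarrow> affine hull T = affine hull (sdom D i)"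
    and cell_face: "T \<in> cells D i \<Longrightarrow> T' \<in> cells D i \<Longrightarrow> (T \<inter> T') face_of T"
  using tri_facts[OF assms cells_tri[OF assms]] by blast+

lemma mcell_facts:
  assumes e: "e \<in> ifaces D"
  shows "finite (mcells D e)" "disjoint_interiors (mcells D e)" "\<Union>(mcells D e) = closure (iface_dom D e)"
    "S \<in> mcells D e \<Longrightarrow> int (sdim D (lower D e)) simplex S"
    "S \<in> mcells D e \<Longrightarrow> rel_interior S \<subseteq> iface_dom D e" "S \<in> mcells D e \<Longrightarrow> affine hull S = affine hull (iface_dom D e)"
  using tri_facts[OF lower_sub[OF e] mcells_tri[OF e, unfolded iface_dom_eq]] by (simp_all add: iface_dom_eq)

lemma cell_tangent: "i \<in> subs D \<Longrightarrow> T \<in> cells D i \<Longrightarrow> tangent T = tangent (sdom D i)"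
  using cell_hull tangent_cong_hull by blast

lemma cell_ne: "i \<in> subs D \<Longrightarrow> T \<in> cells D i \<Longrightarrow> T \<noteq> {}"
  using cell_simplex[of i T] by auto

lemma cell_flat: "i \<in> subs D \<Longrightarrow> T \<in> cells D i \<Longrightarrow> flat_measure T = flat_measure (sdom D i)"
  by (rule flat_measure_cong[OF sub_ne sub_dim3 cell_hull])

lemma cell_dim: "i \<in> subs D \<Longrightarrow> T \<in> cells D i \<Longrightarrow> aff_dim T = int (sdim D i)"
  using cell_simplex aff_dim_simplex by blast

lemma cell_flat_cell:
  assumes "i \<in> subs D" "T \<in> cells D i" "1 \<le> sdim D i" obtains C where "flat_cell C T" "card C = Suc (sdim D i)"
proof -
  obtain C where C: "simplex_cell C T" "card C = Suc (sdim D i)"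
    using simplex_cellI[OF cell_simplex[OF assms(1,2)] assms(3)] by blast
  have "aff_dim T \<le> 3" using cell_dim[OF assms(1,2)] sub_dim[OF assms(1)] sub_dim3[OF assms(1)] by simp
  then show ?thesis using that C by (simp add: flat_cell_def flat_cell_axioms_def)
qed

lemma facet_dim_pos: "i \<in> subs D \<Longrightarrow> T \<in> cells D i \<Longrightarrow> f facet_of T \<Longrightarrow> 1 \<le> sdim D i"
proof -
  assume h: "i \<in> subs D" "T \<in> cells D i" "f facet_of T"
  then have "0 \<le> aff_dim f" "aff_dim f = aff_dim T - 1"
    using aff_dim_negative_iff[of f] by (auto simp: facet_of_def simp flip: not_less)
  then show ?thesis using cell_dim[OF h(1,2)] by linarith
qed

lemma finite_cell_facets: "i \<in> subs D \<Longrightarrow> T \<in> cells D i \<Longrightarrow> finite {f. f facet_of T}"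
  using cell_simplex simplex_imp_polytope finite_polytope_facets by blast

lemma sub_bounded: "i \<in> subs D \<Longrightarrow> bounded (sdom D i)"
proof -
  assume i: "i \<in> subs D"
  have "bounded (\<Union>(cells D i))"
    using cell_finite[OF i] cell_simplex[OF i] compact_simplex compact_imp_bounded by (intro bounded_Union) blast+
  then show ?thesis using cell_union[OF i] bounded_subset closure_subset by metis
qed

lemma cell_convex: "i \<in> subs D \<Longrightarrow> T \<in> cells D i \<Longrightarrow> convex T" using cell_simplex convex_simplex by blast
lemma cell_compact: "i \<in> subs D \<Longrightarrow> T \<in> cells D i \<Longrightarrow> compact T" using cell_simplex compact_simplex by blast

lemma facet_convex: "f facet_of T \<Longrightarrow> convex f" using face_of_imp_convex by (auto simp: facet_of_def)
lemma facet_interior_ne: "f facet_of T \<Longrightarrow> rel_interior f \<noteq> {}"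
  using facet_convex rel_interior_eq_empty by (auto simp: facet_of_def)

lemma iface_facet_hull:
  assumes e: "e \<in> ifaces D" and f: "iface_facet D e T f"
  shows "affine hull f = affine hull (iface_dom D e)"
proof -
  have u: "upper D e \<in> subs D" by (rule upper_sub[OF e])
  have T: "T \<in> cells D (upper D e)" "f facet_of T" "f \<subseteq> closure (iface_dom D e)" using f by (auto simp: iface_facet_def)
  have "aff_dim f = int (sdim D (lower D e))"
    using T(2) cell_dim[OF u T(1)] upper_dim[OF e] by (simp add: facet_of_def)
  also have "\<dots> = aff_dim (closure (iface_dom D e))" using sub_dim[OF lower_sub[OF e]] by (simp add: iface_dom_eq)
  finally have "affine hull f = affine hull (closure (iface_dom D e))" using aff_dim_eq_full_gen[OF T(3)] by blast
  then show ?thesis by simp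
qed

text \<open>The facet lies in the closure of the interface and has the same dimension, so a relatively open part of it contains points of the
interface itself.\<close>

lemma iface_facet_meets:
  assumes e: "e \<in> ifaces D" and f: "iface_facet D e T f" and U: "openin (top_of_set (affine hull f)) U" "U \<noteq> {}" "U \<subseteq> f"
  shows "U \<inter> iface_dom D e \<noteq> {}"
proof -
  obtain W where W: "open W" "U = affine hull f \<inter> W" using U(1) by (auto simp: openin_open)
  obtain x where x: "x \<in> U" using U(2) by blast
  have "x \<in> closure (iface_dom D e)" using x U(3) f by (auto simp: iface_facet_def)
  then obtain y where y: "y \<in> iface_dom D e" "y \<in> W" using W x by (meson Int_iff closure_iff_nhds_not_empty disjoint_iff order_refl)
  then have "y \<in> affine hull f" using iface_facet_hull[OF e f] by (simp add: hull_inc)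
  then show ?thesis using y W by blast
qed

text \<open>Points of the lower subdomain are dense in such a facet, so an inner point of the upper subdomain on the facet would have a
point of both subdomains nearby.\<close>

lemma on_iface_not_inside:
  assumes i: "i \<in> subs D" and on: "on_iface D i T f" shows "rel_interior f \<inter> sdom D i = {}"
proof (rule ccontr)
  assume ne: "rel_interior f \<inter> sdom D i \<noteq> {}"
  obtain e where e: "e \<in> ifaces D" "upper D e = i" "iface_facet D e T f" using on by (auto simp: on_iface_def)
  have T: "T \<in> cells D i" "f facet_of T" using e by (auto simp: iface_facet_def)
  have "affine hull f \<subseteq> affine hull (sdom D i)"
    using cell_hull[OF i T(1)] facet_of_imp_subset[OF T(2)] hull_mono by metis
  moreover obtain W where W: "open W" "sdom D i = affine hull (sdom D i) \<inter> W" using sub_open[OF i] by (auto simp: openin_open)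
  ultimately have "affine hull f \<inter> sdom D i = affine hull f \<inter> W" by blast
  then have "openin (top_of_set (affine hull f)) (affine hull f \<inter> sdom D i)" using W(1) by (simp add: openin_open_Int)
  then have o: "openin (top_of_set (affine hull f)) (rel_interior f \<inter> (affine hull f \<inter> sdom D i))"
    using openin_Int[OF openin_rel_interior[of f]] by blast
  have "rel_interior f \<subseteq> affine hull f" by (meson hull_subset order_trans rel_interior_subset)
  then have eq: "rel_interior f \<inter> (affine hull f \<inter> sdom D i) = rel_interior f \<inter> sdom D i" by blast
  have "(rel_interior f \<inter> sdom D i) \<inter> iface_dom D e \<noteq> {}"
    using iface_facet_meets[OF e(1,3) o[unfolded eq] ne] rel_interior_subset by blast
  then obtain y where "y \<in> sdom D i" "y \<in> sdom D (lower D e)" by (auto simp: iface_dom_eq)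
  then have "i = lower D e" using sub_disjoint[OF i lower_sub[OF e(1)]] by blast
  then show False using upper_dim[OF e(1)] e(2) by simp
qed

lemma iface_dom_open: "e \<in> ifaces D \<Longrightarrow> openin (top_of_set (affine hull (iface_dom D e))) (iface_dom D e)"
  using sub_open lower_sub by (simp add: iface_dom_eq)

lemma iface_facet_interior_open:
  assumes e: "e \<in> ifaces D" and f: "iface_facet D e T f"
  shows "openin (top_of_set (affine hull (iface_dom D e))) (rel_interior f \<inter> iface_dom D e)" "rel_interior f \<inter> iface_dom D e \<noteq> {}"
proof -
  show "openin (top_of_set (affine hull (iface_dom D e))) (rel_interior f \<inter> iface_dom D e)"
    using openin_rel_interior[of f] iface_facet_hull[OF e f] iface_dom_open[OF e] by (simp add: openin_Int)
  show "rel_interior f \<inter> iface_dom D e \<noteq> {}"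
    using iface_facet_meets[OF e f openin_rel_interior] facet_interior_ne f rel_interior_subset by (auto simp: iface_facet_def)
qed

text \<open>Two interfaces sharing a facet have the same lower subdomain, since subdomains are disjoint and each is dense in its closure
near the facet; the side of the facet fixes the normal.\<close>

lemma iface_unique:
  assumes e: "e \<in> ifaces D" "iface_facet D e T f" and e': "e' \<in> ifaces D" "iface_facet D e' T f" and u: "upper D e = upper D e'"
  shows "e = e'"
proof (rule iface_inj[OF e(1) e'(1) _ u])
  show "inormal D e = inormal D e'" using e(2) e'(2) by (auto simp: iface_facet_def)
  have "openin (top_of_set (affine hull f)) (rel_interior f \<inter> iface_dom D e)" "rel_interior f \<inter> iface_dom D e \<noteq> {}"
    using iface_facet_interior_open[OF e] iface_facet_hull[OF e] by simp_all
  then have "(rel_interior f \<inter> iface_dom D e) \<inter> iface_dom D e' \<noteq> {}"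
    using rel_interior_subset by (intro iface_facet_meets[OF e']) auto
  then show "lower D e = lower D e'"
    using sub_disjoint[OF lower_sub[OF e(1)] lower_sub[OF e'(1)]] by (auto simp: iface_dom_eq)
qed

lemma cells_same_side:
  assumes i: "i \<in> subs D" and T: "T \<in> cells D i" "f facet_of T" and T': "T' \<in> cells D i" "f facet_of T'"
    and n: "outer_normal T f = outer_normal T' f"
  shows "T = T'"
  by (rule same_side_cells[OF cell_simplex[OF i T(1)] facet_dim_pos[OF i T] cell_simplex[OF i T'(1)] T(2) T'(2) n cell_face[OF i T(1) T'(1)]])
    (use cell_face[OF i T'(1) T(1)] in \<open>simp add: Int_commute\<close>)

lemma iface_cell_unique:
  assumes "e \<in> ifaces D" "iface_facet D e T f" "iface_facet D e T' f" shows "T = T'"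
  using cells_same_side[OF upper_sub[OF assms(1)], of T f T'] assms(2,3) unfolding iface_facet_def by simp

text \<open>The outer normals of cells at a common facet agree up to sign, and cells with the same normal coincide.\<close>

lemma at_most_two_cells:
  assumes i: "i \<in> subs D" and T: "T \<in> cells D i" "f facet_of T" and T': "T' \<in> cells D i" "f facet_of T'"
    and T'': "T'' \<in> cells D i" "f facet_of T''" and ne: "T \<noteq> T'"
  shows "T'' = T \<or> T'' = T'"
proof -
  have d: "1 \<le> sdim D i" by (rule facet_dim_pos[OF i T])
  have n: "outer_normal S' f = outer_normal S f \<or> outer_normal S' f = - outer_normal S f"
    if "S \<in> cells D i" "f facet_of S" "S' \<in> cells D i" "f facet_of S'" for S S'
    using facet_normals[OF cell_simplex[OF i that(1)] d cell_simplex[OF i that(3)] _ that(2,4)]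
      cell_tangent[OF i that(1)] cell_tangent[OF i that(3)] by simp
  show ?thesis
  proof (rule disjCI)
    assume "T'' \<noteq> T'"
    have "outer_normal T' f \<noteq> outer_normal T f" using cells_same_side[OF i T T'] ne by metis
    then have 1: "outer_normal T' f = - outer_normal T f" using n[OF T T'] by blast
    show "T'' = T"
    proof (rule ccontr)
      assume "T'' \<noteq> T"
      then have "outer_normal T'' f \<noteq> outer_normal T f" using cells_same_side[OF i T T''] by metis
      then have "outer_normal T'' f = outer_normal T' f" using n[OF T T''] 1 by metis
      then show False using cells_same_side[OF i T'' T'] \<open>T'' \<noteq> T'\<close> by blast
    qed
  qed
qed

text \<open>If the relative interiors of two facets of cells \<open>T\<close> and \<open>T'\<close> meet, then the first facet lies in the common face \<open>T \<inter> T'\<close>,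
so both are faces of \<open>T'\<close>, and faces with meeting relative interiors are equal.\<close>

lemma trace_disjoint_interiors:
  assumes e: "e \<in> ifaces D" shows "disjoint_interiors (trace_cells D e)"
proof -
  have u: "upper D e \<in> subs D" by (rule upper_sub[OF e])
  have "trace_cells D e \<subseteq> (\<Union>T\<in>cells D (upper D e). {f. f face_of T})"
    by (auto simp: trace_cells_def iface_facet_def facet_of_def)
  moreover have "finite {f. f face_of T}" if "T \<in> cells D (upper D e)" for T
    using cell_simplex[OF u that] simplex_imp_polytope finite_polytope_faces by blast
  ultimately have fin: "finite (trace_cells D e)" using cell_finite[OF u] by (meson finite_UN_I finite_subset)
  have "f = f'" if h: "f \<in> trace_cells D e" "f' \<in> trace_cells D e" "rel_interior f \<inter> rel_interior f' \<noteq> {}" for f f'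
  proof -
    obtain T where T: "T \<in> cells D (upper D e)" "f facet_of T" using h(1) by (auto simp: trace_cells_def iface_facet_def)
    obtain T' where T': "T' \<in> cells D (upper D e)" "f' facet_of T'" using h(2) by (auto simp: trace_cells_def iface_facet_def)
    have f: "f face_of T" "f' face_of T'" using T T' by (auto simp: facet_of_def)
    have I: "(T \<inter> T') face_of T" "(T \<inter> T') face_of T'"
      using cell_face[OF u T(1) T'(1)] cell_face[OF u T'(1) T(1)] by (simp_all add: Int_commute)
    have "f \<subseteq> T \<inter> T'"
      using subset_of_face_of[OF I(1) face_of_imp_subset[OF f(1)]] h(3) rel_interior_subset f face_of_imp_subset by blast
    then have "f face_of (T \<inter> T')" using f(1) face_of_subset inf_le1 by blast
    then have "f face_of T'" using I(2) face_of_trans by blast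
    then show ?thesis using face_of_eq[OF _ f(2) h(3)] by blast
  qed
  then show ?thesis using fin facet_convex unfolding disjoint_interiors_def trace_cells_def iface_facet_def by blast
qed

end

section \<open>Fluxes in terms of facet normal components\<close>

text \<open>Function types carry no scalar multiplication by default, so the vector space structure of fluxes and of pairs is given
by explicit scalings.\<close>

definition vscale :: "real \<Rightarrow> 'a::euclidean_space flux \<Rightarrow> 'a flux" where "vscale c v = (\<lambda>i T. fscale c (v i T))"
definition pscale :: "real \<Rightarrow> 'a::euclidean_space flux \<times> 'a pwconst \<Rightarrow> 'a flux \<times> 'a pwconst" where
  "pscale c w = (vscale c (fst w), \<lambda>e S. c * snd w e S)"

lemma vector_space_pscale: "vector_space pscale"
  by standard (auto simp: pscale_def vscale_def fscale_def fun_eq_iff algebra_simps)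

interpretation pscale: vector_space pscale by (rule vector_space_pscale)

lemma finite_support_span:
  fixes L :: "('p \<Rightarrow> real) \<Rightarrow> 'a::euclidean_space flux \<times> 'a pwconst"
  assumes add: "\<And>c c'. L (\<lambda>p. c p + c' p) = L c + L c'" and sc: "\<And>k c. L (\<lambda>p. k * c p) = pscale k (L c)"
    and P: "finite P" and c: "\<And>p. p \<notin> P \<Longrightarrow> c p = 0"
  shows "L c \<in> pscale.span ((\<lambda>p. L (\<lambda>q. if q = p then 1 else 0)) ` P)"
  using P c
proof (induction P arbitrary: c rule: finite_induct)
  case empty
  then have "c = (\<lambda>p. 0 * c p)" by auto
  then have "L c = pscale 0 (L c)" using sc[of 0 c] by simp
  then show ?case by (simp only: pscale.scale_zero_left pscale.span_zero)
next
  case (insert a P)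
  let ?e = "\<lambda>p q. if q = p then 1 else (0::real)"
  have e: "c = (\<lambda>p. (c(a := 0)) p + c a * ?e a p)" by auto
  have "L (c(a := 0)) \<in> pscale.span ((\<lambda>p. L (?e p)) ` P)" using insert by (intro insert.IH) auto
  then have "L (c(a := 0)) \<in> pscale.span ((\<lambda>p. L (?e p)) ` insert a P)"
    by (rule pscale.span_mono[THEN subsetD, rotated]) auto
  moreover have "pscale (c a) (L (?e a)) \<in> pscale.span ((\<lambda>p. L (?e p)) ` insert a P)"
    by (intro pscale.span_scale pscale.span_base) auto
  ultimately have "L (c(a := 0)) + pscale (c a) (L (?e a)) \<in> pscale.span ((\<lambda>p. L (?e p)) ` insert a P)"
    by (rule pscale.span_add)
  also have "L (c(a := 0)) + pscale (c a) (L (?e a)) = L c" by (subst (3) e) (simp only: add sc)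
  finally show ?case .
qed

text \<open>The inverse of the map that takes a flux to its normal components on the facets of all cells.\<close>

definition flux_of :: "'a::euclidean_space discretization \<Rightarrow> (nat \<Rightarrow> 'a set \<Rightarrow> 'a set \<Rightarrow> real) \<Rightarrow> 'a flux" where
  "flux_of D c = (\<lambda>i T. if i \<in> subs D \<and> 1 \<le> sdim D i \<and> T \<in> cells D i
     then \<Sum>f\<in>{f. f facet_of T}. fscale (c i T f) (facet_basis T f) else 0)"

lemma flux_of_add: "flux_of D (\<lambda>i T f. c i T f + c' i T f) = flux_of D c + flux_of D c'"
  by (auto simp: flux_of_def fun_eq_iff fscale.scale_left_distrib sum.distrib)

lemma flux_of_scale: "flux_of D (\<lambda>i T f. k * c i T f) = vscale k (flux_of D c)"
proof (intro ext)
  fix i T x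
  show "flux_of D (\<lambda>i T f. k * c i T f) i T x = vscale k (flux_of D c) i T x"
  proof (cases "i \<in> subs D \<and> 1 \<le> sdim D i \<and> T \<in> cells D i")
    case True
    have "(\<Sum>f\<in>{f. f facet_of T}. fscale (k * c i T f) (facet_basis T f)) = fscale k (\<Sum>f\<in>{f. f facet_of T}. fscale (c i T f) (facet_basis T f))"
      by (simp add: fscale.scale_sum_right)
    then show ?thesis using True by (simp add: flux_of_def vscale_def)
  next
    case False then show ?thesis by (auto simp: flux_of_def vscale_def fscale_def)
  qed
qed

context fractured_disc
begin

lemma flux_of_cell:
  assumes i: "i \<in> subs D" "T \<in> cells D i" "1 \<le> sdim D i"
  shows "flux_of D c i T \<in> RT0 T" "f facet_of T \<Longrightarrow> normal_comp (flux_of D c i T) T f = c i T f"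
proof -
  obtain C where "flat_cell C T" using cell_flat_cell[OF i] by blast
  then interpret flat_cell C T .
  have e: "flux_of D c i T = (\<Sum>f\<in>{f. f facet_of T}. fscale (c i T f) (facet_basis T f))" using i by (simp add: flux_of_def)
  show "flux_of D c i T \<in> RT0 T" unfolding e by (rule RT0_combination)
  show "f facet_of T \<Longrightarrow> normal_comp (flux_of D c i T) T f = c i T f" unfolding e by (rule normal_comp_combination)
qed

lemma normal_comp_flux_of:
  assumes "i \<in> subs D" "T \<in> cells D i" "f facet_of T"
  shows "normal_comp (flux_of D c i T) T f = c i T f"
  using flux_of_cell(2) facet_dim_pos assms by blast

text \<open>Membership in the flux space becomes a condition on the coefficients: balance across inner facets and zero on the
Neumann boundary.\<close>

lemma flux_of_Vh:
  assumes 1: "\<And>i T T' f. \<lbrakk>i \<in> subs D; T \<in> cells D i; T' \<in> cells D i; T \<noteq> T'; f facet_of T; f facet_of T'; rel_interior f \<subseteq> sdom D i\<rbrakk>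
       \<Longrightarrow> c i T f + c i T' f = 0"
    and 2: "\<And>i T f. \<lbrakk>i \<in> subs D; T \<in> cells D i; f facet_of T; \<not> on_iface D i T f; rel_interior f \<subseteq> bdryN D\<rbrakk> \<Longrightarrow> c i T f = 0"
  shows "flux_of D c \<in> Vh D"
  unfolding Vh_def
proof (intro CollectI conjI allI ballI impI; (elim conjE)?)
  show "if i \<in> subs D \<and> 1 \<le> sdim D i \<and> T \<in> cells D i then flux_of D c i T \<in> RT0 T else flux_of D c i T = 0" for i T
    using flux_of_cell(1) by (auto simp: flux_of_def)
next
  fix i T T' f assume "i \<in> subs D" "T \<in> cells D i" "T' \<in> cells D i" "T \<noteq> T'" "f facet_of T" "f facet_of T'" "rel_interior f \<subseteq> sdom D i"
  then show "normal_comp (flux_of D c i T) T f + normal_comp (flux_of D c i T') T' f = 0"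
    using 1 by (simp add: normal_comp_flux_of)
next
  fix i T f assume "i \<in> subs D" "T \<in> cells D i" "f facet_of T" "\<not> on_iface D i T f" "rel_interior f \<subseteq> bdryN D"
  then show "normal_comp (flux_of D c i T) T f = 0" using 2 by (simp add: normal_comp_flux_of)
qed

lemma Vh_RT0: "v \<in> Vh D \<Longrightarrow> i \<in> subs D \<Longrightarrow> T \<in> cells D i \<Longrightarrow> 1 \<le> sdim D i \<Longrightarrow> v i T \<in> RT0 T"
  and Vh_0: "v \<in> Vh D \<Longrightarrow> \<not> (i \<in> subs D \<and> 1 \<le> sdim D i \<and> T \<in> cells D i) \<Longrightarrow> v i T = 0"
  unfolding Vh_def by (auto split: if_splits)

lemma Vh_inner: "v \<in> Vh D \<Longrightarrow> i \<in> subs D \<Longrightarrow> T \<in> cells D i \<Longrightarrow> T' \<in> cells D i \<Longrightarrow> T \<noteq> T' \<Longrightarrow> f facet_of T \<Longrightarrow> f facet_of T' \<Longrightarrow>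
     rel_interior f \<subseteq> sdom D i \<Longrightarrow> normal_comp (v i T) T f + normal_comp (v i T') T' f = 0"
  and Vh_neumann: "v \<in> Vh D \<Longrightarrow> i \<in> subs D \<Longrightarrow> T \<in> cells D i \<Longrightarrow> f facet_of T \<Longrightarrow> \<not> on_iface D i T f \<Longrightarrow>
     rel_interior f \<subseteq> bdryN D \<Longrightarrow> normal_comp (v i T) T f = 0"
  unfolding Vh_def mem_Collect_eq by (elim conjE, simp)+

lemma Vh_ext:
  assumes u: "u \<in> Vh D" and v: "v \<in> Vh D"
    and eq: "\<And>i T f. i \<in> subs D \<Longrightarrow> T \<in> cells D i \<Longrightarrow> f facet_of T \<Longrightarrow> normal_comp (u i T) T f = normal_comp (v i T) T f"
  shows "u = v"
proof (intro ext)
  fix i T x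
  have "u i T = v i T"
  proof (cases "i \<in> subs D \<and> 1 \<le> sdim D i \<and> T \<in> cells D i")
    case True
    then obtain C where "flat_cell C T" using cell_flat_cell by blast
    then interpret flat_cell C T .
    show ?thesis using True u v by (intro RT0_ext Vh_RT0 eq) auto
  next
    case False
    show ?thesis by (rule trans[OF Vh_0[OF u False] Vh_0[OF v False, symmetric]])
  qed
  then show "u i T x = v i T x" by simp
qed

lemma Vh_normal_add:
  assumes "u \<in> Vh D" "v \<in> Vh D" "i \<in> subs D" "T \<in> cells D i" "f facet_of T"
  shows "normal_comp ((u + v) i T) T f = normal_comp (u i T) T f + normal_comp (v i T) T f"
proof -
  have d: "1 \<le> sdim D i" using facet_dim_pos assms by blast
  obtain C where "flat_cell C T" using cell_flat_cell[OF assms(3,4) d] by blast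
  then interpret flat_cell C T .
  have "(u + v) i T = u i T + v i T" by (simp only: plus_fun_apply)
  then show ?thesis using normal_comp_add[OF Vh_RT0[OF assms(1,3,4) d] Vh_RT0[OF assms(2,3,4) d] assms(5)] by simp
qed

lemma Vh_normal_scale:
  assumes "u \<in> Vh D" "i \<in> subs D" "T \<in> cells D i" "f facet_of T"
  shows "normal_comp (vscale k u i T) T f = k * normal_comp (u i T) T f"
proof -
  have d: "1 \<le> sdim D i" using facet_dim_pos assms by blast
  obtain C where "flat_cell C T" using cell_flat_cell[OF assms(2,3) d] by blast
  then interpret flat_cell C T .
  show ?thesis unfolding vscale_def by (rule normal_comp_fscale[OF Vh_RT0[OF assms(1-3) d] assms(4)])
qed

lemma Vh_flux_of: "v \<in> Vh D \<Longrightarrow> v = flux_of D (\<lambda>i T f. normal_comp (v i T) T f)"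
  by (rule Vh_ext) (auto simp: normal_comp_flux_of intro!: flux_of_Vh Vh_inner Vh_neumann)

lemma Vh_add: assumes "u \<in> Vh D" "v \<in> Vh D" shows "u + v \<in> Vh D"
proof -
  let ?c = "\<lambda>w i T f. normal_comp (w i T) T f"
  have "u + v = flux_of D (\<lambda>i T f. ?c u i T f + ?c v i T f)"
    unfolding flux_of_add using Vh_flux_of[OF assms(1)] Vh_flux_of[OF assms(2)] by simp
  moreover have "flux_of D (\<lambda>i T f. ?c u i T f + ?c v i T f) \<in> Vh D"
  proof (rule flux_of_Vh)
    fix i T T' f assume "i \<in> subs D" "T \<in> cells D i" "T' \<in> cells D i" "T \<noteq> T'" "f facet_of T" "f facet_of T'" "rel_interior f \<subseteq> sdom D i"
    then show "?c u i T f + ?c v i T f + (?c u i T' f + ?c v i T' f) = 0"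
      using Vh_inner[OF assms(1), of i T T' f] Vh_inner[OF assms(2), of i T T' f] by linarith
  qed (use Vh_neumann[OF assms(1)] Vh_neumann[OF assms(2)] in simp)
  ultimately show ?thesis by (simp only:)
qed

lemma Vh_scale: assumes "u \<in> Vh D" shows "vscale k u \<in> Vh D"
proof -
  let ?c = "\<lambda>w i T f. normal_comp (w i T) T f"
  have "vscale k u = flux_of D (\<lambda>i T f. k * ?c u i T f)"
    unfolding flux_of_scale using Vh_flux_of[OF assms(1)] by simp
  moreover have "flux_of D (\<lambda>i T f. k * ?c u i T f) \<in> Vh D"
  proof (rule flux_of_Vh)
    fix i T T' f assume "i \<in> subs D" "T \<in> cells D i" "T' \<in> cells D i" "T \<noteq> T'" "f facet_of T" "f facet_of T'" "rel_interior f \<subseteq> sdom D i"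
    then show "k * ?c u i T f + k * ?c u i T' f = 0"
      using Vh_inner[OF assms(1), of i T T' f] by (simp flip: distrib_left)
  qed (use Vh_neumann[OF assms(1)] in simp)
  ultimately show ?thesis by (simp only:)
qed

lemma Vh_zero: "0 \<in> Vh D"
proof -
  have "flux_of D (\<lambda>i T f. 0) \<in> Vh D" by (rule flux_of_Vh) auto
  moreover have "flux_of D (\<lambda>i T f. 0) = 0"
    by (rule ext)+ (simp only: flux_of_def fscale.scale_zero_left sum.neutral_const if_cancel zero_fun_apply)
  ultimately show ?thesis by simp
qed

lemma on_iface_facet: "on_iface D i T f \<Longrightarrow> T \<in> cells D i \<and> f facet_of T"
  by (auto simp: on_iface_def iface_facet_def)

lemma V0h_subspace:
  "0 \<in> V0h D" "u \<in> V0h D \<Longrightarrow> v \<in> V0h D \<Longrightarrow> u + v \<in> V0h D" "u \<in> V0h D \<Longrightarrow> vscale k u \<in> V0h D"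
proof -
  show "u \<in> V0h D \<Longrightarrow> v \<in> V0h D \<Longrightarrow> u + v \<in> V0h D"
    unfolding V0h_def using Vh_add Vh_normal_add on_iface_facet by auto
  show s: "u \<in> V0h D \<Longrightarrow> vscale k u \<in> V0h D" for u k
    unfolding V0h_def using Vh_scale Vh_normal_scale on_iface_facet by auto
  have z: "vscale 0 0 = (0 :: 'a flux)" by (auto simp: vscale_def fscale_def fun_eq_iff)
  show "0 \<in> V0h D"
    unfolding V0h_def using Vh_zero Vh_normal_scale[OF Vh_zero, of _ _ _ 0] on_iface_facet unfolding z by auto
qed

lemma V0h_Vh: "v \<in> V0h D \<Longrightarrow> v \<in> Vh D" by (simp add: V0h_def)

lemma Wh_subspace: "pscale.subspace (Wh D)"
  unfolding pscale.subspace_def Wh_def using V0h_subspace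
  by (auto simp: Lh_def pscale_def zero_prod_def)

lemma Wh_iff: "w \<in> Wh D \<longleftrightarrow> fst w \<in> V0h D \<and> snd w \<in> Lh D" by (cases w) (auto simp: Wh_def)

text \<open>Finite dimension is needed to represent functionals by the form \<open>a\<^sup>D\<close>.  Coefficients with finite support are
combinations of unit vectors, both for the facet normal components and for the mortar values.\<close>

lemma Wh_finite: obtains S where "finite S" "Wh D \<subseteq> pscale.span S"
proof -
  let ?L1 = "\<lambda>c :: nat \<times> 'a set \<times> 'a set \<Rightarrow> real. (flux_of D (\<lambda>i T f. c (i, T, f)), 0 :: 'a pwconst)"
  let ?L2 = "\<lambda>c :: nat \<times> 'a set \<Rightarrow> real. (0 :: 'a flux, \<lambda>e S. c (e, S))"
  let ?P1 = "Sigma (subs D) (\<lambda>i. Sigma (cells D i) (\<lambda>T. {f. f facet_of T}))"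
  let ?P2 = "Sigma (ifaces D) (mcells D)"
  have fin: "finite ?P1" "finite ?P2"
    using finite_subs finite_ifaces cell_finite mcell_facts(1) finite_cell_facets by (auto intro!: finite_SigmaI)
  let ?S = "(\<lambda>p. ?L1 (\<lambda>q. if q = p then 1 else 0)) ` ?P1 \<union> (\<lambda>p. ?L2 (\<lambda>q. if q = p then 1 else 0)) ` ?P2"
  show ?thesis
  proof (rule that)
    show "finite ?S" using fin by simp
    show "Wh D \<subseteq> pscale.span ?S"
    proof
      fix w assume w: "w \<in> Wh D"
      obtain u \<theta> where [simp]: "w = (u, \<theta>)" by (cases w)
      have u: "u \<in> Vh D" and \<theta>: "\<theta> \<in> Lh D" using w by (auto simp: Wh_iff V0h_Vh)
      let ?c1 = "\<lambda>(i, T, f). if (i, T, f) \<in> ?P1 then normal_comp (u i T) T f else 0"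
      have "flux_of D (\<lambda>i T f. normal_comp (u i T) T f) = flux_of D (\<lambda>i T f. ?c1 (i, T, f))"
        unfolding flux_of_def by (intro ext) (auto intro!: sum.cong)
      then have 1: "(u, 0) = ?L1 ?c1" using Vh_flux_of[OF u] by simp
      have "?L1 ?c1 \<in> pscale.span ((\<lambda>p. ?L1 (\<lambda>q. if q = p then 1 else 0)) ` ?P1)"
      proof (rule finite_support_span[OF _ _ fin(1)])
        show "?L1 (\<lambda>p. c p + c' p) = ?L1 c + ?L1 c'" for c c' by (simp only: flux_of_add add_Pair add_0_left)
        show "?L1 (\<lambda>p. k * c p) = pscale k (?L1 c)" for k c by (simp add: pscale_def flux_of_scale fun_eq_iff)
      qed (auto split: prod.splits)
      then have m1: "(u, 0) \<in> pscale.span ?S" unfolding 1 by (rule pscale.span_mono[THEN subsetD, rotated]) blast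
      let ?c2 = "\<lambda>(e, S). \<theta> e S"
      have 2: "(0, \<theta>) = ?L2 ?c2" by simp
      have "?L2 ?c2 \<in> pscale.span ((\<lambda>p. ?L2 (\<lambda>q. if q = p then 1 else 0)) ` ?P2)"
        by (rule finite_support_span[OF _ _ fin(2)]) (use \<theta> in \<open>auto simp: pscale_def vscale_def fscale_def fun_eq_iff Lh_def\<close>)
      then have m2: "(0, \<theta>) \<in> pscale.span ?S" unfolding 2 by (rule pscale.span_mono[THEN subsetD, rotated]) blast
      have "(u, 0) + (0, \<theta>) \<in> pscale.span ?S" by (rule pscale.span_add[OF m1 m2])
      then show "w \<in> pscale.span ?S" by simp
    qed
  qed
qed

section \<open>Normal traces and the discrete extension\<close>

text \<open>The cell is an argument because the two sides of an immersed fracture are different interfaces with the same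
upper subdomain.\<close>

definition iface_of :: "nat \<Rightarrow> 'a set \<Rightarrow> 'a set \<Rightarrow> nat" where
  "iface_of i T f = (THE e. e \<in> ifaces D \<and> upper D e = i \<and> iface_facet D e T f)"

lemma iface_of_eq: "e \<in> ifaces D \<Longrightarrow> iface_facet D e T f \<Longrightarrow> iface_of (upper D e) T f = e"
  unfolding iface_of_def by (rule the_equality) (auto intro: iface_unique)

definition extend :: "'a pwconst \<Rightarrow> 'a flux" where
  "extend g = flux_of D (\<lambda>i T f. if on_iface D i T f then g (iface_of i T f) f else 0)"

lemma extend_Vh: "extend g \<in> Vh D"
  unfolding extend_def
proof (rule flux_of_Vh)
  fix i T T' f assume h: "i \<in> subs D" "T \<in> cells D i" "T' \<in> cells D i" "T \<noteq> T'" "f facet_of T" "f facet_of T'" "rel_interior f \<subseteq> sdom D i"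
  have "\<not> on_iface D i S f" for S using on_iface_not_inside[OF h(1)] h(7) facet_interior_ne[OF h(5)] by blast
  then show "(if on_iface D i T f then g (iface_of i T f) f else 0) + (if on_iface D i T' f then g (iface_of i T' f) f else 0) = 0" by simp
qed simp

lemma normal_extend:
  assumes "i \<in> subs D" "T \<in> cells D i" "f facet_of T"
  shows "normal_comp (extend g i T) T f = (if on_iface D i T f then g (iface_of i T f) f else 0)"
  unfolding extend_def by (rule normal_comp_flux_of[OF assms])

lemma normal_extend_iface:
  assumes "e \<in> ifaces D" "iface_facet D e T f"
  shows "normal_comp (extend g (upper D e) T) T f = g e f"
proof -
  have "on_iface D (upper D e) T f" using assms by (auto simp: on_iface_def)
  then show ?thesis using normal_extend[OF upper_sub[OF assms(1)], of T f g] assms iface_of_eq on_iface_facet by simp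
qed

lemma normal_trace_eq:
  assumes "e \<in> ifaces D" "iface_facet D e T f"
  shows "normal_trace D v e f = normal_comp (v (upper D e) T) T f"
proof -
  have "(THE T. iface_facet D e T f) = T"
    by (rule the_equality) (rule assms(2), rule iface_cell_unique[OF assms(1) _ assms(2)])
  moreover have "f \<in> trace_cells D e" using assms(2) unfolding trace_cells_def by blast
  ultimately show ?thesis using assms(1) by (simp add: normal_trace_def)
qed

definition trace_space :: "'a pwconst set" where
  "trace_space = {g. \<forall>e f. \<not> (e \<in> ifaces D \<and> f \<in> trace_cells D e) \<longrightarrow> g e f = 0}"

lemma normal_trace_extend:
  assumes "g \<in> trace_space" shows "normal_trace D (extend g) = g"
proof (intro ext)
  fix e f
  show "normal_trace D (extend g) e f = g e f"
  proof (cases "e \<in> ifaces D \<and> f \<in> trace_cells D e")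
    case True
    then obtain T where "iface_facet D e T f" by (auto simp: trace_cells_def)
    then show ?thesis using True normal_trace_eq normal_extend_iface by simp
  next
    case False
    then show ?thesis using assms by (auto simp: normal_trace_def trace_space_def)
  qed
qed

text \<open>No constraint of the flux space touches a facet on an interface, so every piecewise constant is a normal trace.\<close>

lemma normal_trace_image: "normal_trace D ` Vh D = trace_space"
proof
  show "normal_trace D ` Vh D \<subseteq> trace_space" by (auto simp: normal_trace_def trace_space_def)
  show "trace_space \<subseteq> normal_trace D ` Vh D"
    using normal_trace_extend extend_Vh by (metis image_eqI subsetI)
qed

definition cell_overlap :: "nat \<Rightarrow> 'a set \<Rightarrow> 'a set \<Rightarrow> real" where
  "cell_overlap e S f = measure (flat_measure (iface_dom D e)) (rel_interior S \<inter> rel_interior f \<inter> iface_dom D e)"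
definition facet_area :: "nat \<Rightarrow> 'a set \<Rightarrow> real" where
  "facet_area e f = measure (flat_measure (iface_dom D e)) (rel_interior f \<inter> iface_dom D e)"
text \<open>The values of the orthogonal projection onto the piecewise constants on the facets of the interface, see \<open>Pi_h_eq\<close>.\<close>

definition trace_average :: "'a pwconst \<Rightarrow> 'a pwconst" where
  "trace_average \<mu> e f = (if e \<in> ifaces D \<and> f \<in> trace_cells D e then (\<Sum>S\<in>mcells D e. \<mu> e S * cell_overlap e S f) / facet_area e f else 0)"

lemma iface_dom_facts:
  assumes "e \<in> ifaces D"
  shows "iface_dom D e \<noteq> {}" "aff_dim (iface_dom D e) \<le> 3" "bounded (iface_dom D e)" "iface_dom D e \<in> sets borel"
  using sub_ne sub_dim3 sub_bounded sub_borel lower_sub[OF assms] by (auto simp: iface_dom_eq)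

lemma open_measure_pos:
  assumes "S \<noteq> {}" "aff_dim S \<le> 3" "openin (top_of_set (affine hull S)) U" "U \<noteq> {}" "bounded U"
  shows "0 < measure (flat_measure S) U"
proof -
  have "U \<in> sets borel"
    using assms(3) unfolding openin_open by (metis affine_affine_hull affine_closed borel_closed borel_open sets.Int)
  then show ?thesis
    using flat_open_positive[OF assms(1-4)] flat_bounded_finite[OF assms(1,2,5)] by (simp add: measure_def enn2real_positive_iff)
qed

lemma facet_area_pos: "e \<in> ifaces D \<Longrightarrow> f \<in> trace_cells D e \<Longrightarrow> 0 < facet_area e f"
  unfolding facet_area_def using iface_facet_interior_open iface_dom_facts
  by (intro open_measure_pos) (auto simp: trace_cells_def intro: bounded_subset)

lemma trace_integral:
  assumes e: "e \<in> ifaces D"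
  shows "(LINT x:iface_dom D e|flat_measure (iface_dom D e).
      (P0_fun (trace_cells D e) g x - P0_fun (mcells D e) \<mu> x) * P0_fun (trace_cells D e) k x)
    = (\<Sum>f\<in>trace_cells D e. k f * (g f * facet_area e f - (\<Sum>S\<in>mcells D e. \<mu> S * cell_overlap e S f)))"
proof -
  let ?I = "iface_dom D e" and ?tr = "trace_cells D e" and ?mc = "mcells D e"
  let ?M = "flat_measure ?I"
  note tr = trace_disjoint_interiors[OF e] note mc = mcell_facts(2)[OF e]
  note fi = finite_sum_indicator_integral[OF iface_dom_facts[OF e]]
  have fin: "finite ?tr" "finite ?mc" using tr mc by (auto simp: disjoint_interiors_def)
  have bor: "rel_interior f \<in> sets borel" if "f \<in> ?tr \<union> ?mc" for f
    using that tr mc by (auto simp: disjoint_interiors_def intro!: rel_interior_borel)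
  have 1: "P0_fun ?tr g x * P0_fun ?tr k x = (\<Sum>f\<in>?tr. (g f * k f) * indicator (rel_interior f) x)" for x
    by (rule P0_fun_mult[OF tr])
  have 2: "P0_fun ?mc \<mu> x * P0_fun ?tr k x =
      (\<Sum>p\<in>?mc \<times> ?tr. (\<mu> (fst p) * k (snd p)) * indicator (rel_interior (fst p) \<inter> rel_interior (snd p)) x)" for x
    unfolding P0_fun_def sum_product sum.cartesian_product
    by (intro sum.cong) (auto simp: indicator_def)
  have "(LINT x:?I|?M. (P0_fun ?tr g x - P0_fun ?mc \<mu> x) * P0_fun ?tr k x) =
     (LINT x:?I|?M. (\<Sum>f\<in>?tr. (g f * k f) * indicator (rel_interior f) x)
        - (\<Sum>p\<in>?mc \<times> ?tr. (\<mu> (fst p) * k (snd p)) * indicator (rel_interior (fst p) \<inter> rel_interior (snd p)) x))"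
    unfolding left_diff_distrib 1 2 ..
  also have "\<dots> = (\<Sum>f\<in>?tr. (g f * k f) * facet_area e f) - (\<Sum>p\<in>?mc \<times> ?tr. (\<mu> (fst p) * k (snd p)) * cell_overlap e (fst p) (snd p))"
  proof -
    have b2: "finite (?mc \<times> ?tr)" "\<And>p. p \<in> ?mc \<times> ?tr \<Longrightarrow> rel_interior (fst p) \<inter> rel_interior (snd p) \<in> sets borel"
      using fin bor by auto
    have b1: "\<And>f. f \<in> ?tr \<Longrightarrow> rel_interior f \<in> sets borel" using bor by auto
    show ?thesis
      by (subst set_integral_diff(2)[OF fi(2)[OF fin(1) b1] fi(2)[OF b2]])
        (simp_all only: fi(1)[OF fin(1) b1] fi(1)[OF b2] facet_area_def cell_overlap_def)
  qed
  also have "(\<Sum>p\<in>?mc \<times> ?tr. (\<mu> (fst p) * k (snd p)) * cell_overlap e (fst p) (snd p)) = (\<Sum>f\<in>?tr. \<Sum>S\<in>?mc. (\<mu> S * k f) * cell_overlap e S f)"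
    by (subst sum.swap) (simp add: sum.cartesian_product split_def)
  finally show ?thesis
    by (simp add: sum_subtractf right_diff_distrib sum_distrib_left mult_ac)
qed

text \<open>The traces of fluxes are all piecewise constants on the traces of the meshes.  These have disjoint cells, so the
projection decouples into averages over single facets; testing with the indicator of one facet identifies each value.\<close>

lemma Pi_h_eq: "Pi_h D \<mu> = trace_average \<mu>"
  unfolding Pi_h_def
proof (rule the_equality)
  let ?eq = "\<lambda>g v. (\<Sum>e\<in>ifaces D. LINT x:iface_dom D e|flat_measure (iface_dom D e).
           (P0_fun (trace_cells D e) (g e) x - P0_fun (mcells D e) (\<mu> e) x) *
           P0_fun (trace_cells D e) (normal_trace D v e) x)"
  have eq: "?eq g v = (\<Sum>e\<in>ifaces D. \<Sum>f\<in>trace_cells D e. normal_trace D v e f * (g e f * facet_area e f - (\<Sum>S\<in>mcells D e. \<mu> e S * cell_overlap e S f)))" for g v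
    by (intro sum.cong refl trace_integral)
  have "trace_average \<mu> \<in> trace_space" by (auto simp: trace_space_def trace_average_def)
  moreover have "?eq (trace_average \<mu>) v = 0" for v
    unfolding eq using facet_area_pos by (intro sum.neutral ballI) (force simp: trace_average_def)
  ultimately show "trace_average \<mu> \<in> normal_trace D ` Vh D \<and> (\<forall>v\<in>Vh D. ?eq (trace_average \<mu>) v = 0)"
    unfolding normal_trace_image by blast
  fix g assume g: "g \<in> normal_trace D ` Vh D \<and> (\<forall>v\<in>Vh D. ?eq g v = 0)"
  show "g = trace_average \<mu>"
  proof (intro ext)
    fix e f
    show "g e f = trace_average \<mu> e f"
    proof (cases "e \<in> ifaces D \<and> f \<in> trace_cells D e")
      case True
      define k where "k = (\<lambda>e' f'. if e' = e \<and> f' = f then 1 else (0::real))"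
      have "k \<in> trace_space" using True by (auto simp: k_def trace_space_def)
      then obtain v where v: "v \<in> Vh D" "normal_trace D v = k" using normal_trace_image by (metis imageE)
      have fin: "finite (trace_cells D e)" using trace_disjoint_interiors True by (simp add: disjoint_interiors_def)
      have "0 = (\<Sum>e'\<in>ifaces D. \<Sum>f'\<in>trace_cells D e'. k e' f' * (g e' f' * facet_area e' f' - (\<Sum>S\<in>mcells D e'. \<mu> e' S * cell_overlap e' S f')))"
      proof -
        have "?eq g v = 0" using g v(1) by blast
        then show ?thesis using eq[of g v] unfolding v(2) by (metis (no_types))
      qed
      also have "\<dots> = (\<Sum>e'\<in>ifaces D. if e' = e then \<Sum>f'\<in>trace_cells D e. if f' = f then g e f * facet_area e f - (\<Sum>S\<in>mcells D e. \<mu> e S * cell_overlap e S f) else 0 else 0)"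
        by (intro sum.cong refl) (auto simp: k_def intro!: sum.cong)
      also have "\<dots> = g e f * facet_area e f - (\<Sum>S\<in>mcells D e. \<mu> e S * cell_overlap e S f)"
        using True finite_ifaces fin by simp
      finally show ?thesis using True facet_area_pos[of e f] by (simp add: trace_average_def field_simps)
    next
      case False
      then show ?thesis using g normal_trace_image by (auto simp: trace_average_def trace_space_def)
    qed
  qed
qed

text \<open>The prescribed normal components on all facets are compatible with the constraints of the flux space, because facets on an
interface are exempt from both; unisolvence gives uniqueness.\<close>

lemma R_h_eq: "R_h D \<mu> = extend (trace_average \<mu>)"
  unfolding R_h_def Pi_h_eq
proof (rule the_equality)
  have p: "trace_average \<mu> \<in> trace_space" by (auto simp: trace_space_def trace_average_def)
  show "extend (trace_average \<mu>) \<in> Vh D \<and> normal_trace D (extend (trace_average \<mu>)) = trace_average \<mu> \<and>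
    (\<forall>i\<in>subs D. \<forall>T\<in>cells D i. \<forall>f. f facet_of T \<and> \<not> on_iface D i T f \<longrightarrow> normal_comp (extend (trace_average \<mu>) i T) T f = 0)"
    using extend_Vh normal_trace_extend[OF p] normal_extend by simp
  fix v assume v: "v \<in> Vh D \<and> normal_trace D v = trace_average \<mu> \<and>
    (\<forall>i\<in>subs D. \<forall>T\<in>cells D i. \<forall>f. f facet_of T \<and> \<not> on_iface D i T f \<longrightarrow> normal_comp (v i T) T f = 0)"
  show "v = extend (trace_average \<mu>)"
  proof (rule Vh_ext[OF _ extend_Vh])
    fix i T f assume h: "i \<in> subs D" "T \<in> cells D i" "f facet_of T"
    show "normal_comp (v i T) T f = normal_comp (extend (trace_average \<mu>) i T) T f"
    proof (cases "on_iface D i T f")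
      case True
      then obtain e where e: "e \<in> ifaces D" "upper D e = i" "iface_facet D e T f" by (auto simp: on_iface_def)
      then show ?thesis using normal_trace_eq[OF e(1,3), of v] normal_extend_iface[OF e(1,3), of "trace_average \<mu>"] v by simp
    next
      case False
      then show ?thesis using v h normal_extend[OF h] by simp
    qed
  qed (use v in blast)
qed

lemma R_h_Vh: "R_h D \<mu> \<in> Vh D" unfolding R_h_eq by (rule extend_Vh)

lemma R_h_add: "R_h D (\<mu> + \<mu>') = R_h D \<mu> + R_h D \<mu>'"
proof -
  have "trace_average (\<mu> + \<mu>') e f = trace_average \<mu> e f + trace_average \<mu>' e f" for e f
    by (simp add: trace_average_def algebra_simps sum.distrib add_divide_distrib)
  then show ?thesis unfolding R_h_eq extend_def flux_of_add[symmetric] by (intro arg_cong[where f="flux_of D"] ext) simp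
qed

lemma R_h_scale: "R_h D (\<lambda>e S. k * \<mu> e S) = vscale k (R_h D \<mu>)"
proof -
  have "trace_average (\<lambda>e S. k * \<mu> e S) e f = k * trace_average \<mu> e f" for e f
    by (simp add: trace_average_def mult.assoc flip: sum_distrib_left)
  then show ?thesis unfolding R_h_eq extend_def flux_of_scale[symmetric] by (intro arg_cong[where f="flux_of D"] ext) simp
qed

lemma R_h_0: "R_h D 0 = 0"
proof -
  have "R_h D (\<lambda>e S. 0 * (0::'a pwconst) e S) = vscale 0 (R_h D 0)" by (rule R_h_scale)
  moreover have "vscale 0 (R_h D 0) = 0" by (auto simp: vscale_def fscale_def fun_eq_iff)
  moreover have "(\<lambda>e S. 0 * (0::'a pwconst) e S) = 0" by (auto simp: fun_eq_iff)
  ultimately show ?thesis by metis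
qed

text \<open>Both energies see the pair \<open>(u, \<lambda>)\<close> through the total flux \<open>u + R\<^sub>h \<lambda>\<close> and, separately, the mortar.\<close>

definition flux :: "'a flux \<times> 'a pwconst \<Rightarrow> 'a flux" where "flux w = fst w + R_h D (snd w)"

lemma flux_Vh: "w \<in> Wh D \<Longrightarrow> flux w \<in> Vh D"
  unfolding flux_def by (intro Vh_add R_h_Vh V0h_Vh) (simp add: Wh_iff)

lemma flux_add: "flux (w + w') = flux w + flux w'"
  unfolding flux_def by (simp only: fst_add snd_add R_h_add add_ac)

lemma vscale_add: "vscale k (u + v) = vscale k u + vscale k v"
  by (auto simp: vscale_def fscale_def fun_eq_iff algebra_simps)

lemma flux_scale: "flux (pscale k w) = vscale k (flux w)"
  unfolding flux_def pscale_def by (simp only: fst_conv snd_conv R_h_scale vscale_add)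

end

section \<open>The inverse permeability and the two energies\<close>

context fractured_disc
begin

text \<open>The inverse permeability matters on the tangent space only.  Replacing it by a map that is linear on the whole space makes
continuity and integrability of the energy densities immediate.\<close>

definition spd_inverse :: "nat \<Rightarrow> ('a \<Rightarrow> 'a) \<Rightarrow> bool" where
  "spd_inverse i A \<longleftrightarrow> linear A \<and> (\<forall>\<eta>\<in>tangent (sdom D i). perm_inv D i \<eta> = A \<eta> \<and> A \<eta> \<in> tangent (sdom D i) \<and> perm D i (A \<eta>) = \<eta>)"

lemma perm_facts:
  assumes i: "i \<in> subs D"
  shows "linear (perm D i)" "\<xi> \<in> tangent (sdom D i) \<Longrightarrow> perm D i \<xi> \<in> tangent (sdom D i)"
    "\<xi> \<in> tangent (sdom D i) \<Longrightarrow> \<eta> \<in> tangent (sdom D i) \<Longrightarrow> perm D i \<xi> \<bullet> \<eta> = \<xi> \<bullet> perm D i \<eta>"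
    "\<xi> \<in> tangent (sdom D i) \<Longrightarrow> \<xi> \<noteq> 0 \<Longrightarrow> 0 < perm D i \<xi> \<bullet> \<xi>"
  using phys i unfolding physical_parameters_def by blast+

lemma spd_inverse_exists:
  assumes i: "i \<in> subs D" shows "\<exists>A. spd_inverse i A"
proof -
  let ?U = "tangent (sdom D i)" and ?K = "perm D i"
  note K = perm_facts[OF i]
  have sU: "span ?U = ?U" using tangent_subspace by (simp add: span_eq_iff)
  have inj: "inj_on ?K ?U"
  proof (rule inj_onI)
    fix x y assume h: "x \<in> ?U" "y \<in> ?U" "?K x = ?K y"
    have "?K (x - y) = 0" using h(3) K(1) by (simp add: linear_diff)
    then show "x = y" using K(4)[of "x - y"] subspace_diff[OF tangent_subspace h(1,2)] by force
  qed
  then obtain A where A: "linear A" "\<And>x. x \<in> ?U \<Longrightarrow> A (?K x) = x"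
    using linear_inj_on_left_inverse[of ?K ?U] K(1) sU by auto
  have "dim (?K ` ?U) = dim ?U" using dim_image_eq[OF K(1), of ?U] inj sU by simp
  moreover have "?K ` ?U \<subseteq> ?U" using K(2) by blast
  ultimately have surj: "?K ` ?U = ?U"
    using subspace_dim_equal[of "?K ` ?U" ?U] tangent_subspace linear_subspace_image[OF K(1)] by auto
  have "perm_inv D i \<eta> = A \<eta> \<and> A \<eta> \<in> ?U \<and> ?K (A \<eta>) = \<eta>" if \<eta>: "\<eta> \<in> ?U" for \<eta>
  proof -
    obtain \<xi> where \<xi>: "\<xi> \<in> ?U" "\<eta> = ?K \<xi>" using surj \<eta> by blast
    have "perm_inv D i \<eta> = \<xi>" unfolding perm_inv_def \<xi>(2) by (rule inv_into_f_f[OF inj \<xi>(1)])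
    then show ?thesis using A(2)[OF \<xi>(1)] \<xi> by simp
  qed
  then show ?thesis using A(1) unfolding spd_inverse_def by blast
qed

definition Kinv :: "nat \<Rightarrow> 'a \<Rightarrow> 'a" where "Kinv i = (SOME A. spd_inverse i A)"

lemma Kinv_facts:
  assumes i: "i \<in> subs D"
  shows "linear (Kinv i)" "\<eta> \<in> tangent (sdom D i) \<Longrightarrow> perm_inv D i \<eta> = Kinv i \<eta>" "\<eta> \<in> tangent (sdom D i) \<Longrightarrow> Kinv i \<eta> \<in> tangent (sdom D i)"
    "\<eta> \<in> tangent (sdom D i) \<Longrightarrow> perm D i (Kinv i \<eta>) = \<eta>"
proof -
  have "spd_inverse i (Kinv i)" unfolding Kinv_def by (rule someI_ex[OF spd_inverse_exists[OF i]])
  then show "linear (Kinv i)" "\<eta> \<in> tangent (sdom D i) \<Longrightarrow> perm_inv D i \<eta> = Kinv i \<eta>" "\<eta> \<in> tangent (sdom D i) \<Longrightarrow> Kinv i \<eta> \<in> tangent (sdom D i)"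
    "\<eta> \<in> tangent (sdom D i) \<Longrightarrow> perm D i (Kinv i \<eta>) = \<eta>"
    unfolding spd_inverse_def by blast+
qed

lemma Kinv_sym:
  assumes i: "i \<in> subs D" and h: "\<xi> \<in> tangent (sdom D i)" "\<eta> \<in> tangent (sdom D i)"
  shows "Kinv i \<xi> \<bullet> \<eta> = \<xi> \<bullet> Kinv i \<eta>"
proof -
  have "Kinv i \<xi> \<bullet> \<eta> = Kinv i \<xi> \<bullet> perm D i (Kinv i \<eta>)" using Kinv_facts(4)[OF i h(2)] by simp
  also have "\<dots> = perm D i (Kinv i \<xi>) \<bullet> Kinv i \<eta>" using perm_facts(3)[OF i] Kinv_facts(3)[OF i] h by simp
  finally show ?thesis using Kinv_facts(4)[OF i h(1)] by simp
qed

lemma Kinv_pos: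
  assumes i: "i \<in> subs D" and h: "\<eta> \<in> tangent (sdom D i)" "\<eta> \<noteq> 0" shows "0 < Kinv i \<eta> \<bullet> \<eta>"
proof -
  have "Kinv i \<eta> \<noteq> 0" using Kinv_facts(4)[OF i h(1)] h(2) linear_0[OF perm_facts(1)[OF i]] by force
  then show ?thesis using perm_facts(4)[OF i Kinv_facts(3)[OF i h(1)]] Kinv_facts(4)[OF i h(1)] by (simp add: inner_commute)
qed

lemma Kinv_nonneg: "i \<in> subs D \<Longrightarrow> \<eta> \<in> tangent (sdom D i) \<Longrightarrow> 0 \<le> Kinv i \<eta> \<bullet> \<eta>"
  using Kinv_pos[of i \<eta>] by (cases "\<eta> = 0") auto

text \<open>Both bounds express that a suitable square is nonnegative: the Euclidean square of \<open>\<eta> - k K\<^sup>-\<^sup>1 \<eta>\<close> for the upper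
bound, and the square of \<open>K\<^sup>-\<^sup>1 \<eta> - t \<eta>\<close> in the form \<open>K\<close>, with \<open>t = 1 / (\<kappa> k)\<close>, for the lower one.\<close>

lemma Kinv_bounds:
  assumes i: "i \<in> subs D" and k: "0 < k" "0 < \<kappa>"
    and b: "\<And>\<xi>. \<xi> \<in> tangent (sdom D i) \<Longrightarrow> k * (\<xi> \<bullet> \<xi>) \<le> perm D i \<xi> \<bullet> \<xi> \<and> perm D i \<xi> \<bullet> \<xi> \<le> \<kappa> * k * (\<xi> \<bullet> \<xi>)"
    and \<eta>: "\<eta> \<in> tangent (sdom D i)"
  shows "Kinv i \<eta> \<bullet> \<eta> \<le> 1 / k * (\<eta> \<bullet> \<eta>)" "1 / (\<kappa> * k) * (\<eta> \<bullet> \<eta>) \<le> Kinv i \<eta> \<bullet> \<eta>"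
proof -
  let ?\<xi> = "Kinv i \<eta>"
  note x = Kinv_facts(3)[OF i \<eta>] note Kx = Kinv_facts(4)[OF i \<eta>]
  have "0 \<le> (\<eta> - k *\<^sub>R ?\<xi>) \<bullet> (\<eta> - k *\<^sub>R ?\<xi>)" by (rule inner_ge_zero)
  also have "\<dots> = \<eta> \<bullet> \<eta> - 2 * k * (?\<xi> \<bullet> \<eta>) + k * (k * (?\<xi> \<bullet> ?\<xi>))"
    by (simp add: inner_diff_left inner_diff_right inner_commute algebra_simps)
  also have "k * (k * (?\<xi> \<bullet> ?\<xi>)) \<le> k * (?\<xi> \<bullet> \<eta>)"
    using b[OF x] Kx k by (intro mult_left_mono) (auto simp: inner_commute)
  finally have "k * (?\<xi> \<bullet> \<eta>) \<le> \<eta> \<bullet> \<eta>" by simp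
  then show "?\<xi> \<bullet> \<eta> \<le> 1 / k * (\<eta> \<bullet> \<eta>)" using k by (simp add: field_simps)
  define t where "t = 1 / (\<kappa> * k)"
  have t: "0 < t" "t * (\<kappa> * k) = 1" using k by (auto simp: t_def)
  have "?\<xi> - t *\<^sub>R \<eta> \<in> tangent (sdom D i)" using x \<eta> by (simp add: subspace_diff subspace_scale tangent_subspace)
  then have "0 \<le> perm D i (?\<xi> - t *\<^sub>R \<eta>) \<bullet> (?\<xi> - t *\<^sub>R \<eta>)" using b k(1) by (meson inner_ge_zero less_imp_le mult_nonneg_nonneg order_trans)
  also have "\<dots> = (\<eta> - t *\<^sub>R perm D i \<eta>) \<bullet> (?\<xi> - t *\<^sub>R \<eta>)"
    using perm_facts(1)[OF i] Kx by (simp add: linear_diff linear_scale)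
  also have "\<dots> = ?\<xi> \<bullet> \<eta> - t * (\<eta> \<bullet> \<eta>) - t * (perm D i \<eta> \<bullet> ?\<xi>) + t * (t * (perm D i \<eta> \<bullet> \<eta>))"
    by (simp add: inner_diff_left inner_diff_right inner_commute algebra_simps)
  also have "perm D i \<eta> \<bullet> ?\<xi> = \<eta> \<bullet> \<eta>" using perm_facts(3)[OF i \<eta> x] Kx by simp
  also have "t * (t * (perm D i \<eta> \<bullet> \<eta>)) \<le> t * (t * (\<kappa> * k * (\<eta> \<bullet> \<eta>)))"
    using b[OF \<eta>] t(1) by (intro mult_left_mono) auto
  also have "t * (t * (\<kappa> * k * (\<eta> \<bullet> \<eta>))) = t * ((t * (\<kappa> * k)) * (\<eta> \<bullet> \<eta>))" by (simp only: mult.assoc)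
  finally show "1 / (\<kappa> * k) * (\<eta> \<bullet> \<eta>) \<le> ?\<xi> \<bullet> \<eta>" using t(2) by (simp add: t_def)
qed

text \<open>On points the flux space is zero, and no facet exists; this case is separated because the local forms are studied on
cells of positive dimension only.\<close>

definition cell_energy :: "nat \<Rightarrow> 'a set \<Rightarrow> 'a flux \<Rightarrow> 'a flux \<Rightarrow> real" where
  "cell_energy i T u v = (if 1 \<le> sdim D i then cell_form (Kinv i) T (u i T) (v i T) else 0)"
definition facet_energy :: "nat \<Rightarrow> 'a set \<Rightarrow> 'a set \<Rightarrow> real" where
  "facet_energy i T f = cell_form (Kinv i) T (facet_basis T f) (facet_basis T f)"

lemma cell_psd:
  assumes i: "i \<in> subs D" "T \<in> cells D i" "1 \<le> sdim D i"
  shows "psd_form fscale (RT0 T) (cell_form (Kinv i) T)"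
proof -
  obtain C where "flat_cell C T" using cell_flat_cell[OF i] by blast
  then interpret flat_cell C T .
  show ?thesis
    using Kinv_facts(1)[OF i(1)] Kinv_sym[OF i(1)] Kinv_nonneg[OF i(1)] cell_tangent[OF i(1,2)] by (intro cell_form_psd) auto
qed

lemma perm_integral:
  assumes i: "i \<in> subs D" "T \<in> cells D i" and u: "u \<in> RT0 T" "1 \<le> sdim D i"
  shows "(LINT x:T|flat_measure T. perm_inv D i (u x) \<bullet> v x) = cell_form (Kinv i) T u v"
  unfolding cell_form_def
proof (rule set_lebesgue_integral_cong)
  show "T \<in> sets (flat_measure T)" using cell_compact[OF i] by (simp add: borel_closed compact_imp_closed)
  show "\<forall>x. x \<in> T \<longrightarrow> perm_inv D i (u x) \<bullet> v x = Kinv i (u x) \<bullet> v x"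
    using Kinv_facts(2)[OF i(1)] RT0_tangent[OF u(1)] cell_tangent[OF i] by (auto simp: hull_inc)
qed

lemma inner_K_eq:
  assumes "u \<in> Vh D" "v \<in> Vh D" shows "inner_K D u v = (\<Sum>i\<in>subs D. \<Sum>T\<in>cells D i. cell_energy i T u v)"
  unfolding inner_K_def
proof (intro sum.cong refl)
  fix i T assume i: "i \<in> subs D" "T \<in> cells D i"
  show "(LINT x:T|flat_measure T. perm_inv D i (u i T x) \<bullet> v i T x) = cell_energy i T u v"
  proof (cases "1 \<le> sdim D i")
    case True
    then show ?thesis using perm_integral[OF i Vh_RT0[OF assms(1) i True] True] by (simp add: cell_energy_def)
  next
    case False
    then have "v i T = 0" using Vh_0[OF assms(2)] by blast
    then have "v i T x = 0" for x by simp
    then show ?thesis using False by (simp add: cell_energy_def)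
  qed
qed

lemma inner_KD_eq:
  "inner_KD D u v = (\<Sum>i\<in>subs D. \<Sum>T\<in>cells D i. \<Sum>f\<in>{f. f facet_of T}. normal_comp (u i T) T f * normal_comp (v i T) T f * facet_energy i T f)"
  unfolding inner_KD_def
proof (intro sum.cong refl)
  fix i T f assume i: "i \<in> subs D" "T \<in> cells D i" "f \<in> {f. f facet_of T}"
  have d: "1 \<le> sdim D i" using facet_dim_pos i by blast
  obtain C where "flat_cell C T" using cell_flat_cell[OF i(1,2) d] by blast
  then interpret flat_cell C T .
  have "facet_basis T f \<in> RT0 T" using facet_basis_RT0 i(3) by simp
  then show "normal_comp (u i T) T f * normal_comp (v i T) T f * (LINT x:T|flat_measure T. perm_inv D i (facet_basis T f x) \<bullet> facet_basis T f x) =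
     normal_comp (u i T) T f * normal_comp (v i T) T f * facet_energy i T f"
    using perm_integral[OF i(1,2) _ d] by (simp add: facet_energy_def)
qed

lemma facet_energy_nonneg:
  assumes i: "i \<in> subs D" "T \<in> cells D i" "f facet_of T" shows "0 \<le> facet_energy i T f"
proof -
  have d: "1 \<le> sdim D i" using facet_dim_pos i by blast
  obtain C where "flat_cell C T" using cell_flat_cell[OF i(1,2) d] by blast
  then interpret flat_cell C T .
  interpret p: psd_form fscale "RT0 T" "cell_form (Kinv i) T" by (rule cell_psd[OF i(1,2) d])
  show ?thesis unfolding facet_energy_def by (rule p.nonneg[OF facet_basis_RT0[OF i(3)]])
qed

lemma cell_energy_props:
  assumes i: "i \<in> subs D" "T \<in> cells D i" and v: "u \<in> Vh D" "v \<in> Vh D" "w \<in> Vh D"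
  shows "cell_energy i T (u + v) w = cell_energy i T u w + cell_energy i T v w" "cell_energy i T (vscale c u) w = c * cell_energy i T u w" "cell_energy i T u v = cell_energy i T v u" "0 \<le> cell_energy i T u u"
proof -
  have "cell_energy i T (u + v) w = cell_energy i T u w + cell_energy i T v w \<and> cell_energy i T (vscale c u) w = c * cell_energy i T u w \<and> cell_energy i T u v = cell_energy i T v u \<and> 0 \<le> cell_energy i T u u"
  proof (cases "1 \<le> sdim D i")
    case True
    interpret p: psd_form fscale "RT0 T" "cell_form (Kinv i) T" by (rule cell_psd[OF i True])
    note m = Vh_RT0[OF v(1) i True] Vh_RT0[OF v(2) i True] Vh_RT0[OF v(3) i True]
    have "(u + v) i T = u i T + v i T" "vscale c u i T = fscale c (u i T)" by (simp_all only: plus_fun_apply vscale_def)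
    then show ?thesis using p.add_left[OF m] p.scale_left[OF m(1,3)] p.sym[OF m(1,2)] p.nonneg[OF m(1)] True
      by (simp add: cell_energy_def)
  qed (simp add: cell_energy_def)
  then show "cell_energy i T (u + v) w = cell_energy i T u w + cell_energy i T v w" "cell_energy i T (vscale c u) w = c * cell_energy i T u w" "cell_energy i T u v = cell_energy i T v u" "0 \<le> cell_energy i T u u" by blast+
qed

definition mortar_weight :: "nat \<Rightarrow> 'a set \<Rightarrow> real" where
  "mortar_weight e S = aper D e * inverse (nperm D e) * measure (flat_measure (iface_dom D e)) (rel_interior S \<inter> iface_dom D e)"

lemma inner_Gamma_eq: "inner_Gamma D \<theta> \<mu> = (\<Sum>e\<in>ifaces D. \<Sum>S\<in>mcells D e. \<theta> e S * \<mu> e S * mortar_weight e S)"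
  unfolding inner_Gamma_def
proof (intro sum.cong refl)
  fix e assume e: "e \<in> ifaces D"
  let ?c = "aper D e * inverse (nperm D e)"
  note mc = mcell_facts[OF e]
  have b: "\<And>S. S \<in> mcells D e \<Longrightarrow> rel_interior S \<in> sets borel" using mc(2) by (auto simp: disjoint_interiors_def intro!: rel_interior_borel)
  have "?c * P0_fun (mcells D e) (\<theta> e) x * P0_fun (mcells D e) (\<mu> e) x = (\<Sum>S\<in>mcells D e. (?c * (\<theta> e S * \<mu> e S)) * indicator (rel_interior S) x)" for x
    using P0_fun_mult[OF mc(2), of "\<theta> e" x "\<mu> e"] by (simp add: mult.assoc sum_distrib_left)
  then show "(LINT x:iface_dom D e|flat_measure (iface_dom D e). ?c * P0_fun (mcells D e) (\<theta> e) x * P0_fun (mcells D e) (\<mu> e) x) = (\<Sum>S\<in>mcells D e. \<theta> e S * \<mu> e S * mortar_weight e S)"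
    using finite_sum_indicator_integral(1)[OF iface_dom_facts[OF e] mc(1) b, where c="\<lambda>S. ?c * (\<theta> e S * \<mu> e S)"]
    by (simp add: mortar_weight_def mult_ac)
qed

lemma mortar_weight_pos: assumes e: "e \<in> ifaces D" "S \<in> mcells D e" shows "0 < mortar_weight e S"
proof -
  note mc = mcell_facts[OF e(1)]
  have s: "rel_interior S \<subseteq> iface_dom D e" using mc(5)[OF e(2)] .
  have "S \<noteq> {}" using mc(4)[OF e(2)] by auto
  then have ne: "rel_interior S \<noteq> {}" using mc(4)[OF e(2)] convex_simplex rel_interior_eq_empty by blast
  have "openin (top_of_set (affine hull (iface_dom D e))) (rel_interior S)"
    using openin_rel_interior[of S] mc(6)[OF e(2)] by simp
  then have "0 < measure (flat_measure (iface_dom D e)) (rel_interior S)"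
    using ne s iface_dom_facts[OF e(1)] by (intro open_measure_pos) (auto intro: bounded_subset)
  moreover have "rel_interior S \<inter> iface_dom D e = rel_interior S" using s by blast
  moreover have "0 < aper D e" "0 < nperm D e" using phys e(1) by (auto simp: physical_parameters_def)
  ultimately show ?thesis by (simp add: mortar_weight_def)
qed

lemma form_a_eq: "form_a D w r = inner_K D (flux w) (flux r) + inner_Gamma D (snd w) (snd r)"
  by (simp add: form_a_def flux_def split_beta)

lemma form_aD_eq: "form_aD D w r = inner_KD D (flux w) (flux r) + inner_Gamma D (snd w) (snd r)"
  by (simp add: form_aD_def flux_def split_beta)

lemma Gamma_props:
  "inner_Gamma D (\<theta> + \<theta>') \<mu> = inner_Gamma D \<theta> \<mu> + inner_Gamma D \<theta>' \<mu>"
  "inner_Gamma D (\<lambda>e S. c * \<theta> e S) \<mu> = c * inner_Gamma D \<theta> \<mu>" "inner_Gamma D \<theta> \<mu> = inner_Gamma D \<mu> \<theta>" "0 \<le> inner_Gamma D \<theta> \<theta>"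
proof -
  show "0 \<le> inner_Gamma D \<theta> \<theta>"
    unfolding inner_Gamma_eq using mortar_weight_pos by (intro sum_nonneg mult_nonneg_nonneg[OF zero_le_square]) (simp add: less_imp_le)
qed (simp_all add: inner_Gamma_eq sum.distrib algebra_simps sum_distrib_left)

text \<open>Through \<open>flux\<close> the form is a sum of energies of cells, each of which is a positive semidefinite form on the local space.\<close>

lemma form_a_psd: "psd_form pscale (Wh D) (form_a D)"
proof (intro psd_form.intro vector_space_pscale psd_form_axioms.intro Wh_subspace)
  fix w r z c assume w: "w \<in> Wh D"
  note fw = flux_Vh[OF w]
  show "0 \<le> form_a D w w"
    unfolding form_a_eq inner_K_eq[OF fw fw] using Gamma_props(4) cell_energy_props(4)[OF _ _ fw fw fw] by (intro add_nonneg_nonneg sum_nonneg) auto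
  assume r: "r \<in> Wh D" note fr = flux_Vh[OF r]
  show "form_a D w r = form_a D r w"
    unfolding form_a_eq inner_K_eq[OF fw fr] inner_K_eq[OF fr fw] Gamma_props(3)[of "snd w"]
    using cell_energy_props(3)[OF _ _ fw fr fw] by simp
  have s: "snd (pscale c w) = (\<lambda>e S. c * snd w e S)" by (simp add: pscale_def)
  show "form_a D (pscale c w) r = c * form_a D w r"
    unfolding form_a_eq flux_scale inner_K_eq[OF fw fr] inner_K_eq[OF Vh_scale[OF fw] fr] s Gamma_props(2)
    using cell_energy_props(2)[OF _ _ fw fr fr] by (simp add: sum_distrib_left distrib_left)
  assume z: "z \<in> Wh D" note fz = flux_Vh[OF z]
  have "(\<Sum>i\<in>subs D. \<Sum>T\<in>cells D i. cell_energy i T (flux w + flux r) (flux z)) =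
      (\<Sum>i\<in>subs D. \<Sum>T\<in>cells D i. cell_energy i T (flux w) (flux z)) + (\<Sum>i\<in>subs D. \<Sum>T\<in>cells D i. cell_energy i T (flux r) (flux z))"
    unfolding sum.distrib[symmetric] by (intro sum.cong refl cell_energy_props(1)[OF _ _ fw fr fz])
  then show "form_a D (w + r) z = form_a D w z + form_a D r z"
    unfolding form_a_eq flux_add inner_K_eq[OF fw fz] inner_K_eq[OF fr fz] inner_K_eq[OF Vh_add[OF fw fr] fz] snd_add Gamma_props(1)
    by linarith
qed

lemma form_aD_psd: "psd_form pscale (Wh D) (form_aD D)"
proof (intro psd_form.intro vector_space_pscale psd_form_axioms.intro Wh_subspace)
  fix w r z c assume w: "w \<in> Wh D"
  note fw = flux_Vh[OF w]
  show "0 \<le> form_aD D w w"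
    unfolding form_aD_eq inner_KD_eq using Gamma_props(4) facet_energy_nonneg by (intro add_nonneg_nonneg sum_nonneg mult_nonneg_nonneg[OF zero_le_square]) auto
  assume r: "r \<in> Wh D" note fr = flux_Vh[OF r]
  show "form_aD D w r = form_aD D r w"
    unfolding form_aD_eq inner_KD_eq Gamma_props(3)[of "snd w"] by (simp add: mult.commute)
  have s: "snd (pscale c w) = (\<lambda>e S. c * snd w e S)" by (simp add: pscale_def)
  have "(\<Sum>i\<in>subs D. \<Sum>T\<in>cells D i. \<Sum>f\<in>{f. f facet_of T}. normal_comp (vscale c (flux w) i T) T f * normal_comp (flux r i T) T f * facet_energy i T f) =
      (\<Sum>i\<in>subs D. \<Sum>T\<in>cells D i. \<Sum>f\<in>{f. f facet_of T}. c * (normal_comp (flux w i T) T f * normal_comp (flux r i T) T f * facet_energy i T f))"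
    by (intro sum.cong refl) (simp add: Vh_normal_scale[OF fw])
  then show "form_aD D (pscale c w) r = c * form_aD D w r"
    unfolding form_aD_eq flux_scale inner_KD_eq s Gamma_props(2) by (simp add: sum_distrib_left distrib_left)
  assume z: "z \<in> Wh D"
  have "(\<Sum>i\<in>subs D. \<Sum>T\<in>cells D i. \<Sum>f\<in>{f. f facet_of T}. normal_comp ((flux w + flux r) i T) T f * normal_comp (flux z i T) T f * facet_energy i T f) =
      (\<Sum>i\<in>subs D. \<Sum>T\<in>cells D i. \<Sum>f\<in>{f. f facet_of T}. normal_comp (flux w i T) T f * normal_comp (flux z i T) T f * facet_energy i T f) +
      (\<Sum>i\<in>subs D. \<Sum>T\<in>cells D i. \<Sum>f\<in>{f. f facet_of T}. normal_comp (flux r i T) T f * normal_comp (flux z i T) T f * facet_energy i T f)"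
    unfolding sum.distrib[symmetric]
  proof (intro sum.cong refl)
    fix i T f assume h: "i \<in> subs D" "T \<in> cells D i" "f \<in> {f. f facet_of T}"
    show "normal_comp ((flux w + flux r) i T) T f * normal_comp (flux z i T) T f * facet_energy i T f =
      normal_comp (flux w i T) T f * normal_comp (flux z i T) T f * facet_energy i T f + normal_comp (flux r i T) T f * normal_comp (flux z i T) T f * facet_energy i T f"
      using Vh_normal_add[OF fw fr h(1,2)] h(3) by (simp only: mem_Collect_eq distrib_right)
  qed
  then show "form_aD D (w + r) z = form_aD D w z + form_aD D r z"
    unfolding form_aD_eq flux_add inner_KD_eq snd_add Gamma_props(1) by linarith
qed

text \<open>Expand the field in the at most four basis fields of the cell and apply Cauchy--Schwarz to the sum.\<close>

lemma cell_upper: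
  assumes i: "i \<in> subs D" "T \<in> cells D i" and v: "v \<in> Vh D"
  shows "cell_energy i T v v \<le> 4 * (\<Sum>f\<in>{f. f facet_of T}. normal_comp (v i T) T f * normal_comp (v i T) T f * facet_energy i T f)"
proof (cases "1 \<le> sdim D i")
  case True
  obtain C where "flat_cell C T" using cell_flat_cell[OF i True] by blast
  then interpret flat_cell C T .
  interpret p: psd_form fscale "RT0 T" "cell_form (Kinv i) T" by (rule cell_psd[OF i True])
  let ?n = "normal_comp (v i T) T" and ?F = "{f. f facet_of T}"
  have vR: "v i T \<in> RT0 T" by (rule Vh_RT0[OF v i True])
  have m: "fscale (?n f) (facet_basis T f) \<in> RT0 T" if "f \<in> ?F" for f
    using that facet_basis_RT0 p.W by (auto intro: fscale.subspace_scale)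
  have "cell_form (Kinv i) T (v i T) (v i T) \<le> card ?F * (\<Sum>f\<in>?F. cell_form (Kinv i) T (fscale (?n f) (facet_basis T f)) (fscale (?n f) (facet_basis T f)))"
    using p.sum_square_le[of ?F "\<lambda>f. fscale (?n f) (facet_basis T f)"] finite_facets(1) m unfolding RT0_expansion[OF vR, symmetric] by blast
  also have "(\<Sum>f\<in>?F. cell_form (Kinv i) T (fscale (?n f) (facet_basis T f)) (fscale (?n f) (facet_basis T f))) = (\<Sum>f\<in>?F. ?n f * ?n f * facet_energy i T f)"
    using m facet_basis_RT0 by (intro sum.cong refl) (simp add: p.scale_left p.scale_right facet_energy_def)
  also have "card ?F * (\<Sum>f\<in>?F. ?n f * ?n f * facet_energy i T f) \<le> 4 * (\<Sum>f\<in>?F. ?n f * ?n f * facet_energy i T f)"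
  proof (rule mult_right_mono)
    show "real (card ?F) \<le> 4" using finite_facets(2) aff_dim_T dim3 by linarith
    show "0 \<le> (\<Sum>f\<in>?F. ?n f * ?n f * facet_energy i T f)" using facet_energy_nonneg[OF i] by (intro sum_nonneg mult_nonneg_nonneg[OF zero_le_square]) auto
  qed
  finally show ?thesis using True by (simp add: cell_energy_def)
next
  case False
  then have "{f. f facet_of T} = {}" using facet_dim_pos[OF i] by blast
  then show ?thesis using False by (simp add: cell_energy_def)
qed

lemma form_a_le: assumes w: "w \<in> Wh D" shows "form_a D w w \<le> 4 * form_aD D w w"
proof -
  note fw = flux_Vh[OF w]
  have "inner_K D (flux w) (flux w) \<le> (\<Sum>i\<in>subs D. \<Sum>T\<in>cells D i. 4 * (\<Sum>f\<in>{f. f facet_of T}. normal_comp (flux w i T) T f * normal_comp (flux w i T) T f * facet_energy i T f))"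
    unfolding inner_K_eq[OF fw fw] by (intro sum_mono cell_upper fw)
  also have "\<dots> = 4 * inner_KD D (flux w) (flux w)" unfolding inner_KD_eq by (simp only: sum_distrib_left)
  finally show ?thesis unfolding form_a_eq form_aD_eq distrib_left using Gamma_props(4)[of "snd w"] by linarith
qed

text \<open>The basis field of a facet is bounded by \<open>\<sigma>\<close>, so its energy is at most \<open>\<sigma>\<^sup>2 / k\<close> times the volume of the cell;
the energy of \<open>v\<close> is at least the squared normal component times the volume, divided by \<open>4096 * \<kappa> * k\<close>.  The
scale \<open>k\<close> of the permeability cancels.  A cell has at most four facets, whence \<open>16384 = 4 * 4096\<close>.\<close>

lemma cell_lower:
  assumes i: "i \<in> subs D" "T \<in> cells D i" and v: "v \<in> Vh D" and \<kappa>: "perm_bounds \<kappa> D"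
  shows "(\<Sum>f\<in>{f. f facet_of T}. normal_comp (v i T) T f * normal_comp (v i T) T f * facet_energy i T f) \<le> 16384 * max \<kappa> 0 * \<sigma>\<^sup>2 * cell_energy i T v v"
proof (cases "1 \<le> sdim D i")
  case True
  obtain C where "flat_cell C T" using cell_flat_cell[OF i True] by blast
  then interpret flat_cell C T .
  interpret p: psd_form fscale "RT0 T" "cell_form (Kinv i) T" by (rule cell_psd[OF i True])
  let ?n = "normal_comp (v i T) T" and ?F = "{f. f facet_of T}"
  have vR: "v i T \<in> RT0 T" by (rule Vh_RT0[OF v i True])
  have tan: "tangent T = tangent (sdom D i)" by (rule cell_tangent[OF i])
  obtain k where k: "0 < k" "\<And>\<xi>. \<xi> \<in> tangent (sdom D i) \<Longrightarrow> k * (\<xi> \<bullet> \<xi>) \<le> perm D i \<xi> \<bullet> \<xi> \<and> perm D i \<xi> \<bullet> \<xi> \<le> \<kappa> * k * (\<xi> \<bullet> \<xi>)"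
    using \<kappa> i(1) unfolding perm_bounds_def by blast
  \<comment> \<open>the tangent space contains a unit normal, so the two-sided bound on the permeability is not vacuous\<close>
  have "0 < \<kappa>"
  proof -
    obtain p where p: "p \<in> C" using card by fastforce
    have n: "nrm p \<in> tangent (sdom D i)" "nrm p \<bullet> nrm p = 1" using nrm_tangent[OF p] norm_nrm[OF p] tan by (auto simp: norm_eq_1)
    then have "0 < \<kappa> * k" using k(2)[OF n(1)] k(1) by simp
    then show ?thesis using k(1) by (simp add: zero_less_mult_iff)
  qed
  note B = Kinv_bounds[OF i(1) k(1) this k(2)]
  obtain x0 r where r: "0 < r" "x0 \<in> T" "cball x0 r \<inter> affine hull T \<subseteq> T" "diameter T \<le> \<sigma> * r"
    using cells_regular[OF i(1)] i(2) unfolding shape_regular_def by blast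
  let ?V = "measure (flat_measure T) T" and ?E = "cell_form (Kinv i) T (v i T) (v i T)"
  have per_facet: "?n f * ?n f * facet_energy i T f \<le> 4096 * \<kappa> * \<sigma>\<^sup>2 * ?E" if f: "f \<in> ?F" for f
  proof -
    have "facet_energy i T f \<le> 1 / k * \<sigma>\<^sup>2 * ?V"
      unfolding facet_energy_def using f facet_basis_bound[OF r] B(1) tan k(1) Kinv_facts(1)[OF i(1)]
      by (intro cell_form_facet_basis_upper) auto
    then have "?n f * ?n f * facet_energy i T f \<le> (?n f)\<^sup>2 * (1 / k * \<sigma>\<^sup>2 * ?V)"
      unfolding power2_eq_square by (rule mult_left_mono) simp
    also have "\<dots> = 4096 * \<kappa> * \<sigma>\<^sup>2 * (1 / (\<kappa> * k) * ((?n f)\<^sup>2 * ?V / 4096))"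
      using \<open>0 < \<kappa>\<close> k(1) by (simp add: field_simps)
    also have "\<dots> \<le> 4096 * \<kappa> * \<sigma>\<^sup>2 * ?E"
    proof (rule mult_left_mono)
      show "1 / (\<kappa> * k) * ((?n f)\<^sup>2 * ?V / 4096) \<le> ?E"
        using f B(2) tan k(1) \<open>0 < \<kappa>\<close> by (intro cell_form_lower[OF Kinv_facts(1)[OF i(1)]] vR) auto
      show "0 \<le> 4096 * \<kappa> * \<sigma>\<^sup>2" using \<open>0 < \<kappa>\<close> by simp
    qed
    finally show ?thesis .
  qed
  have E0: "0 \<le> ?E" by (rule p.nonneg[OF vR])
  have "(\<Sum>f\<in>?F. ?n f * ?n f * facet_energy i T f) \<le> card ?F * (4096 * \<kappa> * \<sigma>\<^sup>2 * ?E)"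
    using sum_mono[of ?F _ "\<lambda>_. 4096 * \<kappa> * \<sigma>\<^sup>2 * ?E", OF per_facet] by simp
  also have "\<dots> \<le> 4 * (4096 * \<kappa> * \<sigma>\<^sup>2 * ?E)"
  proof (rule mult_right_mono)
    show "real (card ?F) \<le> 4" using finite_facets(2) aff_dim_T dim3 by linarith
  qed (use E0 \<open>0 < \<kappa>\<close> in simp)
  finally show ?thesis using True \<open>0 < \<kappa>\<close> by (simp add: cell_energy_def)
next
  case False
  then have "{f. f facet_of T} = {}" using facet_dim_pos[OF i] by blast
  then show ?thesis using False by (simp add: cell_energy_def)
qed

lemma form_aD_le:
  assumes w: "w \<in> Wh D" and \<kappa>: "perm_bounds \<kappa> D"
  shows "form_aD D w w \<le> (16384 * max \<kappa> 0 * \<sigma>\<^sup>2 + 1) * form_a D w w"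
proof -
  note fw = flux_Vh[OF w]
  let ?c = "16384 * max \<kappa> 0 * \<sigma>\<^sup>2"
  have c: "0 \<le> ?c" by simp
  have "inner_KD D (flux w) (flux w) \<le> (\<Sum>i\<in>subs D. \<Sum>T\<in>cells D i. ?c * cell_energy i T (flux w) (flux w))"
    unfolding inner_KD_eq by (intro sum_mono cell_lower[OF _ _ fw \<kappa>])
  also have "\<dots> = ?c * inner_K D (flux w) (flux w)" unfolding inner_K_eq[OF fw fw] by (simp only: sum_distrib_left)
  finally have 1: "inner_KD D (flux w) (flux w) \<le> ?c * inner_K D (flux w) (flux w)" .
  have 2: "0 \<le> inner_K D (flux w) (flux w)"
    unfolding inner_K_eq[OF fw fw] using cell_energy_props(4)[OF _ _ fw fw fw] by (intro sum_nonneg) auto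
  have 3: "0 \<le> ?c * inner_Gamma D (snd w) (snd w)" using c Gamma_props(4) by (rule mult_nonneg_nonneg)
  show ?thesis unfolding form_a_eq form_aD_eq distrib_left distrib_right using 1 2 3 by linarith
qed

text \<open>The mortar energy determines the mortar.  On each cell the lower bound by squares of normal components forces every degree
of freedom of the total flux to vanish, and then no extension is left to separate the flux from zero.\<close>

lemma form_a_definite:
  assumes w: "w \<in> Wh D" and z: "form_a D w w = 0" shows "w = 0"
proof -
  note fw = flux_Vh[OF w]
  have K: "0 \<le> cell_energy i T (flux w) (flux w)" if "i \<in> subs D" "T \<in> cells D i" for i T
    using cell_energy_props(4)[OF that fw fw fw] .
  have "0 \<le> inner_K D (flux w) (flux w)" unfolding inner_K_eq[OF fw fw] using K by (intro sum_nonneg) auto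
  then have 0: "inner_K D (flux w) (flux w) = 0" "inner_Gamma D (snd w) (snd w) = 0"
    using z Gamma_props(4)[of "snd w"] unfolding form_a_eq by linarith+
  have sw: "snd w = 0"
  proof (intro ext)
    fix e S
    show "snd w e S = 0 e S"
    proof (cases "e \<in> ifaces D \<and> S \<in> mcells D e")
      case True
      let ?g = "\<lambda>e. \<Sum>S\<in>mcells D e. snd w e S * snd w e S * mortar_weight e S"
      have g: "0 \<le> snd w e S * snd w e S * mortar_weight e S" if "e \<in> ifaces D" "S \<in> mcells D e" for e S
        using mortar_weight_pos[OF that] by (simp add: less_imp_le)
      have "?g e = 0"
        using 0(2) True finite_ifaces unfolding inner_Gamma_eq by (subst (asm) sum_nonneg_eq_0_iff) (auto intro!: sum_nonneg g)
      then have "snd w e S * snd w e S * mortar_weight e S = 0"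
        using True mcell_facts(1) by (subst (asm) sum_nonneg_eq_0_iff) (auto intro!: g)
      then show ?thesis using mortar_weight_pos[of e S] True by simp
    next
      case False then show ?thesis using w by (auto simp: Wh_iff Lh_def)
    qed
  qed
  have "flux w = 0"
  proof (rule Vh_ext[OF fw Vh_zero])
    fix i T f assume h: "i \<in> subs D" "T \<in> cells D i" "f facet_of T"
    have d: "1 \<le> sdim D i" using facet_dim_pos h by blast
    obtain C where "flat_cell C T" using cell_flat_cell[OF h(1,2) d] by blast
    then interpret flat_cell C T .
    have tan: "tangent T = tangent (sdom D i)" by (rule cell_tangent[OF h(1,2)])
    obtain l where l: "0 < l" "\<And>\<xi>. \<xi> \<in> tangent (sdom D i) \<Longrightarrow> l * (\<xi> \<bullet> \<xi>) \<le> Kinv i \<xi> \<bullet> \<xi>"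
      using pos_def_lower_bound[OF Kinv_facts(1)[OF h(1)] tangent_subspace Kinv_pos[OF h(1)]] by blast
    have "(\<Sum>T\<in>cells D i. cell_energy i T (flux w) (flux w)) = 0"
      using 0(1) h(1) finite_subs unfolding inner_K_eq[OF fw fw] by (subst (asm) sum_nonneg_eq_0_iff) (auto intro!: sum_nonneg K)
    then have "cell_energy i T (flux w) (flux w) = 0"
      using h cell_finite by (subst (asm) sum_nonneg_eq_0_iff) (auto intro!: K)
    then have "l * ((normal_comp (flux w i T) T f)\<^sup>2 * measure (flat_measure T) T / 4096) \<le> 0"
      using cell_form_lower[OF Kinv_facts(1)[OF h(1)], of l "flux w i T" f] l tan Vh_RT0[OF fw h(1,2) d] h(3) d by (simp add: cell_energy_def)
    then have "normal_comp (flux w i T) T f = 0" using l(1) measure_T_pos by (simp add: mult_le_0_iff not_less)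
    moreover have "normal_comp (0 i T) T f = 0" using Vh_normal_scale[OF Vh_zero h, of 0]
      by (simp add: vscale_def fscale_def zero_fun_def)
    ultimately show "normal_comp (flux w i T) T f = normal_comp (0 i T) T f" by simp
  qed
  moreover note R_h_0
  ultimately have "fst w = 0" unfolding flux_def sw by (simp only: add_0_right)
  then show ?thesis using sw by (simp add: prod_eq_iff)
qed

lemma form_aD_definite: "w \<in> Wh D \<Longrightarrow> form_aD D w w = 0 \<Longrightarrow> w = 0"
proof -
  assume w: "w \<in> Wh D" and z: "form_aD D w w = 0"
  interpret a: psd_form pscale "Wh D" "form_a D" by (rule form_a_psd)
  show "w = 0" using form_a_definite[OF w] a.nonneg[OF w] form_a_le[OF w] z by simp
qed

end

section \<open>The form b and the discrete gradient\<close>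

text \<open>A nonempty open piece of an affine subspace has positive measure, whereas affine subspaces of smaller dimension are null.\<close>

lemma avoid_affine:
  fixes S :: "'a::euclidean_space set"
  assumes S: "S \<noteq> {}" "aff_dim S \<le> 3" and U: "openin (top_of_set (affine hull S)) U" "U \<noteq> {}"
    and A: "finite \<A>" "\<And>A. A \<in> \<A> \<Longrightarrow> affine A \<and> aff_dim A < aff_dim S"
  obtains y where "y \<in> U" "\<And>A. A \<in> \<A> \<Longrightarrow> y \<notin> A"
proof -
  have null: "A \<in> null_sets (flat_measure S)" if "A \<in> \<A>" for A
  proof -
    have "\<not> affine hull S \<subseteq> A" using A(2)[OF that] aff_dim_subset[of "affine hull S" A] by auto
    then show ?thesis using flat_affine_null[OF S, of A] A(2)[OF that] by (auto simp: affine_closed borel_closed)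
  qed
  have "\<Union>\<A> \<in> null_sets (flat_measure S)" using null null_sets.finite_Union[OF A(1)] by blast
  moreover have "U \<in> sets (flat_measure S)"
    using U(1) unfolding openin_open by (metis affine_affine_hull affine_closed borel_closed borel_open sets.Int sets_flat)
  ultimately have "\<not> U \<subseteq> \<Union>\<A>"
    using flat_open_positive[OF S U] null_sets_subset[of "\<Union>\<A>" "flat_measure S" U] null_setsD1[of U "flat_measure S"]
    by fastforce
  then show ?thesis using that by blast
qed

context fractured_disc
begin

text \<open>The integral over \<open>T\<close> of the divergence of the basis field of \<open>f\<close>.  That divergence is constant, so it may be evaluated
at the origin.\<close>

definition facet_flux :: "'a set \<Rightarrow> 'a set \<Rightarrow> real" where
  "facet_flux T f = flat_div T (facet_basis T f) 0 * measure (flat_measure T) T"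
definition mortar_area :: "'a set \<Rightarrow> 'a set \<Rightarrow> real" where
  "mortar_area T S = measure (flat_measure T) (rel_interior S \<inter> T)"

lemma facet_flux_pos: assumes i: "i \<in> subs D" "T \<in> cells D i" "f facet_of T" shows "0 < facet_flux T f"
proof -
  have d: "1 \<le> sdim D i" using facet_dim_pos i by blast
  obtain C where "flat_cell C T" using cell_flat_cell[OF i(1,2) d] by blast
  then interpret flat_cell C T .
  obtain p where p: "p \<in> C" "f = F p" using i(3) facet_iff by blast
  have "int (dim (tangent T)) = int (sdim D i)" using dim_tangent[OF T_ne] cell_dim[OF i(1,2)] by simp
  then show ?thesis unfolding facet_flux_def p(2) flat_div_facet_basis[OF p(1)] using d ht_pos[OF p(1)] measure_T_pos by simp
qed

text \<open>By the divergence theorem this number is the area of the facet, which belongs to both cells; here the equality follows from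
\<open>height_ratio\<close>.\<close>

lemma facet_flux_eq:
  assumes i: "i \<in> subs D" "T \<in> cells D i" "T' \<in> cells D i" "f facet_of T" "f facet_of T'"
  shows "facet_flux T f = facet_flux T' f"
proof -
  have d: "1 \<le> sdim D i" using facet_dim_pos i by blast
  obtain C where a: "flat_cell C T" using cell_flat_cell[OF i(1,2) d] by blast
  obtain C' where b: "flat_cell C' T'" using cell_flat_cell[OF i(1,3) d] by blast
  interpret a: flat_cell C T by (rule a)
  interpret b: flat_cell C' T' by (rule b)
  obtain p where p: "p \<in> C" "f = a.F p" using i(4) a.facet_iff by blast
  obtain q where q: "q \<in> C'" "f = b.F q" using i(5) b.facet_iff by blast
  have h: "affine hull T' = affine hull T" using cell_hull[OF i(1)] i(2,3) by simp
  have "measure (flat_measure T') T' / b.ht q = measure (flat_measure T) T / a.ht p"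
    using p q by (intro height_ratio[OF a b h]) auto
  moreover have "tangent T' = tangent T" by (rule tangent_cong_hull[OF h])
  moreover have "facet_flux T f = dim (tangent T) * (measure (flat_measure T) T / a.ht p)"
    unfolding facet_flux_def p(2) a.flat_div_facet_basis[OF p(1)] by simp
  moreover have "facet_flux T' f = dim (tangent T') * (measure (flat_measure T') T' / b.ht q)"
    unfolding facet_flux_def q(2) b.flat_div_facet_basis[OF q(1)] by simp
  ultimately show ?thesis by simp
qed

lemma flux_div:
  assumes i: "i \<in> subs D" "T \<in> cells D i" and v: "v \<in> Vh D"
  shows "flat_div T (v i T) x * measure (flat_measure T) T = (\<Sum>f\<in>{f. f facet_of T}. normal_comp (v i T) T f * facet_flux T f)"
proof (cases "1 \<le> sdim D i")
  case True
  obtain C where "flat_cell C T" using cell_flat_cell[OF i True] by blast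
  then interpret flat_cell C T .
  have vR: "v i T \<in> RT0 T" by (rule Vh_RT0[OF v i True])
  let ?n = "normal_comp (v i T) T"
  have *: "A \<subseteq> {f. f facet_of T} \<Longrightarrow> (\<Sum>f\<in>A. fscale (?n f) (facet_basis T f)) \<in> RT0 T \<and>
    flat_div T (\<Sum>f\<in>A. fscale (?n f) (facet_basis T f)) x = (\<Sum>f\<in>A. ?n f * flat_div T (facet_basis T f) x)" if "finite A" for A
    using that
  proof (induction A rule: finite_induct)
    case empty
    show ?case using fscale.subspace_0[OF RT0_subspace[OF T_ne]] by (simp only: sum.empty flat_div_0 simp_thms)
  next
    case (insert f A)
    let ?S = "\<Sum>f\<in>A. fscale (?n f) (facet_basis T f)"
    have S: "?S \<in> RT0 T" "flat_div T ?S x = (\<Sum>f\<in>A. ?n f * flat_div T (facet_basis T f) x)" using insert by blast+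
    have b: "facet_basis T f \<in> RT0 T" using insert.prems facet_basis_RT0 by auto
    have m: "fscale (?n f) (facet_basis T f) \<in> RT0 T" by (rule fscale.subspace_scale[OF RT0_subspace[OF T_ne] b])
    have e: "(\<Sum>f\<in>insert f A. fscale (?n f) (facet_basis T f)) = fscale (?n f) (facet_basis T f) + ?S"
      using insert.hyps by (intro sum.insert)
    show ?case unfolding e flat_div_add[OF m S(1)] flat_div_fscale[OF b] S(2)
      using insert.hyps fscale.subspace_add[OF RT0_subspace[OF T_ne] m S(1)] by (simp only: sum.insert simp_thms)
  qed
  have "flat_div T (v i T) x = (\<Sum>f\<in>{f. f facet_of T}. ?n f * flat_div T (facet_basis T f) x)"
    using *[OF finite_facets(1) order.refl] RT0_expansion[OF vR] by simp
  also have "\<dots> = (\<Sum>f\<in>{f. f facet_of T}. ?n f * flat_div T (facet_basis T f) 0)"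
    using flat_div_const[OF facet_basis_RT0] by (intro sum.cong refl) (metis mem_Collect_eq)
  finally show ?thesis by (simp add: facet_flux_def sum_distrib_right mult.assoc)
next
  case False
  then have "{f. f facet_of T} = {}" using facet_dim_pos[OF i] by blast
  moreover have "v i T = 0" using Vh_0[OF v] False by blast
  ultimately show ?thesis by (simp only: flat_div_0 sum.empty mult_zero_left)
qed

text \<open>All integrands are constant or combinations of indicator functions, so \<open>b\<close> is a finite sum of degrees of freedom with
geometric weights.  Linearity and all tests below are read off from this sum.\<close>

lemma form_b_eq:
  assumes r: "r \<in> Wh D"
  shows "form_b D r q = - (\<Sum>i\<in>subs D. \<Sum>T\<in>cells D i. q i T *
     ((\<Sum>f\<in>{f. f facet_of T}. normal_comp (flux r i T) T f * facet_flux T f) - (\<Sum>e\<in>{e\<in>ifaces D. lower D e = i}. \<Sum>S\<in>mcells D e. snd r e S * mortar_area T S)))"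
proof -
  have "(LINT x:T|flat_measure T. q i T * (flat_div T (flux r i T) x + jump D (snd r) i x)) = q i T *
     ((\<Sum>f\<in>{f. f facet_of T}. normal_comp (flux r i T) T f * facet_flux T f) - (\<Sum>e\<in>{e\<in>ifaces D. lower D e = i}. \<Sum>S\<in>mcells D e. snd r e S * mortar_area T S))"
    if i: "i \<in> subs D" "T \<in> cells D i" for i T
  proof -
    let ?E = "{e\<in>ifaces D. lower D e = i}" and ?J = "Sigma {e\<in>ifaces D. lower D e = i} (mcells D)"
    note fr = flux_Vh[OF r]
    have Tf: "T \<noteq> {}" "aff_dim T \<le> 3" "bounded T" "T \<in> sets borel"
      using cell_ne[OF i] cell_dim[OF i] sub_dim[OF i(1)] sub_dim3[OF i(1)] cell_compact[OF i]
      by (auto simp: compact_imp_bounded borel_closed compact_imp_closed)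
    have fin: "finite ?E" "finite ?J" using finite_ifaces mcell_facts(1) by (auto intro!: finite_SigmaI)
    have b: "\<And>p. p \<in> ?J \<Longrightarrow> rel_interior (snd p) \<in> sets borel"
      using mcell_facts(2) by (auto simp: disjoint_interiors_def intro!: rel_interior_borel)
    have j: "jump D (snd r) i x = (\<Sum>p\<in>?J. (- snd r (fst p) (snd p)) * indicator (rel_interior (snd p)) x)" for x
    proof -
      have "jump D (snd r) i x = - (\<Sum>e\<in>?E. \<Sum>S\<in>mcells D e. snd r e S * indicator (rel_interior S) x)"
        by (simp add: jump_def P0_fun_def)
      also have "\<dots> = - (\<Sum>p\<in>?J. snd r (fst p) (snd p) * indicator (rel_interior (snd p)) x)"
        using fin(1) mcell_facts(1) by (subst sum.Sigma) (auto simp: split_def)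
      finally show ?thesis by (simp add: sum_negf)
    qed
    have d: "flat_div T (flux r i T) x = flat_div T (flux r i T) 0" for x
    proof (cases "1 \<le> sdim D i")
      case True show ?thesis by (rule flat_div_const[OF Vh_RT0[OF fr i True]])
    next
      case False
      then have "flux r i T = 0" using Vh_0[OF fr] by blast
      then show ?thesis by (simp only: flat_div_0)
    qed
    have ci: "set_integrable (flat_measure T) T (\<lambda>x. flat_div T (flux r i T) 0)"
      using flat_set_integrable[OF Tf(1,2) cell_compact[OF i]] by simp
    note fi = finite_sum_indicator_integral[OF Tf fin(2) b, where c="\<lambda>p. - snd r (fst p) (snd p)"]
    have fi1: "(LINT x:T|flat_measure T. (\<Sum>p\<in>?J. (- snd r (fst p) (snd p)) * indicator (rel_interior (snd p)) x)) =
       (\<Sum>p\<in>?J. (- snd r (fst p) (snd p)) * mortar_area T (snd p))"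
      unfolding mortar_area_def by (rule fi(1))
    have "(LINT x:T|flat_measure T. q i T * (flat_div T (flux r i T) x + jump D (snd r) i x)) =
       q i T * ((LINT x:T|flat_measure T. flat_div T (flux r i T) 0) +
         (LINT x:T|flat_measure T. (\<Sum>p\<in>?J. (- snd r (fst p) (snd p)) * indicator (rel_interior (snd p)) x)))"
    proof -
      have "flat_div T (flux r i T) x + jump D (snd r) i x = flat_div T (flux r i T) 0 +
          (\<Sum>p\<in>?J. (- snd r (fst p) (snd p)) * indicator (rel_interior (snd p)) x)" for x
        by (simp only: d[of x] j)
      then show ?thesis
        by (simp only: set_integral_mult_right set_integral_add(2)[OF ci fi(2)])
    qed
    also have "(LINT x:T|flat_measure T. flat_div T (flux r i T) 0) = flat_div T (flux r i T) 0 * measure (flat_measure T) T"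
      using Tf flat_bounded_finite[OF Tf] by (simp add: set_lebesgue_integral_def)
    also have "\<dots> = (\<Sum>f\<in>{f. f facet_of T}. normal_comp (flux r i T) T f * facet_flux T f)" by (rule flux_div[OF i fr])
    also have "(LINT x:T|flat_measure T. (\<Sum>p\<in>?J. (- snd r (fst p) (snd p)) * indicator (rel_interior (snd p)) x)) =
       - (\<Sum>p\<in>?J. snd r (fst p) (snd p) * mortar_area T (snd p))" unfolding fi1 by (simp add: sum_negf)
    also have "(\<Sum>p\<in>?J. snd r (fst p) (snd p) * mortar_area T (snd p)) = (\<Sum>e\<in>?E. \<Sum>S\<in>mcells D e. snd r e S * mortar_area T S)"
      using fin(1) mcell_facts(1) by (subst sum.Sigma) (auto simp: split_def)
    finally show ?thesis by simp
  qed
  moreover have "fst r + R_h D (snd r) = flux r" by (simp only: flux_def)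
  ultimately show ?thesis
    unfolding form_b_def split_beta by (intro arg_cong[where f=uminus] sum.cong refl) simp
qed

lemma form_b_add: assumes "r \<in> Wh D" "r' \<in> Wh D" shows "form_b D (r + r') q = form_b D r q + form_b D r' q"
proof -
  have w: "r + r' \<in> Wh D" using pscale.subspace_add[OF Wh_subspace assms] .
  have n: "normal_comp (flux (r + r') i T) T f = normal_comp (flux r i T) T f + normal_comp (flux r' i T) T f"
    if "i \<in> subs D" "T \<in> cells D i" "f facet_of T" for i T f
    unfolding flux_add by (rule Vh_normal_add[OF flux_Vh[OF assms(1)] flux_Vh[OF assms(2)] that])
  have 1: "(\<Sum>f\<in>{f. f facet_of T}. normal_comp (flux (r + r') i T) T f * facet_flux T f) =
     (\<Sum>f\<in>{f. f facet_of T}. normal_comp (flux r i T) T f * facet_flux T f) + (\<Sum>f\<in>{f. f facet_of T}. normal_comp (flux r' i T) T f * facet_flux T f)"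
    if "i \<in> subs D" "T \<in> cells D i" for i T
    unfolding sum.distrib[symmetric] by (intro sum.cong refl) (simp add: n[OF that] distrib_right)
  have 2: "(\<Sum>e\<in>E. \<Sum>S\<in>mcells D e. snd (r + r') e S * mortar_area T S) = (\<Sum>e\<in>E. \<Sum>S\<in>mcells D e. snd r e S * mortar_area T S) + (\<Sum>e\<in>E. \<Sum>S\<in>mcells D e. snd r' e S * mortar_area T S)" for E T
    by (simp add: sum.distrib algebra_simps)
  have aux: "k * ((a + a') - (b + b')) = k * (a - b) + k * (a' - b')" for k a a' b b' :: real
    by (simp add: algebra_simps)
  show ?thesis
    unfolding form_b_eq[OF w] form_b_eq[OF assms(1)] form_b_eq[OF assms(2)] minus_add_distrib[symmetric] sum.distrib[symmetric]
  proof (intro arg_cong[where f=uminus] sum.cong refl)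
    fix i T assume h: "i \<in> subs D" "T \<in> cells D i"
    show "q i T * ((\<Sum>f\<in>{f. f facet_of T}. normal_comp (flux (r + r') i T) T f * facet_flux T f) - (\<Sum>e\<in>{e\<in>ifaces D. lower D e = i}. \<Sum>S\<in>mcells D e. snd (r + r') e S * mortar_area T S))
      = q i T * ((\<Sum>f\<in>{f. f facet_of T}. normal_comp (flux r i T) T f * facet_flux T f) - (\<Sum>e\<in>{e\<in>ifaces D. lower D e = i}. \<Sum>S\<in>mcells D e. snd r e S * mortar_area T S))
      + q i T * ((\<Sum>f\<in>{f. f facet_of T}. normal_comp (flux r' i T) T f * facet_flux T f) - (\<Sum>e\<in>{e\<in>ifaces D. lower D e = i}. \<Sum>S\<in>mcells D e. snd r' e S * mortar_area T S))"
      unfolding 1[OF h] 2 by (rule aux)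
  qed
qed

lemma form_b_scale: assumes "r \<in> Wh D" shows "form_b D (pscale c r) q = c * form_b D r q"
proof -
  have w: "pscale c r \<in> Wh D" using pscale.subspace_scale[OF Wh_subspace assms] .
  have 1: "(\<Sum>f\<in>{f. f facet_of T}. normal_comp (flux (pscale c r) i T) T f * facet_flux T f) = c * (\<Sum>f\<in>{f. f facet_of T}. normal_comp (flux r i T) T f * facet_flux T f)"
    if "i \<in> subs D" "T \<in> cells D i" for i T
    unfolding flux_scale sum_distrib_left using Vh_normal_scale[OF flux_Vh[OF assms] that] by (intro sum.cong refl) simp
  have 2: "(\<Sum>e\<in>E. \<Sum>S\<in>mcells D e. snd (pscale c r) e S * mortar_area T S) = c * (\<Sum>e\<in>E. \<Sum>S\<in>mcells D e. snd r e S * mortar_area T S)" for E T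
    by (simp add: pscale_def sum_distrib_left mult.assoc)
  have aux: "k * (c * a - c * b) = c * (k * (a - b))" for k a b :: real by (simp add: algebra_simps)
  have "(\<Sum>i\<in>subs D. \<Sum>T\<in>cells D i. q i T * ((\<Sum>f\<in>{f. f facet_of T}. normal_comp (flux (pscale c r) i T) T f * facet_flux T f) - (\<Sum>e\<in>{e\<in>ifaces D. lower D e = i}. \<Sum>S\<in>mcells D e. snd (pscale c r) e S * mortar_area T S)))
    = (\<Sum>i\<in>subs D. \<Sum>T\<in>cells D i. c * (q i T * ((\<Sum>f\<in>{f. f facet_of T}. normal_comp (flux r i T) T f * facet_flux T f) - (\<Sum>e\<in>{e\<in>ifaces D. lower D e = i}. \<Sum>S\<in>mcells D e. snd r e S * mortar_area T S))))"
    by (intro sum.cong refl) (simp only: 1 2 aux)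
  then show ?thesis
    unfolding form_b_eq[OF w] form_b_eq[OF assms] by (simp flip: sum_distrib_left)
qed

lemma form_b_neg: assumes "r \<in> Wh D" shows "form_b D r (\<lambda>i T. - q i T) = - form_b D r q"
  unfolding form_b_eq[OF assms] by (simp add: sum_negf)

lemma grad_unique: "\<exists>!w. w \<in> Wh D \<and> (\<forall>r\<in>Wh D. form_aD D w r = form_b D r q)"
proof -
  interpret d: psd_form pscale "Wh D" "form_aD D" by (rule form_aD_psd)
  obtain S where "finite S" "Wh D \<subseteq> pscale.span S" using Wh_finite by blast
  then show ?thesis by (rule d.representer[OF _ _ form_aD_definite form_b_add form_b_scale])
qed

lemma grad_facts: "grad_h D q \<in> Wh D" "r \<in> Wh D \<Longrightarrow> form_aD D (grad_h D q) r = form_b D r q"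
  using theI'[OF grad_unique[of q]] unfolding grad_h_def by blast+

lemma grad_neg: "grad_h D (\<lambda>i T. - q i T) = pscale (-1) (grad_h D q)"
proof -
  interpret d: psd_form pscale "Wh D" "form_aD D" by (rule form_aD_psd)
  have "pscale (-1) (grad_h D q) \<in> Wh D" using pscale.subspace_scale[OF Wh_subspace grad_facts(1)] .
  moreover have "form_aD D (pscale (-1) (grad_h D q)) r = form_b D r (\<lambda>i T. - q i T)" if "r \<in> Wh D" for r
    by (simp only: d.scale_left[OF grad_facts(1) that] grad_facts(2)[OF that] form_b_neg[OF that] mult_minus1)
  ultimately show ?thesis unfolding grad_h_def by (intro the1_equality[OF grad_unique]) blast
qed

lemma flux_of_V0h:
  assumes 1: "\<And>i T T' f. \<lbrakk>i \<in> subs D; T \<in> cells D i; T' \<in> cells D i; T \<noteq> T'; f facet_of T; f facet_of T'; rel_interior f \<subseteq> sdom D i\<rbrakk>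
       \<Longrightarrow> c i T f + c i T' f = 0"
    and 2: "\<And>i T f. \<lbrakk>i \<in> subs D; T \<in> cells D i; f facet_of T; \<not> on_iface D i T f; rel_interior f \<subseteq> bdryN D\<rbrakk> \<Longrightarrow> c i T f = 0"
    and 3: "\<And>i T f. \<lbrakk>i \<in> subs D; on_iface D i T f\<rbrakk> \<Longrightarrow> c i T f = 0"
  shows "flux_of D c \<in> V0h D"
proof -
  have "flux_of D c \<in> Vh D" by (rule flux_of_Vh) (fact 1, fact 2)
  moreover have "normal_comp (flux_of D c i T) T f = 0" if "i \<in> subs D" "T \<in> cells D i" "on_iface D i T f" for i T f
    using normal_comp_flux_of[OF that(1,2)] on_iface_facet[OF that(3)] 3[OF that(1,3)] by simp
  ultimately show ?thesis unfolding V0h_def by blast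
qed

lemma form_b_flux_test:
  assumes c: "flux_of D c \<in> V0h D"
  shows "(flux_of D c, 0) \<in> Wh D" "form_b D (flux_of D c, 0) q = - (\<Sum>i\<in>subs D. \<Sum>T\<in>cells D i. q i T * (\<Sum>f\<in>{f. f facet_of T}. c i T f * facet_flux T f))"
proof -
  show w: "(flux_of D c, 0) \<in> Wh D" using c by (simp add: Wh_iff Lh_def)
  have f: "flux (flux_of D c, 0) = flux_of D c" unfolding flux_def by (simp only: fst_conv snd_conv R_h_0 add_0_right)
  show "form_b D (flux_of D c, 0) q = - (\<Sum>i\<in>subs D. \<Sum>T\<in>cells D i. q i T * (\<Sum>f\<in>{f. f facet_of T}. c i T f * facet_flux T f))"
    unfolding form_b_eq[OF w] f by (intro arg_cong[where f=uminus] sum.cong refl) (simp add: normal_comp_flux_of)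
qed

lemma delta_sum:
  assumes i: "i0 \<in> subs D" "T0 \<in> cells D i0" "f0 facet_of T0"
  shows "(\<Sum>i\<in>subs D. \<Sum>T\<in>cells D i. q i T * (\<Sum>f\<in>{f. f facet_of T}. (if i = i0 \<and> T = T0 \<and> f = f0 then k else 0) * facet_flux T f)) = k * (q i0 T0 * facet_flux T0 f0)"
proof -
  note fin = finite_cell_facets[OF i(1,2)]
  have "(\<Sum>i\<in>subs D. \<Sum>T\<in>cells D i. q i T * (\<Sum>f\<in>{f. f facet_of T}. (if i = i0 \<and> T = T0 \<and> f = f0 then k else 0) * facet_flux T f)) =
    (\<Sum>i\<in>subs D. if i = i0 then \<Sum>T\<in>cells D i0. if T = T0 then q i0 T0 * (\<Sum>f\<in>{f. f facet_of T0}. if f = f0 then k * facet_flux T0 f0 else 0) else 0 else 0)"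
    by (intro sum.cong refl) (auto intro!: sum.cong sum.neutral)
  also have "\<dots> = q i0 T0 * (k * facet_flux T0 f0)" using i fin finite_subs cell_finite by simp
  finally show ?thesis by simp
qed

context
  fixes q :: "'a pwconst"
  assumes ker: "\<And>r. r \<in> Wh D \<Longrightarrow> form_b D r q = 0"
begin

text \<open>The test flux enters \<open>T1\<close> from \<open>T0\<close> with unit normal component through their common facet.  Since both cells see the same
\<open>facet_flux\<close>, the form \<open>b\<close> measures the jump of \<open>q\<close>.\<close>

lemma ker_interior:
  assumes i: "i0 \<in> subs D" "T0 \<in> cells D i0" "T1 \<in> cells D i0" "T0 \<noteq> T1" "f0 facet_of T0" "f0 facet_of T1" "rel_interior f0 \<subseteq> sdom D i0"
    and N: "rel_interior f0 \<inter> bdryN D = {}"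
  shows "q i0 T0 = q i0 T1"
proof -
  let ?ca = "\<lambda>i T f. if i = i0 \<and> T = T0 \<and> f = f0 then 1 else (0::real)"
  let ?cb = "\<lambda>i T f. if i = i0 \<and> T = T1 \<and> f = f0 then -1 else (0::real)"
  let ?c = "\<lambda>i T f. ?ca i T f + ?cb i T f"
  have ne: "rel_interior f0 \<noteq> {}" using facet_interior_ne[OF i(5)] .
  have "flux_of D ?c \<in> V0h D"
  proof (rule flux_of_V0h)
    fix i T T' f assume h: "i \<in> subs D" "T \<in> cells D i" "T' \<in> cells D i" "T \<noteq> T'" "f facet_of T" "f facet_of T'" "rel_interior f \<subseteq> sdom D i"
    show "?c i T f + ?c i T' f = 0"
    proof (cases "i = i0 \<and> f = f0")
      case True
      have "T = T0 \<or> T = T1" "T' = T0 \<or> T' = T1"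
        using at_most_two_cells[OF i(1,2,5,3,6) _ _ i(4)] h True by blast+
      then show ?thesis using h(4) i(4) True by auto
    qed auto
  next
    fix i T f assume "rel_interior f \<subseteq> bdryN D"
    then show "?c i T f = 0" using N ne by auto
  next
    fix i T f assume "i \<in> subs D" "on_iface D i T f"
    then show "?c i T f = 0" using on_iface_not_inside[of i T f] i(7) ne by auto
  qed
  note t = form_b_flux_test[OF this]
  have "(\<Sum>i\<in>subs D. \<Sum>T\<in>cells D i. q i T * (\<Sum>f\<in>{f. f facet_of T}. ?c i T f * facet_flux T f)) =
     (\<Sum>i\<in>subs D. \<Sum>T\<in>cells D i. q i T * (\<Sum>f\<in>{f. f facet_of T}. ?ca i T f * facet_flux T f)) +
     (\<Sum>i\<in>subs D. \<Sum>T\<in>cells D i. q i T * (\<Sum>f\<in>{f. f facet_of T}. ?cb i T f * facet_flux T f))"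
    unfolding distrib_right distrib_left sum.distrib ..
  also have "\<dots> = 1 * (q i0 T0 * facet_flux T0 f0) + (-1) * (q i0 T1 * facet_flux T1 f0)"
    unfolding delta_sum[OF i(1,2,5)] delta_sum[OF i(1,3,6)] ..
  finally have "q i0 T0 * facet_flux T0 f0 = q i0 T1 * facet_flux T1 f0" using ker[OF t(1)] t(2)[of q] by simp
  then show ?thesis using facet_flux_eq[OF i(1,2,3,5,6)] facet_flux_pos[OF i(1,2,5)] by simp
qed

text \<open>No constraint of the flux space concerns a facet on the Dirichlet boundary, so a flux through this facet alone is admissible.\<close>

lemma ker_dirichlet:
  assumes i: "i0 \<in> subs D" "T0 \<in> cells D i0" "f0 facet_of T0" "\<not> on_iface D i0 T0 f0"
    and N: "rel_interior f0 \<inter> bdryN D = {}" "\<And>i. i \<in> subs D \<Longrightarrow> rel_interior f0 \<inter> sdom D i = {}"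
  shows "q i0 T0 = 0"
proof -
  let ?c = "\<lambda>i T f. if i = i0 \<and> T = T0 \<and> f = f0 then 1 else (0::real)"
  have ne: "rel_interior f0 \<noteq> {}" using facet_interior_ne[OF i(3)] .
  have "flux_of D ?c \<in> V0h D"
  proof (rule flux_of_V0h)
    fix i T T' f assume h: "i \<in> subs D" "rel_interior f \<subseteq> sdom D i"
    then show "?c i T f + ?c i T' f = 0" using N(2)[OF h(1)] ne by auto
  next
    fix i T f assume "rel_interior f \<subseteq> bdryN D"
    then show "?c i T f = 0" using N ne by auto
  next
    fix i T f assume "on_iface D i T f"
    then show "?c i T f = 0" using i(4) by auto
  qed
  note t = form_b_flux_test[OF this]
  have "1 * (q i0 T0 * facet_flux T0 f0) = 0" using ker[OF t(1)] t(2)[of q] unfolding delta_sum[OF i(1-3)] by simp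
  then show ?thesis using facet_flux_pos[OF i(1-3)] by simp
qed

end

end

section \<open>Connectivity of the mesh and the Dirichlet boundary\<close>

lemma polyhedron_facet_through:
  assumes "polyhedron S" "x \<in> S" "x \<notin> rel_interior S"
  obtains f where "f facet_of S" "x \<in> f"
proof -
  have "x \<in> rel_frontier S" using assms closure_subset by (auto simp: rel_frontier_def)
  then have "x \<in> \<Union>{F. F facet_of S}" using rel_frontier_of_polyhedron[OF assms(1)] by simp
  then show ?thesis using that by blast
qed

context fractured_disc
begin

lemma Omega_open: "open (Omega D)" and bdry: "bdryD D \<union> bdryN D = frontier (Omega D)" "bdryD D \<inter> bdryN D = {}"
  using med by (auto simp: fractured_medium_def)

lemma sub_Omega: "i \<in> subs D \<Longrightarrow> sdom D i \<subseteq> Omega D" by (auto simp: Omega_def)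

lemma bdry_not_Omega: "x \<in> bdryD D \<union> bdryN D \<Longrightarrow> x \<notin> Omega D"
  using bdry(1) Omega_open by (metis Diff_iff frontier_def interior_open)

text \<open>By the mesh condition a facet is wholly inside the subdomain, on an interface or on the outer boundary.  A single inner
point therefore decides.\<close>

lemma facet_inside:
  assumes i: "i \<in> subs D" "T \<in> cells D i" "f facet_of T" and z: "z \<in> rel_interior f" "z \<in> sdom D i"
  shows "rel_interior f \<subseteq> sdom D i"
proof -
  have "\<not> on_iface D i T f" using on_iface_not_inside[OF i(1)] z by blast
  moreover have "z \<notin> bdryD D" "z \<notin> bdryN D" using bdry_not_Omega sub_Omega[OF i(1)] z(2) by blast+
  ultimately show ?thesis using facet_cases[OF i] z(1) by blast
qed

lemma cell_polyhedron: "i \<in> subs D \<Longrightarrow> T \<in> cells D i \<Longrightarrow> polyhedron T"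
  using cell_simplex simplex_imp_polyhedron by blast

lemma cell_interior_ne: "i \<in> subs D \<Longrightarrow> T \<in> cells D i \<Longrightarrow> rel_interior T \<noteq> {}"
  using cell_convex cell_ne rel_interior_eq_empty by blast

lemma cell_interior_open: "i \<in> subs D \<Longrightarrow> T \<in> cells D i \<Longrightarrow> openin (top_of_set (affine hull (sdom D i))) (rel_interior T)"
  using openin_rel_interior[of T] cell_hull by metis

lemma cell_closure_interior: "i \<in> subs D \<Longrightarrow> T \<in> cells D i \<Longrightarrow> closure (rel_interior T) = T"
  using cell_convex convex_closure_rel_interior cell_compact compact_imp_closed closure_closed by metis

text \<open>The exceptional set: a segment that avoids it passes from one cell to another through the relative interior of a facet.\<close>

definition low_faces :: "nat \<Rightarrow> nat \<Rightarrow> 'a set set" where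
  "low_faces i d = {g. \<exists>T\<in>cells D i. g face_of T \<and> aff_dim g \<le> int d - 2}"

lemma finite_low_faces: assumes "i \<in> subs D" shows "finite (low_faces i d)"
proof (rule finite_subset)
  show "low_faces i d \<subseteq> (\<Union>T\<in>cells D i. {g. g face_of T})" by (auto simp: low_faces_def)
  show "finite (\<Union>T\<in>cells D i. {g. g face_of T})"
    using cell_finite[OF assms] cell_simplex[OF assms] simplex_imp_polytope finite_polytope_faces by blast
qed

text \<open>The intersection of two cells is a common face of them.  A point on no face of codimension two forces its dimension up to
that of a facet, and lies in the relative interior of this facet.\<close>

lemma cells_common_facet:
  assumes i: "i \<in> subs D" and T: "T \<in> cells D i" "T' \<in> cells D i" "T \<noteq> T'" and z: "z \<in> T" "z \<in> T'" "z \<in> sdom D i"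
    and gen: "\<And>g. g \<in> low_faces i (sdim D i) \<Longrightarrow> z \<notin> g"
  shows "\<exists>f. f facet_of T \<and> f facet_of T' \<and> rel_interior f \<subseteq> sdom D i"
proof -
  let ?f = "T \<inter> T'"
  have I: "?f face_of T" "?f face_of T'" using cell_face[OF i T(1,2)] cell_face[OF i T(2,1)] by (simp_all add: Int_commute)
  note dim = cell_dim[OF i T(1)] cell_dim[OF i T(2)]
  have lt: "aff_dim ?f < int (sdim D i)"
  proof (rule ccontr)
    assume "\<not> aff_dim ?f < int (sdim D i)"
    then have "?f = T" "?f = T'"
      using face_of_aff_dim_lt[OF cell_convex[OF i T(1)] I(1)] face_of_aff_dim_lt[OF cell_convex[OF i T(2)] I(2)] dim by auto
    then show False using T(3) by blast
  qed
  have "?f \<notin> low_faces i (sdim D i)" using gen z by blast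
  then have "aff_dim ?f = int (sdim D i) - 1" using I(1) T(1) lt unfolding low_faces_def by fastforce
  moreover have "?f \<noteq> {}" using z by blast
  ultimately have facet: "?f facet_of T" "?f facet_of T'" using I dim by (auto simp: facet_of_def)
  have "z \<in> rel_interior ?f"
  proof (rule ccontr)
    assume "z \<notin> rel_interior ?f"
    moreover have "polyhedron ?f" using cell_polyhedron[OF i] T by simp
    ultimately obtain g where g: "g facet_of ?f" "z \<in> g" using polyhedron_facet_through[of ?f z] z by blast
    have "g face_of T" using g(1) I(1) face_of_trans by (auto simp: facet_of_def)
    moreover have "aff_dim g \<le> int (sdim D i) - 2" using g(1) lt by (auto simp: facet_of_def)
    ultimately have "g \<in> low_faces i (sdim D i)" using T(1) unfolding low_faces_def by blast
    then show False using gen g(2) by blast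
  qed
  then have "rel_interior ?f \<subseteq> sdom D i" by (rule facet_inside[OF i T(1) facet(1) _ z(3)])
  then show ?thesis using facet by blast
qed

text \<open>Stated for the affine hulls of arbitrary sets of lower dimension, so that it also serves for cones over low-dimensional faces.\<close>

lemma generic_point:
  assumes i: "i \<in> subs D" and U: "openin (top_of_set (affine hull (sdom D i))) U" "U \<noteq> {}"
    and A: "finite \<A>" "\<And>A. A \<in> \<A> \<Longrightarrow> aff_dim A < int (sdim D i)"
  obtains y where "y \<in> U" "\<And>A. A \<in> \<A> \<Longrightarrow> y \<notin> affine hull A"
proof -
  obtain y where "y \<in> U" "\<And>A. A \<in> (hull) affine ` \<A> \<Longrightarrow> y \<notin> A"
    by (rule avoid_affine[OF sub_ne[OF i] sub_dim3[OF i] U, of "(hull) affine ` \<A>"])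
      (use A sub_dim[OF i] in auto)
  then show ?thesis using that by blast
qed

text \<open>Both unions are closed and the subdomain is connected, so cells \<open>T1\<close> and \<open>T2\<close> of the two classes meet at some point
\<open>x\<close> of the subdomain.  Within a small ball around \<open>x\<close>, interior points of \<open>T1\<close> and \<open>T2\<close> can be joined by a segment
that avoids all faces of codimension two, since the endpoints that are excluded lie in finitely many proper affine subspaces.
The segment is connected too; where it passes from one class to the other, two cells share a point that is on no face of
codimension two, hence share a facet.\<close>

lemma cells_chain:
  assumes i: "i \<in> subs D" and AB: "A \<union> B = cells D i" "A \<noteq> {}" "B \<noteq> {}" "A \<inter> B = {}"
  shows "\<exists>T\<in>A. \<exists>T'\<in>B. \<exists>f. f facet_of T \<and> f facet_of T' \<and> rel_interior f \<subseteq> sdom D i"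
proof -
  let ?N = "low_faces i (sdim D i)"
  have finA: "finite A" "finite B" using cell_finite[OF i] AB(1) by (metis finite_Un)+
  have cl: "closed (\<Union>A)" "closed (\<Union>B)"
    using finA AB(1) cell_compact[OF i] compact_imp_closed by (auto intro!: closed_Union)
  have "\<Union>A \<union> \<Union>B = closure (sdom D i)" unfolding cell_union[OF i, symmetric] AB(1)[symmetric] by blast
  then have cov: "sdom D i \<subseteq> \<Union>A \<union> \<Union>B" using closure_subset[of "sdom D i"] by simp
  have meets: "\<Union>E \<inter> sdom D i \<noteq> {}" if E: "E \<subseteq> cells D i" "E \<noteq> {}" for E
  proof -
    obtain T where T: "T \<in> E" "T \<in> cells D i" using E by blast
    obtain y where "y \<in> rel_interior T" using cell_interior_ne[OF i T(2)] by blast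
    then have "y \<in> T" "y \<in> sdom D i" using cell_interior[OF i T(2)] rel_interior_subset by blast+
    then show ?thesis using T(1) by blast
  qed
  have "\<Union>A \<inter> sdom D i \<noteq> {}" "\<Union>B \<inter> sdom D i \<noteq> {}" by (rule meets; use AB in blast)+
  then have "\<Union>A \<inter> \<Union>B \<inter> sdom D i \<noteq> {}"
    using connected_closedD[OF sub_connected[OF i] _ cov cl] by metis
  then obtain x T1 T2 where x: "x \<in> sdom D i" "T1 \<in> A" "x \<in> T1" "T2 \<in> B" "x \<in> T2" by blast
  have T12: "T1 \<in> cells D i" "T2 \<in> cells D i" using x AB by auto
  obtain W where W: "open W" "sdom D i = affine hull (sdom D i) \<inter> W" using sub_open[OF i] by (auto simp: openin_open)
  then obtain \<epsilon> where \<epsilon>: "0 < \<epsilon>" "ball x \<epsilon> \<subseteq> W" using x(1) open_contains_ball by blast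
  \<comment> \<open>a convex neighbourhood of \<open>x\<close> in the subdomain, so that segments stay inside\<close>
  let ?X = "affine hull (sdom D i) \<inter> ball x \<epsilon>"
  have X: "convex ?X" "?X \<subseteq> sdom D i"
    using \<epsilon>(2) W(2) affine_imp_convex[OF affine_affine_hull] by (auto intro!: convex_Int)
  have op: "openin (top_of_set (affine hull (sdom D i))) (rel_interior T \<inter> ?X)" "rel_interior T \<inter> ?X \<noteq> {}"
    if T: "T \<in> cells D i" "x \<in> T" for T
  proof -
    show "openin (top_of_set (affine hull (sdom D i))) (rel_interior T \<inter> ?X)"
      by (intro openin_Int cell_interior_open[OF i T(1)] openin_open_Int open_ball)
    have "x \<in> closure (rel_interior T)" using cell_closure_interior[OF i T(1)] T(2) by simp
    then obtain y where "y \<in> rel_interior T" "y \<in> ball x \<epsilon>"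
      using \<epsilon>(1) unfolding closure_approachable by (metis dist_commute mem_ball)
    then show "rel_interior T \<inter> ?X \<noteq> {}"
      using cell_interior[OF i T(1)] hull_subset[of "sdom D i" affine] by blast
  qed
  have low: "finite ?N" "\<And>g. g \<in> ?N \<Longrightarrow> aff_dim g < int (sdim D i)"
    using finite_low_faces[OF i] by (auto simp: low_faces_def)
  \<comment> \<open>\<open>y'\<close> avoids the low faces, \<open>y\<close> their cones with apex \<open>y'\<close>; the cones still have positive codimension\<close>
  obtain y' where y': "y' \<in> rel_interior T2 \<inter> ?X" "\<And>g. g \<in> ?N \<Longrightarrow> y' \<notin> affine hull g"
    using generic_point[OF i op[OF T12(2) x(5)] low] by blast
  have low': "finite (insert y' ` ?N)" "\<And>g. g \<in> insert y' ` ?N \<Longrightarrow> aff_dim g < int (sdim D i)"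
    using low(1) by (auto simp: aff_dim_insert low_faces_def)
  obtain y where y: "y \<in> rel_interior T1 \<inter> ?X" "\<And>g. g \<in> insert y' ` ?N \<Longrightarrow> y \<notin> affine hull g"
    using generic_point[OF i op[OF T12(1) x(3)] low'] by blast
  let ?s = "closed_segment y y'"
  have s: "?s \<subseteq> sdom D i" using y(1) y'(1) X closed_segment_subset[of y ?X y'] by blast
  have "y \<in> \<Union>A" "y' \<in> \<Union>B" using y(1) y'(1) x rel_interior_subset by blast+
  then have "\<Union>A \<inter> ?s \<noteq> {}" "\<Union>B \<inter> ?s \<noteq> {}" using ends_in_segment[of y y'] by blast+
  moreover have "?s \<subseteq> \<Union>A \<union> \<Union>B" by (rule order_trans[OF s cov])
  ultimately have "\<Union>A \<inter> \<Union>B \<inter> ?s \<noteq> {}"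
    using connected_closedD[OF connected_segment(1)[of y y'], of "\<Union>A" "\<Union>B"] cl by metis
  then obtain z T3 T4 where z: "z \<in> ?s" "T3 \<in> A" "z \<in> T3" "T4 \<in> B" "z \<in> T4" by blast
  \<comment> \<open>a point \<open>z \<noteq> y'\<close> of the segment on a low face would put \<open>y\<close> on the cone over this face\<close>
  have gen: "z \<notin> g" if g: "g \<in> ?N" for g
  proof
    assume zg: "z \<in> g"
    obtain t where t: "z = (1 - t) *\<^sub>R y + t *\<^sub>R y'" using z(1) by (auto simp: closed_segment_def)
    show False
    proof (cases "t = 1")
      case True
      then have "y' \<in> g" using t zg by simp
      then show False using y'(2)[OF g] by (simp add: hull_inc)
    next
      case False
      have m: "z \<in> affine hull (insert y' g)" "y' \<in> affine hull (insert y' g)" using zg by (simp_all add: hull_inc)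
      have one: "1 / (1 - t) + (- t / (1 - t)) = 1" using False by (simp add: diff_divide_distrib[symmetric])
      have "(1 / (1 - t)) *\<^sub>R z + (- t / (1 - t)) *\<^sub>R y' \<in> affine hull (insert y' g)"
        by (rule mem_affine[OF affine_affine_hull m one])
      also have "(1 / (1 - t)) *\<^sub>R z + (- t / (1 - t)) *\<^sub>R y' = y"
        using False unfolding t by (simp add: scaleR_add_right flip: scaleR_add_left)
      finally show False using y(2)[of "insert y' g"] g by blast
    qed
  qed
  have "T3 \<noteq> T4" "T3 \<in> cells D i" "T4 \<in> cells D i" using z AB by auto
  then show ?thesis using cells_common_facet[OF i _ _ _ z(3,5) _ gen] s z by blast
qed

text \<open>If there were no such facet, the Dirichlet boundary would consist of points on faces of dimension at most \<open>n - 2\<close>: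
a point of the boundary of \<open>Omega\<close> lies on a facet of an \<open>n\<close>-dimensional cell, and when this facet lies on a fracture,
the point belongs to the relative boundary of a cell of the fracture, because the fracture itself is part of the open set
\<open>Omega\<close>.  Finitely many such faces are null sets within a hyperplane, contrary to the positive measure of the Dirichlet
boundary.\<close>

lemma dirichlet_facet:
  shows "\<exists>i\<in>subs D. \<exists>T\<in>cells D i. \<exists>f. f facet_of T \<and> rel_interior f \<subseteq> bdryD D \<and> \<not> on_iface D i T f"
proof (rule ccontr)
  assume no: "\<not> ?thesis"
  let ?n = "DIM('a)"
  obtain H where H: "affine H" "aff_dim H = int ?n - 1" "0 < emeasure (flat_measure H) (bdryD D \<inter> H)"
    using med by (auto simp: fractured_medium_def)
  have n: "2 \<le> ?n" "?n \<le> 3" using dimA by auto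
  have Hne: "H \<noteq> {}" "aff_dim H \<le> 3" using H(2) n by auto
  let ?\<A> = "\<Union>i\<in>subs D. (hull) affine ` low_faces i ?n"
  have fin: "finite ?\<A>" using finite_subs finite_low_faces by auto
  have cover: "bdryD D \<inter> H \<subseteq> \<Union>?\<A>"
  proof
    fix x assume "x \<in> bdryD D \<inter> H"
    then have xD: "x \<in> bdryD D" by blast
    then have xO: "x \<notin> Omega D" "x \<in> closure (Omega D)" using bdry_not_Omega bdry(1) by (auto simp: frontier_def)
    have low: "x \<in> \<Union>?\<A>" if "i \<in> subs D" "T \<in> cells D i" "g face_of T" "aff_dim g \<le> int ?n - 2" "x \<in> g" for i T g
    proof -
      have "g \<in> low_faces i ?n" using that unfolding low_faces_def by blast
      then show ?thesis using that(1) hull_inc[OF that(5), of affine] by blast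
    qed
    \<comment> \<open>the open set \<open>Omega\<close> has points near \<open>x\<close> off all lower-dimensional subdomains\<close>
    have "x \<in> closure (\<Union>i\<in>{i\<in>subs D. sdim D i = ?n}. sdom D i)"
      unfolding closure_iff_nhds_not_empty
    proof (intro allI impI)
      fix V W assume W: "W \<subseteq> V" "open W" "x \<in> W"
      have ne: "W \<inter> Omega D \<noteq> {}" using xO(2) W unfolding closure_iff_nhds_not_empty by (metis Int_commute order_refl)
      have "finite ((\<lambda>i. affine hull (sdom D i)) ` {i\<in>subs D. sdim D i < ?n})" using finite_subs by simp
      then obtain y where y: "y \<in> W \<inter> Omega D" "\<And>A. A \<in> (\<lambda>i. affine hull (sdom D i)) ` {i\<in>subs D. sdim D i < ?n} \<Longrightarrow> y \<notin> A"
        by (rule avoid_affine[of UNIV "W \<inter> Omega D", rotated 4])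
          (use ne n W Omega_open sub_dim in \<open>auto simp: open_Int\<close>)
      then obtain i where i: "i \<in> subs D" "y \<in> sdom D i" by (auto simp: Omega_def)
      have "\<not> sdim D i < ?n" using y(2)[of "affine hull (sdom D i)"] i hull_inc[OF i(2), of affine] by blast
      moreover have "sdim D i \<le> ?n" using aff_dim_le_DIM[of "sdom D i"] sub_dim[OF i(1)] by simp
      ultimately show "(\<Union>i\<in>{i\<in>subs D. sdim D i = ?n}. sdom D i) \<inter> V \<noteq> {}" using i y(1) W(1) by auto
    qed
    moreover have "closure (\<Union>i\<in>{i\<in>subs D. sdim D i = ?n}. sdom D i) \<subseteq> (\<Union>i\<in>{i\<in>subs D. sdim D i = ?n}. closure (sdom D i))"
      using finite_subs by (intro closure_minimal UN_mono order.refl closure_subset closed_UN ballI closed_closure) simp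
    ultimately have "x \<in> (\<Union>i\<in>{i\<in>subs D. sdim D i = ?n}. closure (sdom D i))" by blast
    then obtain i T where i: "i \<in> subs D" "sdim D i = ?n" "T \<in> cells D i" "x \<in> T" using cell_union by blast
    have "x \<notin> rel_interior T" using cell_interior[OF i(1,3)] sub_Omega[OF i(1)] xO(1) by blast
    then obtain f where f: "f facet_of T" "x \<in> f" using polyhedron_facet_through[OF cell_polyhedron[OF i(1,3)] i(4)] by blast
    have fd: "aff_dim f = int ?n - 1" using f(1) cell_dim[OF i(1,3)] i(2) by (simp add: facet_of_def)
    show "x \<in> \<Union>?\<A>"
    proof (cases "x \<in> rel_interior f")
      case False
      have "polyhedron f" using f(1) face_of_polyhedron_polyhedron[OF cell_polyhedron[OF i(1,3)]] by (simp add: facet_of_def)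
      then obtain g where g: "g facet_of f" "x \<in> g" using polyhedron_facet_through[OF _ f(2) False] by blast
      have "g face_of T" using g(1) f(1) face_of_trans by (auto simp: facet_of_def)
      then show ?thesis using low[OF i(1,3) _ _ g(2)] g(1) fd by (simp add: facet_of_def)
    next
      case True
      \<comment> \<open>of the possible positions of a facet only the interface is left\<close>
      have "\<not> rel_interior f \<subseteq> sdom D i" using True xO(1) sub_Omega[OF i(1)] by blast
      moreover have "\<not> rel_interior f \<subseteq> bdryN D" using True xD bdry(2) by blast
      ultimately have "on_iface D i T f" using facet_cases[OF i(1,3) f(1)] no i(1,3) f(1) by blast
      then obtain e where e: "e \<in> ifaces D" "upper D e = i" "iface_facet D e T f" by (auto simp: on_iface_def)
      have l: "lower D e \<in> subs D" by (rule lower_sub[OF e(1)])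
      have "x \<in> closure (sdom D (lower D e))" using e(3) f(2) by (auto simp: iface_facet_def iface_dom_eq)
      then obtain S where S: "S \<in> cells D (lower D e)" "x \<in> S" using cell_union[OF l] by blast
      \<comment> \<open>an inner point of the fracture cell would lie in \<open>Omega\<close>\<close>
      have "x \<notin> rel_interior S" using cell_interior[OF l S(1)] sub_Omega[OF l] xO(1) by blast
      then obtain g where g: "g facet_of S" "x \<in> g" using polyhedron_facet_through[OF cell_polyhedron[OF l S(1)] S(2)] by blast
      have "aff_dim g = int ?n - 2" using g(1) cell_dim[OF l S(1)] upper_dim[OF e(1)] e(2) i(2) by (simp add: facet_of_def)
      then show ?thesis using low[OF l S(1) _ _ g(2)] g(1) by (simp add: facet_of_def)
    qed
  qed
  have "A \<in> null_sets (flat_measure H)" if A: "A \<in> ?\<A>" for A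
  proof -
    have "affine A" "aff_dim A \<le> int ?n - 2" using A by (auto simp: low_faces_def)
    moreover from this have "\<not> affine hull H \<subseteq> A" using aff_dim_subset[of "affine hull H" A] H(2) by auto
    ultimately show ?thesis using flat_affine_null[OF Hne, of A] by (auto simp: affine_closed borel_closed)
  qed
  then have null: "\<Union>?\<A> \<in> null_sets (flat_measure H)" by (intro null_sets.finite_Union[OF fin] subsetI)
  have "emeasure (flat_measure H) (bdryD D \<inter> H) \<le> emeasure (flat_measure H) (\<Union>?\<A>)"
    using cover null by (intro emeasure_mono) auto
  then show False using H(3) null by (simp add: null_setsD1)
qed

text \<open>The mortar mesh need not match the other meshes, but its cells are the closures of their relative interiors and cover
the interface, so one of them meets any given open piece in positive measure.\<close>

lemma overlap:
  assumes e: "e \<in> ifaces D" and U: "openin (top_of_set (affine hull (iface_dom D e))) U" "U \<noteq> {}" "U \<subseteq> iface_dom D e"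
  shows "\<exists>S\<in>mcells D e. 0 < measure (flat_measure (iface_dom D e)) (rel_interior S \<inter> U)"
proof -
  note mc = mcell_facts[OF e]
  obtain x where x: "x \<in> U" using U(2) by blast
  then obtain S where S: "S \<in> mcells D e" "x \<in> S" using U(3) mc(3) closure_subset by blast
  obtain W where W: "open W" "U = affine hull (iface_dom D e) \<inter> W" using U(1) by (auto simp: openin_open)
  have c: "closure (rel_interior S) = S"
    using mc(4)[OF S(1)] convex_closure_rel_interior convex_simplex closed_simplex closure_closed by metis
  have "rel_interior S \<inter> W \<noteq> {}" using c S(2) W x unfolding closure_iff_nhds_not_empty[of x] by (metis IntD2 closure_iff_nhds_not_empty order_refl)
  moreover have "rel_interior S \<subseteq> affine hull (iface_dom D e)" by (rule order_trans[OF mc(5)[OF S(1)] hull_subset])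
  ultimately have ne: "rel_interior S \<inter> U \<noteq> {}" using W(2) by blast
  have "openin (top_of_set (affine hull (iface_dom D e))) (rel_interior S \<inter> U)"
    using openin_rel_interior[of S] mc(6)[OF S(1)] U(1) by (simp add: openin_Int)
  moreover have "bounded (rel_interior S \<inter> U)" using iface_dom_facts(3)[OF e] U(3) bounded_subset by blast
  ultimately have "0 < measure (flat_measure (iface_dom D e)) (rel_interior S \<inter> U)"
    using open_measure_pos[OF iface_dom_facts(1,2)[OF e]] ne by blast
  then show ?thesis using S(1) by blast
qed

section \<open>Triviality of the kernel of the discrete gradient\<close>

context
  fixes q :: "'a pwconst"
  assumes ker: "\<And>r. r \<in> Wh D \<Longrightarrow> form_b D r q = 0"
begin

text \<open>Otherwise the cells with the value of \<open>T\<close> and the remaining ones would be two nonempty classes, and two cells from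
different classes would share a facet inside the subdomain, across which \<open>q\<close> cannot jump.\<close>

lemma ker_const:
  assumes i: "i \<in> subs D" "T \<in> cells D i" "T' \<in> cells D i" shows "q i T = q i T'"
proof (rule ccontr)
  assume ne: "q i T \<noteq> q i T'"
  let ?A = "{S\<in>cells D i. q i S = q i T}" and ?B = "{S\<in>cells D i. q i S \<noteq> q i T}"
  have "T \<in> ?A" "T' \<in> ?B" using i ne by auto
  then obtain S S' f where S: "S \<in> ?A" "S' \<in> ?B" "f facet_of S" "f facet_of S'" "rel_interior f \<subseteq> sdom D i"
    using cells_chain[OF i(1), of ?A ?B] by blast
  have "rel_interior f \<inter> bdryN D = {}" using S(5) sub_Omega[OF i(1)] bdry_not_Omega by blast
  then have "q i S = q i S'" using S by (intro ker_interior[OF ker i(1) _ _ _ S(3,4,5)]) auto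
  then show False using S by simp
qed

text \<open>The test function is the unit mortar \<open>\<mu>\<close> on the single interface \<open>e\<close>.  The divergence of its extension lives in
the upper subdomain and has a positive integral \<open>W\<close>; its jump lives in the lower subdomain and has integral
\<open>- M\<close> with \<open>M > 0\<close>.  As \<open>q\<close> takes constant values \<open>Qu\<close> and \<open>Ql\<close> there, \<open>b\<close> vanishes at the test function
only if \<open>Qu * W = Ql * M\<close>.  This carries the value zero across the interface.\<close>

lemma ker_iface:
  assumes e: "e \<in> ifaces D"
  shows "(\<forall>T\<in>cells D (upper D e). q (upper D e) T = 0) \<longleftrightarrow> (\<forall>T\<in>cells D (lower D e). q (lower D e) T = 0)"
proof -
  let ?u = "upper D e" and ?l = "lower D e"
  note u = upper_sub[OF e] note l = lower_sub[OF e]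
  have cne: "cells D i \<noteq> {}" if "i \<in> subs D" for i using cell_union[OF that] sub_ne[OF that] by (metis Union_empty closure_eq_empty)
  obtain Tu where Tu: "Tu \<in> cells D ?u" using cne[OF u] by blast
  obtain Tl where Tl: "Tl \<in> cells D ?l" using cne[OF l] by blast
  define Qu where "Qu = q ?u Tu"
  define Ql where "Ql = q ?l Tl"
  have Qu: "q ?u T = Qu" if "T \<in> cells D ?u" for T unfolding Qu_def by (rule ker_const[OF u that Tu])
  have Ql: "q ?l T = Ql" if "T \<in> cells D ?l" for T unfolding Ql_def by (rule ker_const[OF l that Tl])
  define \<mu> :: "'a pwconst" where "\<mu> = (\<lambda>e' S. if e' = e \<and> S \<in> mcells D e then 1 else 0)"
  have r: "(0, \<mu>) \<in> Wh D" using V0h_subspace(1) e by (auto simp: Wh_iff Lh_def \<mu>_def)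
  have fl: "flux (0, \<mu>) = extend (trace_average \<mu>)" unfolding flux_def by (simp only: fst_conv snd_conv R_h_eq add_0_left)
  let ?n = "\<lambda>i T f. normal_comp (extend (trace_average \<mu>) i T) T f"
  have trace_average_nonneg: "0 \<le> trace_average \<mu> e' f" for e' f
    using facet_area_pos[of e' f] by (auto simp: trace_average_def \<mu>_def cell_overlap_def intro!: divide_nonneg_pos sum_nonneg)
  have n0: "0 \<le> ?n i T f" if "i \<in> subs D" "T \<in> cells D i" "f facet_of T" for i T f
    unfolding normal_extend[OF that] using trace_average_nonneg by simp
  have nz: "?n i T f = 0" if h: "i \<in> subs D" "T \<in> cells D i" "f facet_of T" "i \<noteq> ?u" for i T f
  proof (cases "on_iface D i T f")
    case True
    then obtain e' where e': "e' \<in> ifaces D" "upper D e' = i" "iface_facet D e' T f" by (auto simp: on_iface_def)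
    then have "e' \<noteq> e" using h(4) by blast
    then show ?thesis using normal_extend_iface[OF e'(1,3), of "trace_average \<mu>"] e'(2) by (simp add: trace_average_def \<mu>_def)
  qed (simp add: normal_extend[OF h(1-3)])
  define W where "W = (\<Sum>T\<in>cells D ?u. \<Sum>f\<in>{f. f facet_of T}. ?n ?u T f * facet_flux T f)"
  define M where "M = (\<Sum>T\<in>cells D ?l. \<Sum>S\<in>mcells D e. mortar_area T S)"
  have Wpos: "0 < W"
  proof -
    have "\<Union>(trace_cells D e) \<noteq> {}" unfolding trace_union[OF e] using iface_dom_facts(1)[OF e] by (simp add: closure_eq_empty)
    then obtain f0 where f0: "f0 \<in> trace_cells D e" by blast
    then obtain T0 where T0: "iface_facet D e T0 f0" by (auto simp: trace_cells_def)
    then have T0': "T0 \<in> cells D ?u" "f0 facet_of T0" by (auto simp: iface_facet_def)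
    obtain S where S: "S \<in> mcells D e" "0 < cell_overlap e S f0"
      using overlap[OF e iface_facet_interior_open[OF e T0]] by (auto simp: cell_overlap_def Int_assoc)
    have "0 < (\<Sum>S\<in>mcells D e. \<mu> e S * cell_overlap e S f0)"
      using S mcell_facts(1)[OF e] by (intro sum_pos2[of _ S]) (auto simp: \<mu>_def cell_overlap_def)
    then have "0 < trace_average \<mu> e f0" using facet_area_pos[OF e f0] e f0 by (simp add: trace_average_def)
    then have p: "0 < ?n ?u T0 f0 * facet_flux T0 f0" using normal_extend_iface[OF e T0] facet_flux_pos[OF u T0'] by simp
    have nn: "0 \<le> ?n ?u T f * facet_flux T f" if "T \<in> cells D ?u" "f facet_of T" for T f
      using n0[OF u that] facet_flux_pos[OF u that] by simp
    have "0 < (\<Sum>f\<in>{f. f facet_of T0}. ?n ?u T0 f * facet_flux T0 f)"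
      using p T0' nn finite_cell_facets[OF u] by (intro sum_pos2[of _ f0]) auto
    then show ?thesis
      unfolding W_def by (rule sum_pos2[OF cell_finite[OF u] T0'(1)]) (use nn in \<open>auto intro!: sum_nonneg\<close>)
  qed
  have Mpos: "0 < M"
  proof -
    obtain S where S: "S \<in> mcells D e" "0 < measure (flat_measure (iface_dom D e)) (rel_interior S \<inter> rel_interior Tl)"
      using overlap[OF e, of "rel_interior Tl"] cell_interior_open[OF l Tl] cell_interior_ne[OF l Tl] cell_interior[OF l Tl]
      by (auto simp: iface_dom_eq)
    have mortar_area: "mortar_area T S = measure (flat_measure (iface_dom D e)) (rel_interior S \<inter> T)" if "T \<in> cells D ?l" for T S
      unfolding mortar_area_def cell_flat[OF l that] iface_dom_eq ..
    have "measure (flat_measure (iface_dom D e)) (rel_interior S \<inter> rel_interior Tl) \<le> mortar_area Tl S"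
      unfolding mortar_area[OF Tl]
    proof (rule measure_mono_fmeasurable)
      show "rel_interior S \<inter> rel_interior Tl \<subseteq> rel_interior S \<inter> Tl" using rel_interior_subset by blast
      have b: "rel_interior S \<in> sets borel" "rel_interior Tl \<in> sets borel" "Tl \<in> sets borel"
        using mcell_facts(2)[OF e] S(1) cell_convex[OF l Tl] cell_compact[OF l Tl]
        by (auto simp: disjoint_interiors_def borel_closed compact_imp_closed intro: rel_interior_borel)
      then show "rel_interior S \<inter> rel_interior Tl \<in> sets (flat_measure (iface_dom D e))" by auto
      have "bounded (rel_interior S \<inter> Tl)" using cell_compact[OF l Tl] compact_imp_bounded bounded_subset by blast
      then show "rel_interior S \<inter> Tl \<in> fmeasurable (flat_measure (iface_dom D e))"
        using b flat_bounded_finite[OF iface_dom_facts(1,2)[OF e]] by (intro fmeasurableI) auto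
    qed
    then have "0 < mortar_area Tl S" using S(2) by linarith
    moreover have "0 \<le> mortar_area T S" for T S by (simp add: mortar_area_def)
    ultimately have "0 < (\<Sum>S\<in>mcells D e. mortar_area Tl S)" using S(1) mcell_facts(1)[OF e] by (intro sum_pos2[of _ S]) auto
    then show ?thesis
      unfolding M_def by (rule sum_pos2[OF cell_finite[OF l] Tl]) (auto simp: mortar_area_def intro!: sum_nonneg)
  qed
  have 1: "(\<Sum>i\<in>subs D. \<Sum>T\<in>cells D i. q i T * (\<Sum>f\<in>{f. f facet_of T}. ?n i T f * facet_flux T f)) = Qu * W"
  proof -
    have "(\<Sum>i\<in>subs D. \<Sum>T\<in>cells D i. q i T * (\<Sum>f\<in>{f. f facet_of T}. ?n i T f * facet_flux T f)) =
      (\<Sum>i\<in>subs D. if i = ?u then \<Sum>T\<in>cells D ?u. Qu * (\<Sum>f\<in>{f. f facet_of T}. ?n ?u T f * facet_flux T f) else 0)"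
    proof (rule sum.cong[OF refl])
      fix i assume i: "i \<in> subs D"
      show "(\<Sum>T\<in>cells D i. q i T * (\<Sum>f\<in>{f. f facet_of T}. ?n i T f * facet_flux T f)) =
        (if i = ?u then \<Sum>T\<in>cells D ?u. Qu * (\<Sum>f\<in>{f. f facet_of T}. ?n ?u T f * facet_flux T f) else 0)"
      proof (cases "i = ?u")
        case True then show ?thesis using Qu by (auto intro!: sum.cong)
      next
        case False
        have "(\<Sum>f\<in>{f. f facet_of T}. ?n i T f * facet_flux T f) = 0" if "T \<in> cells D i" for T
          using nz[OF i that _ False] by (intro sum.neutral) auto
        then show ?thesis using False by simp
      qed
    qed
    also have "\<dots> = Qu * W" using u finite_subs by (simp add: W_def sum_distrib_left)
    finally show ?thesis .
  qed
  have 2: "(\<Sum>i\<in>subs D. \<Sum>T\<in>cells D i. q i T * (\<Sum>e'\<in>{e'\<in>ifaces D. lower D e' = i}. \<Sum>S\<in>mcells D e'. \<mu> e' S * mortar_area T S)) = Ql * M"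
  proof -
    have s: "(\<Sum>e'\<in>{e'\<in>ifaces D. lower D e' = i}. \<Sum>S\<in>mcells D e'. \<mu> e' S * mortar_area T S) = (if i = ?l then \<Sum>S\<in>mcells D e. mortar_area T S else 0)" for i T
    proof -
      have "(\<Sum>e'\<in>{e'\<in>ifaces D. lower D e' = i}. \<Sum>S\<in>mcells D e'. \<mu> e' S * mortar_area T S) =
        (\<Sum>e'\<in>{e'\<in>ifaces D. lower D e' = i}. if e' = e then \<Sum>S\<in>mcells D e. mortar_area T S else 0)"
        by (intro sum.cong refl) (auto simp: \<mu>_def)
      also have "\<dots> = (if i = ?l then \<Sum>S\<in>mcells D e. mortar_area T S else 0)" using finite_ifaces e by auto
      finally show ?thesis .
    qed
    have "(\<Sum>i\<in>subs D. \<Sum>T\<in>cells D i. q i T * (\<Sum>e'\<in>{e'\<in>ifaces D. lower D e' = i}. \<Sum>S\<in>mcells D e'. \<mu> e' S * mortar_area T S)) =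
       (\<Sum>i\<in>subs D. if i = ?l then \<Sum>T\<in>cells D ?l. Ql * (\<Sum>S\<in>mcells D e. mortar_area T S) else 0)"
      unfolding s using Ql by (intro sum.cong refl) auto
    also have "\<dots> = Ql * M" using l finite_subs by (simp add: M_def sum_distrib_left)
    finally show ?thesis .
  qed
  have "0 = - (\<Sum>i\<in>subs D. \<Sum>T\<in>cells D i. q i T * ((\<Sum>f\<in>{f. f facet_of T}. ?n i T f * facet_flux T f) - (\<Sum>e'\<in>{e'\<in>ifaces D. lower D e' = i}. \<Sum>S\<in>mcells D e'. \<mu> e' S * mortar_area T S)))"
    using ker[OF r] form_b_eq[OF r, of q] by (simp only: fl snd_conv)
  also have "\<dots> = - (Qu * W - Ql * M)" unfolding right_diff_distrib sum_subtractf 1 2 ..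
  finally have "Qu * W = Ql * M" by simp
  then have "Qu = 0 \<longleftrightarrow> Ql = 0" using Wpos Mpos by (metis less_irrefl mult_eq_0_iff)
  then show ?thesis using Qu Ql Tu Tl by metis
qed

text \<open>Zero starts in a cell at the Dirichlet boundary, fills its subdomain because \<open>q\<close> is constant there, and spreads along
the chain of interfaces that links any two subdomains.\<close>

lemma ker_zero: assumes q: "q \<in> Qh D" shows "q = 0"
proof -
  let ?Z = "\<lambda>i. \<forall>T\<in>cells D i. q i T = 0"
  obtain i0 T0 f0 where d: "i0 \<in> subs D" "T0 \<in> cells D i0" "f0 facet_of T0" "rel_interior f0 \<subseteq> bdryD D" "\<not> on_iface D i0 T0 f0"
    using dirichlet_facet by blast
  have "q i0 T0 = 0"
  proof (rule ker_dirichlet[OF ker d(1,2,3,5)])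
    show "rel_interior f0 \<inter> bdryN D = {}" using d(4) bdry(2) by blast
    show "rel_interior f0 \<inter> sdom D i = {}" if "i \<in> subs D" for i using d(4) bdry_not_Omega sub_Omega[OF that] by blast
  qed
  then have z0: "?Z i0" using ker_const[OF d(1,2)] by force
  have z: "?Z k" if k: "k \<in> subs D" for k
  proof -
    have "(i0, k) \<in> ((\<lambda>e. (lower D e, upper D e)) ` ifaces D \<union> (\<lambda>e. (upper D e, lower D e)) ` ifaces D)\<^sup>*"
      using med d(1) k unfolding fractured_medium_def by blast
    then show ?thesis
    proof (induction rule: rtrancl_induct)
      case base show ?case by (rule z0)
    next
      case (step i j)
      from step(2) obtain e where "e \<in> ifaces D" "(i = lower D e \<and> j = upper D e) \<or> (i = upper D e \<and> j = lower D e)" by blast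
      then show ?case using ker_iface[of e] step(3) by metis
    qed
  qed
  show ?thesis
  proof (intro ext)
    fix i T show "q i T = 0 i T" using z q by (cases "i \<in> subs D \<and> T \<in> cells D i") (auto simp: Qh_def)
  qed
qed

end

section \<open>Continuity and the inf-sup condition\<close>

lemma triple_norm_eq: "triple_norm D (w, p) = sqrt (form_a D w w + form_aD D (grad_h D p) (grad_h D p))"
  by (simp add: triple_norm_def)

lemma form_L_eq: "form_L D (w, p) (r, q) = form_a D w r + form_aD D (grad_h D p) r + form_aD D (grad_h D q) w"
  by (simp add: form_L_def)

text \<open>The quotient in the inf-sup condition would be the meaningless \<open>0 / 0\<close>, which is \<open>0\<close> by convention, at a
nonzero pair of norm zero.  There is no such pair: a vanishing energy forces the mixed variable to vanish, and the kernel
of the discrete gradient is trivial.\<close>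

lemma triple_norm_pos:
  assumes y: "r \<in> Wh D" "q \<in> Qh D" "(r, q) \<noteq> 0" shows "0 < triple_norm D (r, q)"
proof (rule ccontr)
  interpret a: psd_form pscale "Wh D" "form_a D" by (rule form_a_psd)
  interpret d: psd_form pscale "Wh D" "form_aD D" by (rule form_aD_psd)
  have n: "0 \<le> form_a D r r" "0 \<le> form_aD D (grad_h D q) (grad_h D q)" using a.nonneg[OF y(1)] d.nonneg[OF grad_facts(1)] by auto
  assume "\<not> 0 < triple_norm D (r, q)"
  then have "form_a D r r + form_aD D (grad_h D q) (grad_h D q) \<le> 0" by (simp add: triple_norm_eq)
  then have z: "form_a D r r = 0" "form_aD D (grad_h D q) (grad_h D q) = 0" using n by linarith+
  have r: "r = 0" by (rule form_a_definite[OF y(1) z(1)])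
  have g: "grad_h D q = 0" by (rule form_aD_definite[OF grad_facts(1) z(2)])
  have "form_b D s q = 0" if "s \<in> Wh D" for s
  proof -
    have "0 = form_aD D (pscale 0 (grad_h D q)) s" using d.scale_left[OF grad_facts(1) that, of 0] by simp
    then show ?thesis using grad_facts(2)[OF that, of q] g by simp
  qed
  then have "q = 0" using y(2) by (rule ker_zero)
  then show False using r y(3) by (simp add: zero_prod_def)
qed

lemma form_L_continuity:
  assumes \<kappa>: "perm_bounds \<kappa> D" and x: "w \<in> Wh D" "r \<in> Wh D"
  shows "\<bar>form_L D (w, p) (r, q)\<bar> \<le> (1 + 2 * sqrt (16384 * max \<kappa> 0 * \<sigma>\<^sup>2 + 1)) * triple_norm D (w, p) * triple_norm D (r, q)"
  unfolding form_L_eq triple_norm_eq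
  by (rule saddle_continuity[OF form_a_psd form_aD_psd _ _ x(1) grad_facts(1) x(2) grad_facts(1)])
    (use form_aD_le[OF _ \<kappa>] in auto)

text \<open>The pressure component of the test pair is \<open>- q\<close>, so that its discrete gradient is the opposite of that of \<open>q\<close>
and the estimate \<open>saddle_infsup\<close> applies.  Dividing by the norms is legitimate by \<open>triple_norm_pos\<close>.\<close>

lemma form_L_infsup:
  assumes y: "r \<in> Wh D" "q \<in> Qh D" "(r, q) \<noteq> 0"
  shows "\<exists>x\<in>Wh D \<times> Qh D - {0}. 1/12 \<le> form_L D x (r, q) / (triple_norm D x * triple_norm D (r, q))"
proof -
  interpret d: psd_form pscale "Wh D" "form_aD D" by (rule form_aD_psd)
  let ?Q = "grad_h D q"
  define w where "w = r + pscale (1/2) ?Q"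
  define p where "p = (\<lambda>i T. - q i T)"
  have Q: "?Q \<in> Wh D" by (rule grad_facts(1))
  have w: "w \<in> Wh D" unfolding w_def using y(1) Q Wh_subspace by (intro pscale.subspace_add pscale.subspace_scale)
  have p: "p \<in> Qh D" using y(2) by (simp add: p_def Qh_def)
  have P: "grad_h D p = pscale (-1) ?Q" unfolding p_def by (rule grad_neg)
  have m1: "form_aD D (pscale (-1) ?Q) s = - form_aD D ?Q s" if "s \<in> Wh D" for s
    using d.scale_left[OF Q that, of "-1"] by (simp only: mult_minus1)
  have P2: "pscale (-1) ?Q \<in> Wh D" using Q Wh_subspace by (intro pscale.subspace_scale)
  have pp: "form_aD D (grad_h D p) (grad_h D p) = form_aD D ?Q ?Q"
    unfolding P m1[OF P2] using d.scale_right[OF Q Q, of "-1"] by (simp only: mult_minus1 minus_minus)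
  have ne: "(w, p) \<noteq> 0"
  proof
    assume 0: "(w, p) = 0"
    then have "p = 0" "w = 0" by (simp_all add: zero_prod_def)
    then have q0: "q = 0" by (auto simp: p_def fun_eq_iff)
    \<comment> \<open>\<open>b\<close> is odd in \<open>q\<close>, so \<open>q = 0\<close> has a discrete gradient of energy zero\<close>
    have "form_b D ?Q q = - form_b D ?Q q"
    proof -
      have "(\<lambda>i T. - q i T) = q" using q0 by (auto simp: fun_eq_iff)
      then show ?thesis using form_b_neg[OF Q, of q] by metis
    qed
    then have "form_aD D ?Q ?Q = 0" using grad_facts(2)[OF Q, of q] by linarith
    then have "?Q = 0" by (rule form_aD_definite[OF Q])
    then have "r = 0" using \<open>w = 0\<close> unfolding w_def by (simp only: pscale.scale_zero_right add_0_right)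
    then show False using q0 y(3) by (simp add: zero_prod_def)
  qed
  have "1/12 * (triple_norm D (w, p) * triple_norm D (r, q)) \<le> form_L D (w, p) (r, q)"
    using saddle_infsup[OF form_a_psd form_aD_psd form_a_le y(1) Q]
    unfolding triple_norm_eq form_L_eq pp unfolding P m1[OF y(1)] w_def[symmetric] by simp
  then have "1/12 \<le> form_L D (w, p) (r, q) / (triple_norm D (w, p) * triple_norm D (r, q))"
    using triple_norm_pos[OF w p ne] triple_norm_pos[OF y] by (simp add: pos_le_divide_eq)
  then show ?thesis using w p ne by blast
qed

end

text \<open>The inf-sup constant \<open>1/12\<close> is independent even of \<open>\<sigma>\<close> and \<open>\<kappa>\<close>; both enter the continuity constant only,
through the bound of the lumped energy by the exact one.\<close>

theorem theorem4p3:
  fixes \<sigma> :: real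
  assumes "DIM('a::euclidean_space) = 2 \<or> DIM('a) = 3"
  shows
    "(\<forall>\<kappa>. \<exists>\<alpha>>0. \<forall>D :: 'a discretization. admissible \<sigma> D \<and> perm_bounds \<kappa> D \<longrightarrow>
        (\<forall>x\<in>Wh D \<times> Qh D. \<forall>y\<in>Wh D \<times> Qh D.
           \<bar>form_L D x y\<bar> \<le> \<alpha> * triple_norm D x * triple_norm D y)) \<and>
     (\<exists>\<beta>>0. \<forall>D :: 'a discretization. admissible \<sigma> D \<longrightarrow>
        (INF y\<in>Wh D \<times> Qh D - {0}. SUP x\<in>Wh D \<times> Qh D - {0}.
           ereal (form_L D x y / (triple_norm D x * triple_norm D y))) \<ge> ereal \<beta>)"
proof (intro conjI allI)
  fix \<kappa> :: real
  let ?\<alpha> = "1 + 2 * sqrt (16384 * max \<kappa> 0 * \<sigma>\<^sup>2 + 1)"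
  have "0 \<le> sqrt (16384 * max \<kappa> 0 * \<sigma>\<^sup>2 + 1)" by simp
  then have "0 < ?\<alpha>" by linarith
  moreover have "\<bar>form_L D x y\<bar> \<le> ?\<alpha> * triple_norm D x * triple_norm D y"
    if "admissible \<sigma> D \<and> perm_bounds \<kappa> D" "x \<in> Wh D \<times> Qh D" "y \<in> Wh D \<times> Qh D" for D :: "'a discretization" and x y
  proof -
    interpret fractured_disc D \<sigma> using that(1) assms by unfold_locales auto
    show ?thesis using form_L_continuity[of \<kappa> "fst x" "fst y" "snd x" "snd y"] that by auto
  qed
  ultimately show "\<exists>\<alpha>>0. \<forall>D :: 'a discretization. admissible \<sigma> D \<and> perm_bounds \<kappa> D \<longrightarrow>
        (\<forall>x\<in>Wh D \<times> Qh D. \<forall>y\<in>Wh D \<times> Qh D. \<bar>form_L D x y\<bar> \<le> \<alpha> * triple_norm D x * triple_norm D y)"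
    by blast
next
  have "ereal (1/12) \<le> (INF y\<in>Wh D \<times> Qh D - {0}. SUP x\<in>Wh D \<times> Qh D - {0}.
           ereal (form_L D x y / (triple_norm D x * triple_norm D y)))" if "admissible \<sigma> D" for D :: "'a discretization"
  proof (rule INF_greatest)
    interpret fractured_disc D \<sigma> using that assms by unfold_locales auto
    fix y assume y: "y \<in> Wh D \<times> Qh D - {0}"
    obtain r q where rq: "y = (r, q)" by (cases y)
    obtain x where x: "x \<in> Wh D \<times> Qh D - {0}" "1/12 \<le> form_L D x y / (triple_norm D x * triple_norm D y)"
      using form_L_infsup[of r q] y unfolding rq by blast
    show "ereal (1/12) \<le> (SUP x\<in>Wh D \<times> Qh D - {0}. ereal (form_L D x y / (triple_norm D x * triple_norm D y)))"
      by (rule SUP_upper2[OF x(1)]) (use x(2) in simp)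
  qed
  then show "\<exists>\<beta>>0. \<forall>D :: 'a discretization. admissible \<sigma> D \<longrightarrow>
        (INF y\<in>Wh D \<times> Qh D - {0}. SUP x\<in>Wh D \<times> Qh D - {0}.
           ereal (form_L D x y / (triple_norm D x * triple_norm D y))) \<ge> ereal \<beta>"
    by (intro exI[of _ "1/12"]) auto
qed

end
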